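(* Let $\sigma>0$ and let $\nu,\mu\in\mathbb{T}$ with $\nu^2=\mu^2=-1$. The functions $$h^\sigma_{m,n,m',n'}(Z):=\mathcal{V}^{\sigma,\nu,\mu}_{\mathbb{R}^2,\mathbb{T}}\left(h^\sigma_{m,n},h^\sigma_{m',n'}\right)(Z),$$ for varying $m,n,m',n'=0,1,2,\dots$, form an orthogonal basis of $L^2_{\mathbb{T}}(\mathbb{T})$.
   Context: Bicomplex numbers: $\mathbb{T}=\{Z=z_1+jz_2:\ z_1,z_2\in\mathbb{C}\}$ with $i^2=j^2=-1$, $ij=ji$. The idempotents $e_\pm=\frac{1\pm ij}{2}$ satisfy $e_\pm^2=e_\pm$, $e_+e_-=0$, $e_++e_-=1$; every bicomplex number is uniquely $ae_++be_-$ with $a,b\in\mathbb{C}$. Conjugation: $(ae_++be_-)^*=\bar a e_++\bar b e_-$. Exponentials are computed componentwise. Function spaces: $L^2_{\mathbb{T}}(X)$ is the space of functions $f=f^+e_++f^-e_-$ with $f^\pm\in L^2_{\mathbb{C}}(X)$, with $\mathbb{T}$-valued inner product $\langle f,g\rangle=\int_X f g^*\,d\lambda$; here $X=\mathbb{R}^2\cong\mathbb{C}$ or $X=\mathbb{T}\cong\mathbb{C}^2\cong\mathbb{R}^4$ (via $Z=z_1+jz_2\mapsto(z_1,z_2)$) with Lebesgue measure. An orthogonal basis of a $\mathbb{T}$-Hilbert space is a family of nonzero elements with pairwise vanishing $\mathbb{T}$-valued inner products such that every element has a unique convergent expansion with coefficients in $\mathbb{T}$. Polyanalytic complex Hermite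 functions: for $\xi\in\mathbb{C}\cong\mathbb{R}^2$, $$h^\sigma_{m,n}(\xi,\bar\xi)=(-1)^{m+n}e^{\frac{\sigma}{2}|\xi|^2}\frac{\partial^{m+n}}{\partial\bar\xi^m\partial\xi^n}\left(e^{-\sigma|\xi|^2}\right),$$ viewed in $L^2_{\mathbb{T}}(\mathbb{R}^2)$ as $h^\sigma_{m,n}e_++h^\sigma_{m,n}e_-$. Bidimensional bicomplex Fourier--Wigner transform: for $\varphi,\psi\in L^2_{\mathbb{T}}(\mathbb{R}^2)$ and $Z=z_1+jz_2$, $z_\ell=x_\ell+iy_\ell$, $X=(x_1,x_2)$, $Y=(y_1,y_2)$, $$\mathcal{V}^{\sigma,\nu,\mu}_{\mathbb{R}^2,\mathbb{T}}(\varphi,\psi)(Z)=\frac{\sigma}{2\pi}\int_{\mathbb{R}^2}e^{\sigma(\nu e_++\mu e_-)\langle U-\frac X2,Y\rangle_{\mathbb{R}^2}}\varphi(U)\,\psi^*(U-X)\,d\lambda(U),$$ where $\psi^*(U):=(\psi(U))^*$. Here $\nu,\mu\in\mathbb{T}$ satisfy $\nu^2=\mu^2=-1$ (each is one of $\pm i,\pm j$). *)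

theory Defs
  imports "HOL-Analysis.Analysis"
begin

section \<open>Bicomplex numbers\<close>

text \<open>\<open>Bicomplex z1 z2\<close> stands for \<open>z1 + j z2\<close>.\<close>

datatype bicomplex = Bicomplex (bc1: complex) (bc2: complex)

lemma bicomplex_eq_iff: "Z = W \<longleftrightarrow> bc1 Z = bc1 W \<and> bc2 Z = bc2 W"
  by (cases Z; cases W) simp

instantiation bicomplex :: comm_ring_1
begin

definition "0 = Bicomplex 0 0"
definition "1 = Bicomplex 1 0"
definition "Z + W = Bicomplex (bc1 Z + bc1 W) (bc2 Z + bc2 W)"
definition "- Z = Bicomplex (- bc1 Z) (- bc2 Z)"
definition "Z - W = Bicomplex (bc1 Z - bc1 W) (bc2 Z - bc2 W)"
definition "Z * W = Bicomplex (bc1 Z * bc1 W - bc2 Z * bc2 W) (bc1 Z * bc2 W + bc2 Z * bc1 W)"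

instance
  by standard
    (simp_all add: zero_bicomplex_def one_bicomplex_def plus_bicomplex_def uminus_bicomplex_def
      minus_bicomplex_def times_bicomplex_def algebra_simps)

end

lemma bicomplex_sel [simp]:
  "bc1 0 = 0" "bc2 0 = 0" "bc1 1 = 1" "bc2 1 = 0"
  "bc1 (Z + W) = bc1 Z + bc1 W" "bc2 (Z + W) = bc2 Z + bc2 W"
  "bc1 (- Z) = - bc1 Z" "bc2 (- Z) = - bc2 Z"
  "bc1 (Z - W) = bc1 Z - bc1 W" "bc2 (Z - W) = bc2 Z - bc2 W"
  "bc1 (Z * W) = bc1 Z * bc1 W - bc2 Z * bc2 W"
  "bc2 (Z * W) = bc1 Z * bc2 W + bc2 Z * bc1 W"
  by (simp_all add: zero_bicomplex_def one_bicomplex_def plus_bicomplex_def uminus_bicomplex_def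
      minus_bicomplex_def times_bicomplex_def)

instantiation bicomplex :: real_algebra_1
begin

definition "r *\<^sub>R Z = Bicomplex (r *\<^sub>R bc1 Z) (r *\<^sub>R bc2 Z)"

instance
  by standard (simp_all add: bicomplex_eq_iff scaleR_bicomplex_def algebra_simps)

end

lemma bicomplex_sel_scaleR [simp]: "bc1 (r *\<^sub>R Z) = r *\<^sub>R bc1 Z" "bc2 (r *\<^sub>R Z) = r *\<^sub>R bc2 Z"
  by (simp_all add: scaleR_bicomplex_def)

text \<open>The Euclidean structure is the one transported from \<open>\<complex>\<^sup>2 = \<real>\<^sup>4\<close> along
  \<open>z1 + j z2 \<mapsto> (z1, z2)\<close>, so that \<open>lborel\<close> on \<^typ>\<open>bicomplex\<close> is the Lebesgue measure
  of \<open>\<real>\<^sup>4\<close>.  This norm is not submultiplicative, so \<^typ>\<open>bicomplex\<close> is not made a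
  normed algebra.\<close>

instantiation bicomplex :: real_inner
begin

definition "inner Z W = inner (bc1 Z) (bc1 W) + inner (bc2 Z) (bc2 W)"
definition "norm (Z :: bicomplex) = sqrt (inner Z Z)"
definition "sgn (Z :: bicomplex) = Z /\<^sub>R norm Z"
definition "dist (Z :: bicomplex) W = norm (Z - W)"
definition [code del]:
  "(uniformity :: (bicomplex \<times> bicomplex) filter) = (INF e\<in>{0 <..}. principal {(x, y). dist x y < e})"
definition [code del]:
  "open (U :: bicomplex set) \<longleftrightarrow> (\<forall>x\<in>U. eventually (\<lambda>(x', y). x' = x \<longrightarrow> y \<in> U) uniformity)"

instance
proof
  fix r :: real and Z W V :: bicomplex and U :: "bicomplex set"
  show "inner Z W = inner W Z" "inner (Z + W) V = inner Z V + inner W V"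
    "inner (r *\<^sub>R Z) W = r * inner Z W" "0 \<le> inner Z Z"
    by (simp_all add: inner_bicomplex_def inner_commute inner_add_left inner_add_right
        distrib_left)
  show "inner Z Z = 0 \<longleftrightarrow> Z = 0"
    by (simp add: inner_bicomplex_def add_nonneg_eq_0_iff bicomplex_eq_iff)
qed (rule norm_bicomplex_def sgn_bicomplex_def dist_bicomplex_def uniformity_bicomplex_def
      open_bicomplex_def)+

end

instantiation bicomplex :: euclidean_space
begin

definition "Basis = {Bicomplex 1 0, Bicomplex \<i> 0, Bicomplex 0 1, Bicomplex 0 \<i>}"

instance
proof
  show "(\<forall>u\<in>Basis. inner Z u = 0) \<longleftrightarrow> Z = 0" for Z :: bicomplex
    by (auto simp: Basis_bicomplex_def inner_bicomplex_def bicomplex_eq_iff complex_eq_iff)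
qed (auto simp: Basis_bicomplex_def inner_bicomplex_def)

end

definition of_cx :: "complex \<Rightarrow> bicomplex"
  where "of_cx z = Bicomplex z 0"

definition bc_i :: bicomplex where "bc_i = of_cx \<i>"

definition bc_j :: bicomplex where "bc_j = Bicomplex 0 1"

definition e_plus :: bicomplex where "e_plus = (1/2) *\<^sub>R (1 + bc_i * bc_j)"

definition e_minus :: bicomplex where "e_minus = (1/2) *\<^sub>R (1 - bc_i * bc_j)"

text \<open>The coefficients of \<open>Z = a e\<^sub>+ + b e\<^sub>-\<close>; see \<open>idem_eq_iff\<close> below.\<close>

definition plus_part :: "bicomplex \<Rightarrow> complex"
  where "plus_part Z = bc1 Z - \<i> * bc2 Z"

definition minus_part :: "bicomplex \<Rightarrow> complex"
  where "minus_part Z = bc1 Z + \<i> * bc2 Z"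

definition idem :: "complex \<Rightarrow> complex \<Rightarrow> bicomplex"
  where "idem a b = of_cx a * e_plus + of_cx b * e_minus"

lemma Bicomplex_eq: "Bicomplex z1 z2 = of_cx z1 + bc_j * of_cx z2"
  by (simp add: bicomplex_eq_iff of_cx_def bc_j_def)

lemma bc_units: "bc_i * bc_i = - 1" "bc_j * bc_j = - 1"
  by (simp_all add: bicomplex_eq_iff of_cx_def bc_i_def bc_j_def)

lemma e_plus_minus:
  "e_plus * e_plus = e_plus" "e_minus * e_minus = e_minus" "e_plus * e_minus = 0"
  "e_plus + e_minus = 1"
  by (simp_all add: bicomplex_eq_iff e_plus_def e_minus_def of_cx_def bc_i_def bc_j_def
      complex_eq_iff)

lemma idem_eq_iff: "Z = idem a b \<longleftrightarrow> a = plus_part Z \<and> b = minus_part Z"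
  by (auto simp: bicomplex_eq_iff idem_def plus_part_def minus_part_def e_plus_def e_minus_def
      of_cx_def bc_i_def bc_j_def complex_eq_iff field_simps)

lemma norm_bicomplex_parts:
  "(norm Z)\<^sup>2 = ((norm (plus_part Z))\<^sup>2 + (norm (minus_part Z))\<^sup>2) / 2" for Z :: bicomplex
  unfolding norm_bicomplex_def inner_bicomplex_def cmod_power2
  by (simp add: plus_part_def minus_part_def inner_complex_def)
    (simp add: power2_eq_square algebra_simps)

definition bc_cnj :: "bicomplex \<Rightarrow> bicomplex"
  where "bc_cnj Z = idem (cnj (plus_part Z)) (cnj (minus_part Z))"

definition bc_exp :: "bicomplex \<Rightarrow> bicomplex"
  where "bc_exp Z = idem (exp (plus_part Z)) (exp (minus_part Z))"

section \<open>The space of square-integrable bicomplex-valued functions\<close>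

text \<open>Elements of \<open>L\<^sup>2\<close> are represented by functions; equality in \<open>L\<^sup>2\<close> is equality almost
  everywhere.\<close>

definition L2_C :: "('a::euclidean_space \<Rightarrow> complex) set"
  where "L2_C = {f \<in> borel_measurable lborel. integrable lborel (\<lambda>x. (norm (f x))\<^sup>2)}"

definition L2_T :: "('a::euclidean_space \<Rightarrow> bicomplex) set"
  where "L2_T = {f. (\<lambda>x. plus_part (f x)) \<in> L2_C \<and> (\<lambda>x. minus_part (f x)) \<in> L2_C}"

definition L2_inner :: "('a::euclidean_space \<Rightarrow> bicomplex) \<Rightarrow> ('a \<Rightarrow> bicomplex) \<Rightarrow> bicomplex"
  where "L2_inner f g = (LINT x|lborel. f x * bc_cnj (g x))"

text \<open>Since \<open>|Z|\<^sup>2 = (|a|\<^sup>2 + |b|\<^sup>2) / 2\<close> for \<open>Z = a e\<^sub>+ + b e\<^sub>-\<close>, this is the norm with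
  \<open>\<parallel>f\<parallel>\<^sup>2 = (\<parallel>f\<^sup>+\<parallel>\<^sup>2 + \<parallel>f\<^sup>-\<parallel>\<^sup>2) / 2\<close>.  Only meaningful on \<^const>\<open>L2_T\<close>.\<close>

definition L2_norm :: "('a::euclidean_space \<Rightarrow> bicomplex) \<Rightarrow> real"
  where "L2_norm f = sqrt (LINT x|lborel. (norm (f x))\<^sup>2)"

text \<open>\<open>f = \<Sum>k. c k * b k\<close>, the sum over all indices converging unconditionally in \<open>L\<^sup>2\<close>.\<close>

definition L2_has_expansion ::
    "('k \<Rightarrow> 'a::euclidean_space \<Rightarrow> bicomplex) \<Rightarrow> ('a \<Rightarrow> bicomplex) \<Rightarrow> ('k \<Rightarrow> bicomplex) \<Rightarrow> bool"
  where "L2_has_expansion b f c \<longleftrightarrow>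
    ((\<lambda>F. L2_norm (\<lambda>x. f x - (\<Sum>k\<in>F. c k * b k x))) \<longlongrightarrow> 0) (finite_subsets_at_top UNIV)"

definition L2_orthogonal_basis :: "('k \<Rightarrow> 'a::euclidean_space \<Rightarrow> bicomplex) \<Rightarrow> bool"
  where "L2_orthogonal_basis b \<longleftrightarrow>
    (\<forall>k. b k \<in> L2_T \<and> \<not> (AE x in lborel. b k x = 0)) \<and>
    (\<forall>k l. k \<noteq> l \<longrightarrow> L2_inner (b k) (b l) = 0) \<and>
    (\<forall>f\<in>L2_T. \<exists>!c. L2_has_expansion b f c)"

section \<open>Polyanalytic complex Hermite functions\<close>

definition partial_x :: "(complex \<Rightarrow> complex) \<Rightarrow> complex \<Rightarrow> complex"
  where "partial_x f z = vector_derivative (\<lambda>t. f (z + of_real t)) (at 0)"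

definition partial_y :: "(complex \<Rightarrow> complex) \<Rightarrow> complex \<Rightarrow> complex"
  where "partial_y f z = vector_derivative (\<lambda>t. f (z + \<i> * of_real t)) (at 0)"

definition wirtinger :: "(complex \<Rightarrow> complex) \<Rightarrow> complex \<Rightarrow> complex"
  where "wirtinger f z = (partial_x f z - \<i> * partial_y f z) / 2"

definition wirtinger_bar :: "(complex \<Rightarrow> complex) \<Rightarrow> complex \<Rightarrow> complex"
  where "wirtinger_bar f z = (partial_x f z + \<i> * partial_y f z) / 2"

definition hermite :: "real \<Rightarrow> nat \<Rightarrow> nat \<Rightarrow> complex \<Rightarrow> complex"
  where "hermite \<sigma> m n \<xi> = (- 1) ^ (m + n) * of_real (exp (\<sigma> / 2 * (norm \<xi>)\<^sup>2)) *
    (wirtinger_bar ^^ m) ((wirtinger ^^ n) (\<lambda>\<zeta>. of_real (exp (- \<sigma> * (norm \<zeta>)\<^sup>2)))) \<xi>"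

definition hermite_T :: "real \<Rightarrow> nat \<Rightarrow> nat \<Rightarrow> complex \<Rightarrow> bicomplex"
  where "hermite_T \<sigma> m n \<xi> = of_cx (hermite \<sigma> m n \<xi>) * e_plus + of_cx (hermite \<sigma> m n \<xi>) * e_minus"

section \<open>The bidimensional bicomplex Fourier--Wigner transform\<close>

text \<open>Points of \<open>\<real>\<^sup>2\<close> are of type \<^typ>\<open>complex\<close>.  For \<open>Z = (x1 + i y1) + j (x2 + i y2)\<close>,
  these are \<open>X = (x1, x2)\<close> and \<open>Y = (y1, y2)\<close>, not the two components of \<open>Z\<close>.\<close>

definition re_vec :: "bicomplex \<Rightarrow> complex"
  where "re_vec Z = Complex (Re (bc1 Z)) (Re (bc2 Z))"

definition im_vec :: "bicomplex \<Rightarrow> complex"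
  where "im_vec Z = Complex (Im (bc1 Z)) (Im (bc2 Z))"

definition fourier_wigner :: "real \<Rightarrow> bicomplex \<Rightarrow> bicomplex \<Rightarrow>
    (complex \<Rightarrow> bicomplex) \<Rightarrow> (complex \<Rightarrow> bicomplex) \<Rightarrow> bicomplex \<Rightarrow> bicomplex"
  where "fourier_wigner \<sigma> \<nu> \<mu> \<phi> \<psi> Z = (\<sigma> / (2 * pi)) *\<^sub>R
    (LINT U|lborel.
      bc_exp ((\<sigma> * inner (U - re_vec Z / 2) (im_vec Z)) *\<^sub>R (\<nu> * e_plus + \<mu> * e_minus)) *
      \<phi> U * bc_cnj (\<psi> (U - re_vec Z)))"

end

theory Submission
  imports Defs "HOL-Probability.Levy"
begin

text \<open>
  In each idempotent component the transform is an integral against \<open>exp (\<sigma> \<epsilon> \<langle>U - X/2, Y\<rangle>)\<close>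
  with \<open>\<epsilon> = \<plusminus> \<i>\<close>.  With \<open>X\<close>, \<open>Y\<close> read as complex numbers, put \<open>P = (X + \<epsilon> Y) / 2\<close> and
  \<open>R = cnj ((X - \<epsilon> Y) / 2)\<close>.  Up to the factor \<open>\<plusminus> 1/2\<close>, the transform of \<open>h\<^bsub>m,n\<^esub>\<close>, \<open>h\<^bsub>m',n'\<^esub>\<close> is
  \<open>h\<^bsub>m,m'\<^esub>(P) h\<^bsub>n,n'\<^esub>(R)\<close>: integrating Wirtinger derivatives of the integrand gives recurrences
  in the four indices, which are those of the product on the right.  The change of variables
  \<open>(X, Y) \<mapsto> (P, R)\<close> is linear with constant Jacobian, so the claim becomes that tensor products of
  Hermite functions form an orthogonal basis.  Orthogonality is the case \<open>X = Y = 0\<close> of the same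
  recurrences.  Totality reduces, slice by slice, to the line: a function orthogonal to all
  \<open>x\<^sup>n exp (- \<sigma> x\<^sup>2 / 2)\<close> has, after multiplication by the Gaussian, vanishing Fourier transform,
  and Levy's uniqueness theorem applies.  Totality in the sense of a trivial orthogonal complement
  yields expansions because \<open>L\<^sup>2\<close> is complete.
\<close>

section \<open>The Hilbert space of square-integrable complex functions\<close>

text \<open>The transform couples four indices, with no visible product structure. Centring, U = X/2
  + w, merges the two Gaussians and the exponential into one Gaussian with a phase, with parameters
  a = X/2 and p = \<epsilon> cnj Y / 2. Integration by parts then cancels every term that stays
  within one polynomial and leaves terms linking m only to m' and n only to n'. This is the origin
  of the regrouping of the indices, and P = a - cnj p and R = cnj a + p are the coefficients that
  survive. The factor 1/2 is \<sigma>/(2 pi) times pi/\<sigma>, the mass of the Gaussian for p = 0;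
  its sign is collected by the recurrences in m' and n'.

  Bicomplex numbers have zero divisors, so non-vanishing in one idempotent component says nothing
  about the other: both components have to be shown to be orthogonal bases. One argument with
  \<epsilon> = i or - i serves for both.\<close>

definition ip_C :: "('a::euclidean_space \<Rightarrow> complex) \<Rightarrow> ('a \<Rightarrow> complex) \<Rightarrow> complex"
  where "ip_C f g = (LINT x|lborel. f x * cnj (g x))"

definition sq_C :: "('a::euclidean_space \<Rightarrow> complex) \<Rightarrow> real"
  where "sq_C f = (LINT x|lborel. (norm (f x))\<^sup>2)"

lemma measurable_cnj [measurable]: "cnj \<in> borel \<rightarrow>\<^sub>M borel"
  by (intro borel_measurable_continuous_onI continuous_intros)

lemma L2_C_measurable: "f \<in> L2_C \<Longrightarrow> f \<in> borel_measurable borel"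
  by (simp add: L2_C_def)

lemma L2_C_norm_mult_integrable:
  assumes "f \<in> L2_C" "g \<in> L2_C"
  shows "integrable lborel (\<lambda>x. norm (f x) * norm (g x))"
proof (rule Bochner_Integration.integrable_bound)
  show "integrable lborel (\<lambda>x. (norm (f x))\<^sup>2 + (norm (g x))\<^sup>2)"
    using assms by (simp add: L2_C_def)
  have [measurable]: "f \<in> borel_measurable borel" "g \<in> borel_measurable borel"
    using assms by (simp_all add: L2_C_measurable)
  show "(\<lambda>x. norm (f x) * norm (g x)) \<in> borel_measurable lborel"
    by measurable
  have "a * b \<le> a\<^sup>2 + b\<^sup>2" if "0 \<le> a" "0 \<le> b" for a b :: real
  proof -
    have "2 * (a * b) \<le> a\<^sup>2 + b\<^sup>2" using sum_squares_bound[of a b] by simp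
    moreover have "0 \<le> a * b" using that by simp
    ultimately show ?thesis by linarith
  qed
  then show "AE x in lborel. norm (norm (f x) * norm (g x))
      \<le> norm ((norm (f x))\<^sup>2 + (norm (g x))\<^sup>2)"
    by simp
qed

lemma L2_C_mult_integrable:
  assumes "f \<in> L2_C" "g \<in> L2_C"
  shows "integrable lborel (\<lambda>x. f x * g x)"
proof -
  have [measurable]: "f \<in> borel_measurable borel" "g \<in> borel_measurable borel"
    using assms by (simp_all add: L2_C_measurable)
  show ?thesis
    by (rule Bochner_Integration.integrable_bound[OF L2_C_norm_mult_integrable[OF assms]])
      (auto simp: norm_mult)
qed

lemma L2_C_cnj: "f \<in> L2_C \<Longrightarrow> (\<lambda>x. cnj (f x)) \<in> L2_C"
  by (auto simp: L2_C_def intro!: borel_measurable_continuous_on[of cnj] continuous_intros)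

lemma ip_C_integrable: "f \<in> L2_C \<Longrightarrow> g \<in> L2_C \<Longrightarrow> integrable lborel (\<lambda>x. f x * cnj (g x))"
  by (rule L2_C_mult_integrable[OF _ L2_C_cnj])

lemma L2_C_add:
  assumes "f \<in> L2_C" "g \<in> L2_C"
  shows "(\<lambda>x. f x + g x) \<in> L2_C"
proof -
  have [measurable]: "f \<in> borel_measurable borel" "g \<in> borel_measurable borel"
    using assms by (simp_all add: L2_C_measurable)
  have i: "integrable lborel (\<lambda>x. 2 * (norm (f x))\<^sup>2 + 2 * (norm (g x))\<^sup>2)"
    using assms by (simp add: L2_C_def)
  have b: "(norm (a + b))\<^sup>2 \<le> 2 * (norm a)\<^sup>2 + 2 * (norm b)\<^sup>2" for a b :: complex
  proof -
    have "(norm (a + b))\<^sup>2 \<le> (norm a + norm b)\<^sup>2"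
      by (simp add: norm_triangle_ineq power_mono)
    also have "\<dots> \<le> 2 * (norm a)\<^sup>2 + 2 * (norm b)\<^sup>2"
      using sum_squares_bound[of "norm a" "norm b"] by (simp add: power2_sum)
    finally show ?thesis .
  qed
  have "integrable lborel (\<lambda>x. (norm (f x + g x))\<^sup>2)"
    by (rule Bochner_Integration.integrable_bound[OF i]) (auto intro!: AE_I2 b)
  then show ?thesis by (simp add: L2_C_def)
qed

lemma L2_C_cmult: "f \<in> L2_C \<Longrightarrow> (\<lambda>x. c * f x) \<in> L2_C"
  by (auto simp: L2_C_def norm_mult power_mult_distrib)

lemma L2_C_diff: "f \<in> L2_C \<Longrightarrow> g \<in> L2_C \<Longrightarrow> (\<lambda>x. f x - g x) \<in> L2_C"
  using L2_C_add[OF _ L2_C_cmult[of g "-1"], of f] by simp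

lemma L2_C_sum: "(\<And>k. k \<in> F \<Longrightarrow> b k \<in> L2_C) \<Longrightarrow> (\<lambda>x. \<Sum>k\<in>F. b k x) \<in> L2_C"
  by (induction F rule: infinite_finite_induct) (simp_all add: L2_C_add, simp_all add: L2_C_def)

lemma sq_C_eq_ip_C: "of_real (sq_C f) = ip_C f f"
proof -
  have "ip_C f f = (LINT x|lborel. complex_of_real ((norm (f x))\<^sup>2))"
    unfolding ip_C_def by (simp add: complex_norm_square[symmetric] del: of_real_power)
  also have "\<dots> = of_real (sq_C f)"
    unfolding sq_C_def by (rule integral_complex_of_real)
  finally show ?thesis by simp
qed

lemma sq_C_nonneg: "0 \<le> sq_C f"
  by (simp add: sq_C_def)

lemma ip_C_cnj: "cnj (ip_C f g) = ip_C g f"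
  unfolding ip_C_def by (subst Bochner_Integration.integral_cnj[symmetric]) (simp add: mult.commute)

lemma ip_C_add_left:
  "f \<in> L2_C \<Longrightarrow> g \<in> L2_C \<Longrightarrow> h \<in> L2_C \<Longrightarrow> ip_C (\<lambda>x. f x + g x) h = ip_C f h + ip_C g h"
  by (simp add: ip_C_def ip_C_integrable distrib_right)

lemma ip_C_diff_left:
  "f \<in> L2_C \<Longrightarrow> g \<in> L2_C \<Longrightarrow> h \<in> L2_C \<Longrightarrow> ip_C (\<lambda>x. f x - g x) h = ip_C f h - ip_C g h"
  by (simp add: ip_C_def ip_C_integrable left_diff_distrib)

lemma ip_C_cmult_left: "ip_C (\<lambda>x. c * f x) h = c * ip_C f h"
  by (simp add: ip_C_def mult.assoc)

lemma ip_C_sum_left: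
  "(\<And>k. k \<in> F \<Longrightarrow> b k \<in> L2_C) \<Longrightarrow> h \<in> L2_C \<Longrightarrow>
    ip_C (\<lambda>x. \<Sum>k\<in>F. c k * b k x) h = (\<Sum>k\<in>F. c k * ip_C (b k) h)"
proof (induction F rule: infinite_finite_induct)
  case (insert k F)
  have "ip_C (\<lambda>x. \<Sum>k\<in>insert k F. c k * b k x) h
      = ip_C (\<lambda>x. c k * b k x + (\<Sum>k\<in>F. c k * b k x)) h"
    using insert by simp
  also have "\<dots> = c k * ip_C (b k) h + ip_C (\<lambda>x. \<Sum>k\<in>F. c k * b k x) h"
    using insert by (subst ip_C_add_left) (auto intro!: L2_C_cmult L2_C_sum simp: ip_C_cmult_left)
  finally show ?case using insert by simp
qed (auto simp: ip_C_def)

lemma sq_C_eq_0_imp_AE: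
  assumes "f \<in> L2_C" "sq_C f = 0"
  shows "AE x in lborel. f x = 0"
  using assms integral_nonneg_eq_0_iff_AE[of lborel "\<lambda>x. (norm (f x))\<^sup>2"]
  by (simp add: sq_C_def L2_C_def)

lemma sq_C_cong_AE:
  assumes "f \<in> L2_C" "g \<in> L2_C" "AE x in lborel. f x = g x"
  shows "sq_C f = sq_C g"
proof -
  have [measurable]: "f \<in> borel_measurable borel" "g \<in> borel_measurable borel"
    using assms by (simp_all add: L2_C_measurable)
  show ?thesis unfolding sq_C_def
    by (rule integral_cong_AE) (use assms(3) in auto)
qed

text \<open>Weighted AM-GM, integrated: if a and b are the norms of f and g, then the weights b / a
  and a / b give exactly a * b. This needs both norms to be nonzero; otherwise the product vanishes
  almost everywhere.\<close>

lemma L2_C_Cauchy_Schwarz: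
  assumes f: "f \<in> L2_C" and g: "g \<in> L2_C"
  shows "(LINT x|lborel. norm (f x) * norm (g x)) \<le> sqrt (sq_C f) * sqrt (sq_C g)"
proof (cases "sq_C f = 0 \<or> sq_C g = 0")
  case True
  then have "AE x in lborel. norm (f x) * norm (g x) = 0"
  proof
    assume "sq_C f = 0"
    from sq_C_eq_0_imp_AE[OF f this] show ?thesis by eventually_elim simp
  next
    assume "sq_C g = 0"
    from sq_C_eq_0_imp_AE[OF g this] show ?thesis by eventually_elim simp
  qed
  then have "(LINT x|lborel. norm (f x) * norm (g x)) = 0"
    by (rule integral_eq_zero_AE)
  then show ?thesis by (simp add: sq_C_nonneg)
next
  case False
  define a b where "a = sqrt (sq_C f)" and "b = sqrt (sq_C g)"
  have ab: "a > 0" "b > 0" "sq_C f = a\<^sup>2" "sq_C g = b\<^sup>2"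
    using False sq_C_nonneg[of f] sq_C_nonneg[of g] by (auto simp: a_def b_def)
  have "norm (f x) * norm (g x) \<le> (b / a * (norm (f x))\<^sup>2 + a / b * (norm (g x))\<^sup>2) / 2" for x
  proof -
    have "2 * (norm (f x) * b) * (norm (g x) * a) \<le> (norm (f x) * b)\<^sup>2 + (norm (g x) * a)\<^sup>2"
      by (rule sum_squares_bound)
    then show ?thesis using ab by (simp add: field_simps power2_eq_square)
  qed
  then have "(LINT x|lborel. norm (f x) * norm (g x))
      \<le> (LINT x|lborel. (b / a * (norm (f x))\<^sup>2 + a / b * (norm (g x))\<^sup>2) / 2)"
    using f g by (intro integral_mono L2_C_norm_mult_integrable) (auto simp: L2_C_def)
  also have "\<dots> = (b / a * sq_C f + a / b * sq_C g) / 2"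
    using f g by (simp add: sq_C_def L2_C_def)
  also have "\<dots> = a * b" using ab by (simp add: field_simps power2_eq_square)
  finally show ?thesis by (simp add: a_def b_def)
qed

lemma norm_ip_C_le:
  assumes "f \<in> L2_C" "g \<in> L2_C"
  shows "norm (ip_C f g) \<le> sqrt (sq_C f) * sqrt (sq_C g)"
proof -
  have "norm (ip_C f g) \<le> (LINT x|lborel. norm (f x * cnj (g x)))"
    unfolding ip_C_def by (rule integral_norm_bound)
  then show ?thesis using L2_C_Cauchy_Schwarz[OF assms] by (simp add: norm_mult)
qed

text \<open>Lower semicontinuity of the norm, for passing to the limit in Cauchy estimates.
  Membership is part of the conclusion because the Bochner integral of a non-integrable function is
  0, so that a bound on \<open>sq_C\<close> alone would say nothing.\<close>

lemma L2_C_Fatou: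
  assumes "\<And>n. u n \<in> L2_C" "\<And>n. sq_C (u n) \<le> B"
    and [measurable]: "v \<in> borel_measurable borel"
    and "AE x in lborel. (\<lambda>n. u n x) \<longlonglongrightarrow> v x"
  shows "v \<in> L2_C" "sq_C v \<le> B"
proof -
  have [measurable]: "u n \<in> borel_measurable borel" for n
    using assms by (simp add: L2_C_measurable)
  have "(\<integral>\<^sup>+x. ennreal ((norm (v x))\<^sup>2) \<partial>lborel)
      = (\<integral>\<^sup>+x. liminf (\<lambda>n. ennreal ((norm (u n x))\<^sup>2)) \<partial>lborel)"
  proof (rule nn_integral_cong_AE, use assms(4) in eventually_elim)
    case (elim x)
    then have "(\<lambda>n. ennreal ((norm (u n x))\<^sup>2)) \<longlonglongrightarrow> ennreal ((norm (v x))\<^sup>2)"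
      by (intro tendsto_ennrealI tendsto_intros)
    then show ?case by (metis lim_imp_Liminf sequentially_bot)
  qed
  also have "\<dots> \<le> liminf (\<lambda>n. \<integral>\<^sup>+x. ennreal ((norm (u n x))\<^sup>2) \<partial>lborel)"
    by (rule nn_integral_liminf) simp
  also have "(\<lambda>n. \<integral>\<^sup>+x. ennreal ((norm (u n x))\<^sup>2) \<partial>lborel) = (\<lambda>n. ennreal (sq_C (u n)))"
    using assms(1) by (simp add: nn_integral_eq_integral L2_C_def sq_C_def)
  also have "liminf \<dots> \<le> liminf (\<lambda>n. ennreal B)"
    using assms(2) by (intro Liminf_mono always_eventually allI ennreal_leI)
  finally have *: "(\<integral>\<^sup>+x. ennreal ((norm (v x))\<^sup>2) \<partial>lborel) \<le> ennreal B"
    by (simp add: Liminf_const)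
  then have i: "integrable lborel (\<lambda>x. (norm (v x))\<^sup>2)"
    by (intro integrableI_bounded) (auto simp: top_unique less_top[symmetric])
  then show "v \<in> L2_C" by (simp add: L2_C_def)
  have "0 \<le> B" using assms(2)[of 0] sq_C_nonneg[of "u 0"] by linarith
  with * i show "sq_C v \<le> B"
    by (simp add: nn_integral_eq_integral sq_C_def)
qed

text \<open>An almost everywhere convergent subsequence is extracted from a Cauchy sequence in L^1.
  As Lebesgue measure is infinite, functions in L^2 need not be integrable. A positive integrable
  weight w \<le> 1 lies in L^2 too, so by Cauchy-Schwarz multiplication by w leads from L^2 to L^1;
  since w > 0, it can be divided out afterwards.\<close>

lemma L2_C_complete:
  fixes s :: "nat \<Rightarrow> 'a::euclidean_space \<Rightarrow> complex"
  assumes s: "\<And>n. s n \<in> L2_C"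
    and Cauchy: "\<And>e. e > 0 \<Longrightarrow> \<exists>N. \<forall>i\<ge>N. \<forall>j\<ge>N. sq_C (\<lambda>x. s i x - s j x) < e"
  obtains v where "v \<in> L2_C" "(\<lambda>n. sq_C (\<lambda>x. v x - s n x)) \<longlonglongrightarrow> 0"
proof -
  have [measurable]: "s n \<in> borel_measurable borel" for n
    using s by (simp add: L2_C_measurable)
  obtain w :: "'a \<Rightarrow> real" where w: "w \<in> borel_measurable lborel" "\<And>x. 0 < w x" "\<And>x. w x \<le> 1"
      "integrable lborel w"
    by (rule sigma_finite_measure.obtain_positive_integrable_function[OF sigma_finite_lborel]) blast
  have [measurable]: "w \<in> borel_measurable borel" using w(1) by simp
  have wL: "(\<lambda>x. of_real (w x)) \<in> L2_C"
  proof -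
    have "(w x)\<^sup>2 \<le> w x" for x
      using w(2)[of x] w(3)[of x] by (simp add: power2_eq_square mult_left_le)
    then have "integrable lborel (\<lambda>x. (w x)\<^sup>2)"
      using w(2) by (intro Bochner_Integration.integrable_bound[OF w(4)]) (auto simp: less_imp_le)
    then show ?thesis by (simp add: L2_C_def)
  qed
  define W where "W = sqrt (sq_C (\<lambda>x. of_real (w x) :: complex))"
  have W: "W \<ge> 0" by (simp add: W_def sq_C_nonneg)
  have dist: "(LINT x|lborel. norm (of_real (w x) * s i x - of_real (w x) * s j x))
      \<le> W * sqrt (sq_C (\<lambda>x. s i x - s j x))" for i j
    using L2_C_Cauchy_Schwarz[OF wL L2_C_diff[OF s s], of i j]
    by (simp add: W_def norm_mult flip: right_diff_distrib)
  have "\<exists>N. \<forall>i\<ge>N. \<forall>j\<ge>N. (LINT x|lborel. norm (of_real (w x) * s i x - of_real (w x) * s j x)) < e"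
    if "e > 0" for e
  proof -
    \<comment> \<open>The summand 1 avoids division by zero and makes W * (e / (W + 1)) < e
      strict.\<close>
    have "(e / (W + 1))\<^sup>2 > 0" using that W by simp
    from Cauchy[OF this]
    obtain N where N: "\<And>i j. i \<ge> N \<Longrightarrow> j \<ge> N \<Longrightarrow> sq_C (\<lambda>x. s i x - s j x) < (e / (W + 1))\<^sup>2"
      by blast
    show ?thesis
    proof (intro exI[of _ N] allI impI)
      fix i j assume ij: "i \<ge> N" "j \<ge> N"
      have "sqrt (sq_C (\<lambda>x. s i x - s j x)) \<le> e / (W + 1)"
        using N[OF ij] that W by (intro real_le_lsqrt) auto
      then have "W * sqrt (sq_C (\<lambda>x. s i x - s j x)) \<le> W * (e / (W + 1))"
        using W by (rule mult_left_mono)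
      also have "\<dots> < e" using W that by (simp add: field_simps)
      finally show "(LINT x|lborel. norm (of_real (w x) * s i x - of_real (w x) * s j x)) < e"
        using dist[of i j] by linarith
    qed
  qed
  from cauchy_L1_AE_cauchy_subseq[of lborel "\<lambda>n x. of_real (w x) * s n x",
      OF L2_C_mult_integrable[OF wL s] this]
  obtain r where r: "strict_mono r"
    "AE x in lborel. Cauchy (\<lambda>i. of_real (w x) * s (r i) x)"
    by blast
  define v where "v x = lim (\<lambda>i. s (r i) x)" for x
  have [measurable]: "v \<in> borel_measurable borel"
    unfolding v_def by measurable
  have conv: "AE x in lborel. (\<lambda>i. s (r i) x) \<longlonglongrightarrow> v x"
    using r(2)
  proof eventually_elim
    case (elim x)
    then have "convergent (\<lambda>i. of_real (w x) * s (r i) x)"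
      by (rule Cauchy_convergent)
    then have "convergent (\<lambda>i. inverse (of_real (w x)) * (of_real (w x) * s (r i) x))"
      by (rule convergent_mult[OF convergent_const])
    moreover have "inverse (of_real (w x)) * (of_real (w x) * s (r i) x) = s (r i) x" for i
      using w(2)[of x] by simp
    ultimately show ?case
      by (simp only: v_def convergent_LIMSEQ_iff)
  qed
  \<comment> \<open>With n fixed, the other index runs along the subsequence, and Fatou carries the
    Cauchy bound over to v. The subsequence is started at N because r (i + N) \<ge> N.\<close>
  have bound: "(\<lambda>x. v x - s n x) \<in> L2_C \<and> sq_C (\<lambda>x. v x - s n x) \<le> e"
    if "n \<ge> N" and N: "\<And>i j. i \<ge> N \<Longrightarrow> j \<ge> N \<Longrightarrow> sq_C (\<lambda>x. s i x - s j x) < e" for n N e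
  proof -
    have "r (i + N) \<ge> N" for i
      using seq_suble[OF r(1), of "i + N"] by linarith
    then have "sq_C (\<lambda>x. s (r (i + N)) x - s n x) \<le> e" for i
      using N \<open>n \<ge> N\<close> by (simp add: less_imp_le)
    moreover have "AE x in lborel. (\<lambda>i. s (r (i + N)) x - s n x) \<longlonglongrightarrow> v x - s n x"
      using conv
      by eventually_elim (rule tendsto_diff[OF LIMSEQ_ignore_initial_segment tendsto_const])
    ultimately show ?thesis
      using L2_C_Fatou[of "\<lambda>i x. s (r (i + N)) x - s n x" e "\<lambda>x. v x - s n x"]
        L2_C_diff[OF s s] by simp
  qed
  show ?thesis
  proof
    obtain N where N: "\<And>i j. i \<ge> N \<Longrightarrow> j \<ge> N \<Longrightarrow> sq_C (\<lambda>x. s i x - s j x) < 1"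
      using Cauchy[of 1] by auto
    have "(\<lambda>x. v x - s N x) \<in> L2_C"
      using bound[OF order_refl N] by blast
    from L2_C_add[OF this s[of N]] show "v \<in> L2_C" by simp
    show "(\<lambda>n. sq_C (\<lambda>x. v x - s n x)) \<longlonglongrightarrow> 0"
    proof (rule LIMSEQ_I)
      fix e :: real assume "e > 0"
      then obtain N where "\<And>i j. i \<ge> N \<Longrightarrow> j \<ge> N \<Longrightarrow> sq_C (\<lambda>x. s i x - s j x) < e / 2"
        using Cauchy[of "e / 2"] by auto
      from bound[OF _ this] have le: "sq_C (\<lambda>x. v x - s n x) \<le> e / 2" if "n \<ge> N" for n
        using that by auto
      have "norm (sq_C (\<lambda>x. v x - s n x) - 0) < e" if "n \<ge> N" for n
        using le[OF that] \<open>e > 0\<close> sq_C_nonneg[of "\<lambda>x. v x - s n x"] by simp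
      then show "\<exists>no. \<forall>n\<ge>no. norm (sq_C (\<lambda>x. v x - s n x) - 0) < e" by blast
    qed
  qed
qed

section \<open>Orthogonal bases, Fourier coefficients and unconditional expansions\<close>

definition total_C :: "('k \<Rightarrow> 'a::euclidean_space \<Rightarrow> complex) \<Rightarrow> bool"
  where "total_C b \<longleftrightarrow>
    (\<forall>f\<in>L2_C. (\<forall>k. ip_C f (b k) = 0) \<longrightarrow> (AE x in lborel. f x = 0))"

text \<open>A trivial orthogonal complement is required instead of expansions because that form
  passes through tensor products by Fubini and through changes of variables by substitution.
  Expansions are recovered once, in \<open>has_expansion_C_coeff\<close>.\<close>

definition orthogonal_basis_C :: "('k \<Rightarrow> 'a::euclidean_space \<Rightarrow> complex) \<Rightarrow> bool"
  where "orthogonal_basis_C b \<longleftrightarrow>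
    (\<forall>k. b k \<in> L2_C \<and> sq_C (b k) \<noteq> 0) \<and>
    (\<forall>k l. k \<noteq> l \<longrightarrow> ip_C (b k) (b l) = 0) \<and> total_C b"

definition has_expansion_C ::
    "('k \<Rightarrow> 'a::euclidean_space \<Rightarrow> complex) \<Rightarrow> ('a \<Rightarrow> complex) \<Rightarrow> ('k \<Rightarrow> complex) \<Rightarrow> bool"
  where "has_expansion_C b f c \<longleftrightarrow>
    ((\<lambda>F. sq_C (\<lambda>x. f x - (\<Sum>k\<in>F. c k * b k x))) \<longlongrightarrow> 0) (finite_subsets_at_top UNIV)"

lemma sq_C_zero: "sq_C (\<lambda>x. 0) = 0"
  by (simp add: sq_C_def)

lemma sq_C_diff_cmult:
  assumes "g \<in> L2_C" "h \<in> L2_C"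
  shows "sq_C (\<lambda>x. g x - c * h x) = sq_C g - 2 * Re (cnj c * ip_C g h) + (norm c)\<^sup>2 * sq_C h"
proof -
  have [simp]: "integrable lborel (\<lambda>x. (norm (g x))\<^sup>2)" "integrable lborel (\<lambda>x. (norm (h x))\<^sup>2)"
    "integrable lborel (\<lambda>x. g x * cnj (h x))"
    using assms ip_C_integrable by (auto simp: L2_C_def)
  have *: "(norm (g x - c * h x))\<^sup>2
      = (norm (g x))\<^sup>2 - 2 * Re (cnj c * (g x * cnj (h x))) + (norm c)\<^sup>2 * (norm (h x))\<^sup>2" for x
    unfolding cmod_power2 by (simp add: power2_eq_square algebra_simps)
  have "(LINT x|lborel. Re (cnj c * (g x * cnj (h x)))) = Re (cnj c * ip_C g h)"
    unfolding ip_C_def by (subst integral_Re) auto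
  moreover have "integrable lborel (\<lambda>x. Re (cnj c * (g x * cnj (h x))))"
    by (rule integrable_Re) simp
  ultimately show ?thesis
    unfolding sq_C_def * by (simp del: times_complex.sel)
qed

context
  fixes b :: "'k \<Rightarrow> 'a::euclidean_space \<Rightarrow> complex"
  assumes b: "orthogonal_basis_C b"
begin

lemma basis_L2_C: "b k \<in> L2_C"
  using b by (simp add: orthogonal_basis_C_def)

lemma basis_sq_C_pos: "0 < sq_C (b k)"
  using b sq_C_nonneg[of "b k"] by (simp add: orthogonal_basis_C_def order_less_le)

lemma basis_ip_C: "ip_C (b k) (b l) = (if k = l then of_real (sq_C (b k)) else 0)"
  using b sq_C_eq_ip_C[of "b k"] by (auto simp: orthogonal_basis_C_def)

definition coeff_C :: "('a \<Rightarrow> complex) \<Rightarrow> 'k \<Rightarrow> complex"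
  where "coeff_C f k = ip_C f (b k) / of_real (sq_C (b k))"

lemma L2_C_remainder:
  assumes "f \<in> L2_C"
  shows "(\<lambda>x. f x - (\<Sum>k\<in>F. c k * b k x)) \<in> L2_C"
  by (intro L2_C_diff L2_C_sum L2_C_cmult assms basis_L2_C)

lemma ip_C_remainder:
  assumes "f \<in> L2_C" "finite F"
  shows "ip_C (\<lambda>x. f x - (\<Sum>k\<in>F. c k * b k x)) (b l)
    = ip_C f (b l) - (if l \<in> F then c l * of_real (sq_C (b l)) else 0)"
proof -
  have "ip_C (\<lambda>x. f x - (\<Sum>k\<in>F. c k * b k x)) (b l)
      = ip_C f (b l) - (\<Sum>k\<in>F. c k * ip_C (b k) (b l))"
    using assms by (simp add: ip_C_diff_left ip_C_sum_left L2_C_sum L2_C_cmult basis_L2_C)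
  also have "(\<Sum>k\<in>F. c k * ip_C (b k) (b l))
      = (\<Sum>k\<in>F. if k = l then c l * of_real (sq_C (b l)) else 0)"
    by (rule sum.cong) (auto simp: basis_ip_C)
  finally show ?thesis using assms by (simp add: sum.delta)
qed

text \<open>Completing the square at each new index separates the least possible error from the
  penalty for deviating from \<open>coeff_C\<close>. With the coefficients \<open>coeff_C f\<close>
  this gives Bessel's inequality; with arbitrary ones it gives uniqueness.\<close>

lemma sq_C_remainder:
  assumes f: "f \<in> L2_C" and "finite F"
  shows "sq_C (\<lambda>x. f x - (\<Sum>k\<in>F. c k * b k x))
    = sq_C f - (\<Sum>k\<in>F. (norm (coeff_C f k))\<^sup>2 * sq_C (b k))
      + (\<Sum>k\<in>F. (norm (c k - coeff_C f k))\<^sup>2 * sq_C (b k))"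
  using assms(2)
proof (induction F)
  case (insert l F)
  let ?g = "\<lambda>x. f x - (\<Sum>k\<in>F. c k * b k x)"
  have "ip_C ?g (b l) = coeff_C f l * of_real (sq_C (b l))"
    using insert basis_sq_C_pos[of l] f by (simp add: ip_C_remainder coeff_C_def)
  then have *: "Re (cnj (c l) * ip_C ?g (b l)) = Re (cnj (c l) * coeff_C f l) * sq_C (b l)"
    by (simp add: algebra_simps)
  have "(\<lambda>x. f x - (\<Sum>k\<in>insert l F. c k * b k x)) = (\<lambda>x. ?g x - c l * b l x)"
    using insert by (auto simp: algebra_simps)
  then have "sq_C (\<lambda>x. f x - (\<Sum>k\<in>insert l F. c k * b k x))
      = sq_C ?g - 2 * (Re (cnj (c l) * coeff_C f l) * sq_C (b l)) + (norm (c l))\<^sup>2 * sq_C (b l)"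
    using sq_C_diff_cmult[OF L2_C_remainder[OF f] basis_L2_C] * by simp
  also have "\<dots> = sq_C ?g - (norm (coeff_C f l))\<^sup>2 * sq_C (b l)
      + (norm (c l - coeff_C f l))\<^sup>2 * sq_C (b l)"
    unfolding cmod_power2 by (simp add: power2_eq_square algebra_simps)
  finally show ?case using insert by simp
qed simp

lemma sq_C_remainder_coeff:
  assumes "f \<in> L2_C" "finite F"
  shows "sq_C (\<lambda>x. f x - (\<Sum>k\<in>F. coeff_C f k * b k x))
    = sq_C f - (\<Sum>k\<in>F. (norm (coeff_C f k))\<^sup>2 * sq_C (b k))"
  using sq_C_remainder[OF assms, of "coeff_C f"] by simp

text \<open>For every finite F containing k, Bessel leaves the k-th penalty term of
  \<open>sq_C_remainder\<close> as a lower bound for the error, and the error tends to 0.\<close>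

lemma has_expansion_C_unique:
  assumes f: "f \<in> L2_C" and "has_expansion_C b f c"
  shows "c = coeff_C f"
proof
  fix k
  have "(norm (c k - coeff_C f k))\<^sup>2 * sq_C (b k) \<le> sq_C (\<lambda>x. f x - (\<Sum>k\<in>F. c k * b k x))"
    if "finite F" "{k} \<subseteq> F" for F
  proof -
    have "(norm (c k - coeff_C f k))\<^sup>2 * sq_C (b k)
        \<le> (\<Sum>k\<in>F. (norm (c k - coeff_C f k))\<^sup>2 * sq_C (b k))"
      using that by (intro member_le_sum) (auto simp: sq_C_nonneg)
    moreover have "0 \<le> sq_C f - (\<Sum>k\<in>F. (norm (coeff_C f k))\<^sup>2 * sq_C (b k))"
      using sq_C_nonneg[of "\<lambda>x. f x - (\<Sum>k\<in>F. coeff_C f k * b k x)"]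
      by (simp only: sq_C_remainder_coeff[OF f that(1)])
    ultimately show ?thesis using sq_C_remainder[OF f that(1), of c] by simp
  qed
  then have "\<forall>\<^sub>F F in finite_subsets_at_top UNIV.
      (norm (c k - coeff_C f k))\<^sup>2 * sq_C (b k) \<le> sq_C (\<lambda>x. f x - (\<Sum>k\<in>F. c k * b k x))"
    unfolding eventually_finite_subsets_at_top by (intro exI[of _ "{k}"]) auto
  then have "(norm (c k - coeff_C f k))\<^sup>2 * sq_C (b k) \<le> 0"
    using assms(2) unfolding has_expansion_C_def
    by (intro tendsto_lowerbound) auto
  then show "c k = coeff_C f k"
    using basis_sq_C_pos[of k] by (simp add: mult_le_0_iff)
qed

end

text \<open>Completeness is about sequences, so the countable index type is exhausted by finite sets
  F n. Bessel's series controls the distances of the partial sums; their limit v has the same inner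
  products with the basis as f, and totality forces f = v almost everywhere. Monotonicity of the
  error turns convergence along F n into convergence along all finite sets.\<close>

lemma has_expansion_C_coeff:
  fixes b :: "'k::countable \<Rightarrow> 'a::euclidean_space \<Rightarrow> complex"
  assumes b: "orthogonal_basis_C b" and f: "f \<in> L2_C"
  shows "has_expansion_C b f (coeff_C b f)"
proof -
  define F :: "nat \<Rightarrow> 'k set" where "F n = {k. to_nat k < n}" for n
  have F: "finite (F n)" for n
    unfolding F_def using finite_vimageI[OF finite_lessThan inj_to_nat, of n]
    by (simp add: vimage_def)
  have F_mono: "F m \<subseteq> F n" if "m \<le> n" for m n
    using that by (auto simp: F_def)
  define a where "a k = (norm (coeff_C b f k))\<^sup>2 * sq_C (b k)" for k
  have a: "0 \<le> a k" for k by (simp add: a_def sq_C_nonneg)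
  define s where "s n x = (\<Sum>k\<in>F n. coeff_C b f k * b k x)" for n x
  have s: "s n \<in> L2_C" for n
    unfolding s_def by (intro L2_C_sum L2_C_cmult basis_L2_C[OF b])
  have Bessel: "sum a G \<le> sq_C f" if "finite G" for G
    using sq_C_remainder_coeff[OF b f that] sq_C_nonneg[of
        "\<lambda>x. f x - (\<Sum>k\<in>G. coeff_C b f k * b k x)"]
    by (simp add: a_def)
  have "incseq (\<lambda>n. sum a (F n))"
    by (auto intro!: incseq_SucI sum_mono2 F F_mono a)
  then have "convergent (\<lambda>n. sum a (F n))"
    by (rule incseq_convergent[where B = "sq_C f"]) (use Bessel F in \<open>auto simp: convergent_def\<close>)
  then have Cauchy: "Cauchy (\<lambda>n. sum a (F n))"
    by (rule convergent_Cauchy)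
  have dist: "sq_C (\<lambda>x. s i x - s j x) = dist (sum a (F i)) (sum a (F j))" if "i \<ge> j" for i j
  proof -
    \<comment> \<open>\<open>ip_C_remainder\<close> is applied to the zero function with negated
      coefficients: its remainder is s i itself.\<close>
    have "coeff_C b (s i) k = (if k \<in> F i then coeff_C b f k else 0)" for k
      using ip_C_remainder[OF b L2_C_cmult[of f 0, OF f] F[of i], of
          "\<lambda>k. - coeff_C b f k" k] basis_sq_C_pos[OF b, of k]
      by (simp add: coeff_C_def[OF b] s_def sum_negf ip_C_def)
    then have co: "(\<Sum>k\<in>G. (norm (coeff_C b (s i) k))\<^sup>2 * sq_C (b k)) = sum a G"
      "(\<Sum>k\<in>G. coeff_C b (s i) k * b k x) = (\<Sum>k\<in>G. coeff_C b f k * b k x)"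
      if "G \<subseteq> F i" for G x
      using that by (auto simp: a_def intro!: sum.cong)
    \<comment> \<open>The remainder of s i over F i is identically 0, which is Parseval's identity
      for this finite sum.\<close>
    have "sq_C (s i) - sum a (F i) = 0"
      using sq_C_remainder_coeff[OF b s F, of i i]
      by (simp add: co s_def[symmetric] sq_C_zero)
    moreover have "sq_C (\<lambda>x. s i x - s j x) = sq_C (s i) - sum a (F j)"
      using sq_C_remainder_coeff[OF b s F, of i j] F_mono[OF that]
          by (simp add: co s_def[symmetric])
    moreover have "sum a (F j) \<le> sum a (F i)"
      by (rule sum_mono2) (auto simp: F F_mono[OF that] a)
    ultimately show ?thesis by (simp add: dist_real_def)
  qed
  have sym: "sq_C (\<lambda>x. s i x - s j x) = sq_C (\<lambda>x. s j x - s i x)" for i j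
    by (simp add: sq_C_def norm_minus_commute)
  have "\<exists>N. \<forall>i\<ge>N. \<forall>j\<ge>N. sq_C (\<lambda>x. s i x - s j x) < e" if e: "e > 0" for e
  proof -
    obtain N where N: "\<forall>i\<ge>N. \<forall>j\<ge>N. dist (sum a (F i)) (sum a (F j)) < e"
      using metric_CauchyD[OF Cauchy e] by blast
    have "sq_C (\<lambda>x. s i x - s j x) = dist (sum a (F i)) (sum a (F j))" for i j
    proof (cases "i \<ge> j")
      case False
      then show ?thesis by (subst sym, subst dist) (auto simp: dist_commute)
    qed (rule dist)
    with N show ?thesis by (intro exI[of _ N]) simp
  qed
  from L2_C_complete[OF s this]
  obtain v where v: "v \<in> L2_C" "(\<lambda>n. sq_C (\<lambda>x. v x - s n x)) \<longlonglongrightarrow> 0"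
    by blast
  have "ip_C (\<lambda>x. f x - v x) (b k) = 0" for k
  proof -
    have "norm (ip_C v (b k) - ip_C f (b k)) \<le> sqrt (sq_C (\<lambda>x. v x - s n x)) * sqrt (sq_C (b k))"
      if "n > to_nat k" for n
    proof -
      have "k \<in> F n" using that by (simp add: F_def)
      then have "ip_C f (b k) = ip_C (s n) (b k)"
        using ip_C_remainder[OF b f F[of n], of
            "coeff_C b f" k] ip_C_diff_left[OF f s basis_L2_C[OF b], of n k]
          basis_sq_C_pos[OF b, of k]
        by (simp add: coeff_C_def[OF b] s_def)
      then show ?thesis
        using norm_ip_C_le[OF L2_C_diff[OF v(1) s] basis_L2_C[OF b], of n k]
        by (simp add: ip_C_diff_left v s basis_L2_C[OF b])
    qed
    then have "\<forall>\<^sub>F n in sequentially. norm (ip_C v (b k) - ip_C f (b k))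
        \<le> sqrt (sq_C (\<lambda>x. v x - s n x)) * sqrt (sq_C (b k))"
      by (intro eventually_sequentiallyI[of "Suc (to_nat k)"]) auto
    moreover have "(\<lambda>n. sqrt (sq_C (\<lambda>x. v x - s n x)) * sqrt (sq_C (b k))) \<longlonglongrightarrow> sqrt 0 * sqrt (sq_C
        (b k))"
      by (intro tendsto_intros v)
    ultimately have "norm (ip_C v (b k) - ip_C f (b k)) \<le> sqrt 0 * sqrt (sq_C (b k))"
      by (intro tendsto_lowerbound) auto
    then show ?thesis
      by (simp add: ip_C_diff_left f v basis_L2_C[OF b])
  qed
  then have AE: "AE x in lborel. f x - v x = 0"
    using b L2_C_diff[OF f v(1)] unfolding orthogonal_basis_C_def total_C_def by blast
  have eq: "sq_C (\<lambda>x. f x - s n x) = sq_C (\<lambda>x. v x - s n x)" for n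
    by (rule sq_C_cong_AE) (use AE in \<open>auto intro!: L2_C_diff f s v\<close>)
  let ?D = "\<lambda>G. sq_C (\<lambda>x. f x - (\<Sum>k\<in>G. coeff_C b f k * b k x))"
  \<comment> \<open>With \<open>coeff_C\<close> as coefficients, enlarging the index set can only
    lower the error.\<close>
  have D: "?D G \<le> sq_C (\<lambda>x. v x - s n x)" if "finite G" "F n \<subseteq> G" for n G
  proof -
    have "sum a (F n) \<le> sum a G" using that a by (intro sum_mono2) auto
    then have "?D G \<le> ?D (F n)"
      using that F by (simp add: sq_C_remainder_coeff[OF b f] a_def)
    then show ?thesis using eq by (simp add: s_def)
  qed
  show ?thesis
    unfolding has_expansion_C_def
  proof (rule order_tendstoI)
    fix e :: real assume "e < 0"
    then show "\<forall>\<^sub>F G in finite_subsets_at_top UNIV. e < ?D G"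
      by (auto intro!: always_eventually less_le_trans[OF _ sq_C_nonneg])
  next
    fix e :: real assume "0 < e"
    then obtain n where "sq_C (\<lambda>x. v x - s n x) < e"
      using order_tendstoD(2)[OF v(2)] eventually_happens'[OF sequentially_bot] by blast
    then have "finite G \<Longrightarrow> F n \<subseteq> G \<Longrightarrow> ?D G < e" for G
      using D[of G n] by linarith
    then show "\<forall>\<^sub>F G in finite_subsets_at_top UNIV. ?D G < e"
      unfolding eventually_finite_subsets_at_top using F by blast
  qed
qed

section \<open>Idempotent components\<close>

lemma idem_parts [simp]: "plus_part (idem a b) = a" "minus_part (idem a b) = b"
  using idem_eq_iff[of "idem a b" a b] by simp_all

lemma bicomplex_eq_iff_parts: "Z = W \<longleftrightarrow> plus_part Z = plus_part W \<and> minus_part Z = minus_part W"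
  using idem_eq_iff[of Z "plus_part W" "minus_part W"] idem_eq_iff[of W "plus_part W"
      "minus_part W"]
  by auto

lemma parts_simps [simp]:
  "plus_part 0 = 0" "minus_part 0 = 0" "plus_part 1 = 1" "minus_part 1 = 1"
  "plus_part (Z + W) = plus_part Z + plus_part W" "minus_part (Z + W) = minus_part Z + minus_part W"
  "plus_part (Z - W) = plus_part Z - plus_part W" "minus_part (Z - W) = minus_part Z - minus_part W"
  "plus_part (- Z) = - plus_part Z" "minus_part (- Z) = - minus_part Z"
  "plus_part (Z * W) = plus_part Z * plus_part W" "minus_part (Z * W) = minus_part Z * minus_part W"
  "plus_part (r *\<^sub>R Z) = r *\<^sub>R plus_part Z" "minus_part (r *\<^sub>R Z) = r *\<^sub>R minus_part Z"
  "plus_part (of_cx z) = z" "minus_part (of_cx z) = z"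
  "plus_part e_plus = 1" "minus_part e_plus = 0" "plus_part e_minus = 0" "minus_part e_minus = 1"
  by (simp_all add: plus_part_def minus_part_def algebra_simps of_cx_def e_plus_def e_minus_def
      bc_i_def bc_j_def complex_eq_iff)

lemma parts_cnj_exp [simp]:
  "plus_part (bc_cnj Z) = cnj (plus_part Z)" "minus_part (bc_cnj Z) = cnj (minus_part Z)"
  "plus_part (bc_exp Z) = exp (plus_part Z)" "minus_part (bc_exp Z) = exp (minus_part Z)"
  by (simp_all add: bc_cnj_def bc_exp_def)

lemma parts_sum [simp]:
  "plus_part (\<Sum>k\<in>F. f k) = (\<Sum>k\<in>F. plus_part (f k))"
  "minus_part (\<Sum>k\<in>F. f k) = (\<Sum>k\<in>F. minus_part (f k))"
  by (induction F rule: infinite_finite_induct) auto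

lemma bounded_linear_parts [simp]:
  "bounded_linear plus_part" "bounded_linear minus_part"
  by (simp_all add: linear_conv_bounded_linear[symmetric] linear_iff)

lemma idem_parts_eq: "idem (plus_part Z) (minus_part Z) = Z"
  by (metis idem_eq_iff)

lemma integrable_bicomplex_iff:
  "integrable M f \<longleftrightarrow> integrable M (\<lambda>x. plus_part (f x)) \<and> integrable M (\<lambda>x. minus_part (f x))"
proof safe
  assume "integrable M (\<lambda>x. plus_part (f x))" "integrable M (\<lambda>x. minus_part (f x))"
  then have "integrable M (\<lambda>x. idem (plus_part (f x)) 0 + idem 0 (minus_part (f x)))"
    by (intro Bochner_Integration.integrable_add
        integrable_bounded_linear[of "\<lambda>z. idem z 0"] integrable_bounded_linear[of "\<lambda>z. idem 0 z"])
      (simp_all add: linear_conv_bounded_linear[symmetric] linear_iff bicomplex_eq_iff_parts)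
  moreover have "idem a 0 + idem 0 b = idem a b" for a b
    by (simp add: bicomplex_eq_iff_parts)
  ultimately show "integrable M f" by (simp add: idem_parts_eq)
qed (auto intro: integrable_bounded_linear[rotated])

lemma integral_parts:
  assumes "integrable M f"
  shows "plus_part (LINT x|M. f x) = (LINT x|M. plus_part (f x))"
    "minus_part (LINT x|M. f x) = (LINT x|M. minus_part (f x))"
  using assms by (simp_all add: integral_bounded_linear)

lemma L2_inner_parts:
  assumes "f \<in> L2_T" "g \<in> L2_T"
  shows "L2_inner f g = idem (ip_C (\<lambda>x. plus_part (f x)) (\<lambda>x. plus_part (g x)))
    (ip_C (\<lambda>x. minus_part (f x)) (\<lambda>x. minus_part (g x)))"
proof -
  have "integrable lborel (\<lambda>x. f x * bc_cnj (g x))"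
    using assms by (auto simp: integrable_bicomplex_iff L2_T_def intro!: ip_C_integrable)
  then show ?thesis
    by (simp add: bicomplex_eq_iff_parts L2_inner_def integral_parts ip_C_def)
qed

lemma L2_norm_parts:
  assumes "f \<in> L2_T"
  shows "(L2_norm f)\<^sup>2 = (sq_C (\<lambda>x. plus_part (f x)) + sq_C (\<lambda>x. minus_part (f x))) / 2"
  using assms
  by (simp add: L2_norm_def norm_bicomplex_parts sq_C_def L2_T_def L2_C_def)

lemma L2_T_remainder:
  assumes "f \<in> L2_T" "\<And>k. b k \<in> L2_T"
  shows "(\<lambda>x. f x - (\<Sum>k\<in>F. c k * b k x)) \<in> L2_T"
  using assms unfolding L2_T_def by (auto intro!: L2_C_diff L2_C_sum L2_C_cmult)

text \<open>The square of \<open>L2_norm\<close> is the mean of two nonnegative component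
  quantities, so it tends to 0 exactly when both of them do.\<close>

lemma L2_has_expansion_iff:
  assumes f: "f \<in> L2_T" and b: "\<And>k. b k \<in> L2_T"
  shows "L2_has_expansion b f c \<longleftrightarrow>
    has_expansion_C (\<lambda>k x. plus_part (b k x)) (\<lambda>x. plus_part (f x)) (\<lambda>k. plus_part (c k)) \<and>
    has_expansion_C (\<lambda>k x. minus_part (b k x)) (\<lambda>x. minus_part (f x)) (\<lambda>k. minus_part (c k))"
    (is "_ \<longleftrightarrow> ?P \<and> ?M")
proof -
  let ?N = "\<lambda>F. L2_norm (\<lambda>x. f x - (\<Sum>k\<in>F. c k * b k x))"
  let ?p = "\<lambda>F. sq_C (\<lambda>x. plus_part (f x) - (\<Sum>k\<in>F. plus_part (c k) * plus_part (b k x)))"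
  let ?m = "\<lambda>F. sq_C (\<lambda>x. minus_part (f x) - (\<Sum>k\<in>F. minus_part (c k) * minus_part (b k x)))"
  let ?T = "finite_subsets_at_top UNIV"
  have sq: "(?N F)\<^sup>2 = (?p F + ?m F) / 2" for F
    using L2_norm_parts[OF L2_T_remainder[OF f b]] by simp
  have "(?N \<longlongrightarrow> 0) ?T \<longleftrightarrow> ((\<lambda>F. (?N F)\<^sup>2) \<longlongrightarrow> 0) ?T"
  proof
    assume "((\<lambda>F. (?N F)\<^sup>2) \<longlongrightarrow> 0) ?T"
    from tendsto_real_sqrt[OF this] show "(?N \<longlongrightarrow> 0) ?T"
      by (simp add: L2_norm_def)
  next
    assume "(?N \<longlongrightarrow> 0) ?T"
    from tendsto_power[OF this, of 2] show "((\<lambda>F. (?N F)\<^sup>2) \<longlongrightarrow> 0) ?T"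
      by simp
  qed
  also have "\<dots> \<longleftrightarrow> (?p \<longlongrightarrow> 0) ?T \<and> (?m \<longlongrightarrow> 0) ?T"
  proof safe
    assume *: "((\<lambda>F. (?N F)\<^sup>2) \<longlongrightarrow> 0) ?T"
    have **: "((\<lambda>F. 2 * (?N F)\<^sup>2) \<longlongrightarrow> 0) ?T"
      using tendsto_mult_right_zero[OF *] by simp
    show "(?p \<longlongrightarrow> 0) ?T"
      by (rule tendsto_sandwich[OF _ _ tendsto_const **]) (simp_all add: sq sq_C_nonneg)
    show "(?m \<longlongrightarrow> 0) ?T"
      by (rule tendsto_sandwich[OF _ _ tendsto_const **]) (simp_all add: sq sq_C_nonneg)
  next
    assume "(?p \<longlongrightarrow> 0) ?T" "(?m \<longlongrightarrow> 0) ?T"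
    then have "((\<lambda>F. (?p F + ?m F) / 2) \<longlongrightarrow> (0 + 0) / 2) ?T"
      by (intro tendsto_intros) auto
    then show "((\<lambda>F. (?N F)\<^sup>2) \<longlongrightarrow> 0) ?T" by (simp add: sq)
  qed
  finally show ?thesis by (simp add: L2_has_expansion_def has_expansion_C_def)
qed

text \<open>Since multiplication is componentwise, the coefficients of the two components are
  determined independently of each other and glued by \<open>idem\<close>.\<close>

theorem L2_orthogonal_basisI:
  fixes b :: "'k::countable \<Rightarrow> 'a::euclidean_space \<Rightarrow> bicomplex"
  assumes p: "orthogonal_basis_C (\<lambda>k x. plus_part (b k x))"
    and m: "orthogonal_basis_C (\<lambda>k x. minus_part (b k x))"
  shows "L2_orthogonal_basis b"
proof -
  have b: "b k \<in> L2_T" for k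
    using basis_L2_C[OF p] basis_L2_C[OF m] by (simp add: L2_T_def)
  have "\<not> (AE x in lborel. b k x = 0)" for k
  proof
    assume "AE x in lborel. b k x = 0"
    then have "AE x in lborel. plus_part (b k x) = 0" by eventually_elim simp
    then have "sq_C (\<lambda>x. plus_part (b k x)) = 0"
      unfolding sq_C_def by (intro integral_eq_zero_AE) (auto elim: eventually_mono)
    then show False using basis_sq_C_pos[OF p, of k] by simp
  qed
  moreover have "L2_inner (b k) (b l) = 0" if "k \<noteq> l" for k l
    using that basis_ip_C[OF p] basis_ip_C[OF m]
    by (simp add: L2_inner_parts b bicomplex_eq_iff_parts)
  moreover have "\<exists>!c. L2_has_expansion b f c" if f: "f \<in> L2_T" for f
  proof -
    have fp: "(\<lambda>x. plus_part (f x)) \<in> L2_C" and fm: "(\<lambda>x. minus_part (f x)) \<in> L2_C"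
      using f by (simp_all add: L2_T_def)
    let ?cp = "coeff_C (\<lambda>k x. plus_part (b k x)) (\<lambda>x. plus_part (f x))"
    let ?cm = "coeff_C (\<lambda>k x. minus_part (b k x)) (\<lambda>x. minus_part (f x))"
    show ?thesis
    proof (rule ex1I[of _ "\<lambda>k. idem (?cp k) (?cm k)"])
      show "L2_has_expansion b f (\<lambda>k. idem (?cp k) (?cm k))"
        using has_expansion_C_coeff[OF p fp] has_expansion_C_coeff[OF m fm]
        by (simp add: L2_has_expansion_iff f b)
      fix c assume "L2_has_expansion b f c"
      then have "(\<lambda>k. plus_part (c k)) = ?cp" "(\<lambda>k. minus_part (c k)) = ?cm"
        using has_expansion_C_unique[OF p fp] has_expansion_C_unique[OF m fm]
        by (simp_all add: L2_has_expansion_iff f b)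
      then show "c = (\<lambda>k. idem (?cp k) (?cm k))"
        by (auto simp: fun_eq_iff bicomplex_eq_iff_parts)
    qed
  qed
  ultimately show ?thesis using b by (simp add: L2_orthogonal_basis_def)
qed

section \<open>Completeness of Gaussian monomials on the line\<close>

lemma power_le_fact_exp: "\<bar>x\<bar> ^ k \<le> fact k * exp \<bar>x\<bar>" for x :: real
proof -
  have "\<bar>x\<bar> ^ k /\<^sub>R fact k \<le> (\<Sum>j<Suc k. \<bar>x\<bar> ^ j /\<^sub>R fact j)"
    by (rule member_le_sum) auto
  also have "\<dots> \<le> exp \<bar>x\<bar>"
    using sum_le_suminf[OF summable_exp_generic[of "\<bar>x\<bar>"], of "{..<Suc k}"]
    by (simp add: exp_def)
  finally show ?thesis by (simp add: field_simps)
qed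

text \<open>The power series of \<open>iexp\<close> turns the integral into a series of moments.
  Every partial sum is bounded by
  \<open>\<bar>g x\<bar> * exp (\<bar>t\<bar> * \<bar>x\<bar>)\<close>, which is integrable by
  assumption, so integration term by term is dominated convergence.\<close>

lemma integral_iexp_eq_0:
  fixes g :: "real \<Rightarrow> real"
  assumes [measurable]: "g \<in> borel_measurable borel"
    and int: "\<And>t. integrable lborel (\<lambda>x. \<bar>g x\<bar> * exp (t * \<bar>x\<bar>))"
    and mom: "\<And>n. (LINT x|lborel. g x * x ^ n) = 0"
  shows "(LINT x|lborel. g x *\<^sub>R iexp (t * x)) = 0"
proof -
  let ?s = "\<lambda>n x. \<Sum>k<n. g x *\<^sub>R ((\<i> * of_real (t * x)) ^ k /\<^sub>R fact k)"
  have term_bound: "norm (g x *\<^sub>R ((\<i> * of_real (t * x)) ^ k /\<^sub>R fact k))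
      = \<bar>g x\<bar> * ((\<bar>t\<bar> * \<bar>x\<bar>) ^ k /\<^sub>R fact k)" for x k
    by (simp add: norm_mult norm_power power_mult_distrib abs_mult divide_inverse mult_ac)
  have part_bound: "(\<Sum>k<n. (\<bar>t\<bar> * \<bar>x\<bar>) ^ k /\<^sub>R fact k) \<le> exp (\<bar>t\<bar> * \<bar>x\<bar>)" for n x
    using sum_le_suminf[OF summable_exp_generic[of "\<bar>t\<bar> * \<bar>x\<bar>"], of "{..<n}"]
    by (simp add: exp_def)
  have s_bound: "norm (?s n x) \<le> \<bar>g x\<bar> * exp (\<bar>t\<bar> * \<bar>x\<bar>)" for n x
  proof -
    have "norm (?s n x) \<le> (\<Sum>k<n. \<bar>g x\<bar> * ((\<bar>t\<bar> * \<bar>x\<bar>) ^ k /\<^sub>R fact k))"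
      by (rule order_trans[OF norm_sum]) (simp only: term_bound order_refl)
    also have "\<dots> \<le> \<bar>g x\<bar> * exp (\<bar>t\<bar> * \<bar>x\<bar>)"
      unfolding sum_distrib_left[symmetric] by (intro mult_left_mono part_bound) simp
    finally show ?thesis .
  qed
  have pow: "integrable lborel (\<lambda>x. g x * x ^ k)" for k
  proof (rule Bochner_Integration.integrable_bound[OF integrable_mult_right[OF int[of 1], of
      "fact k"]])
    have "\<bar>g x\<bar> * \<bar>x\<bar> ^ k \<le> \<bar>g x\<bar> * (fact k * exp \<bar>x\<bar>)" for x
      by (intro mult_left_mono power_le_fact_exp) auto
    then show "AE x in lborel. norm (g x * x ^ k) \<le> norm (fact k * (\<bar>g x\<bar> * exp (1 * \<bar>x\<bar>)))"
      by (auto simp: abs_mult power_abs mult_ac)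
  qed simp
  have "(LINT x|lborel. g x *\<^sub>R ((\<i> * of_real (t * x)) ^ k /\<^sub>R fact k)) = 0"
    and tint: "integrable lborel (\<lambda>x. g x *\<^sub>R ((\<i> * of_real (t * x)) ^ k /\<^sub>R fact k))" for k
  proof -
    have *: "(\<lambda>x. g x *\<^sub>R ((\<i> * of_real (t * x)) ^ k /\<^sub>R fact k))
        = (\<lambda>x. ((\<i> * of_real t) ^ k / fact k) * of_real (g x * x ^ k))"
      by (rule ext) (simp add: scaleR_conv_of_real power_mult_distrib field_simps)
    show "(LINT x|lborel. g x *\<^sub>R ((\<i> * of_real (t * x)) ^ k /\<^sub>R fact k)) = 0"
      unfolding * using mom[of k] by (simp del: of_real_mult of_real_power)
    show "integrable lborel (\<lambda>x. g x *\<^sub>R ((\<i> * of_real (t * x)) ^ k /\<^sub>R fact k))"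
      unfolding * by (intro integrable_mult_right integrable_of_real pow)
  qed
  then have "(LINT x|lborel. ?s n x) = 0" for n
    by (subst Bochner_Integration.integral_sum) auto
  moreover have "(\<lambda>n. LINT x|lborel. ?s n x) \<longlonglongrightarrow> (LINT x|lborel. g x *\<^sub>R iexp (t * x))"
  proof (rule integral_dominated_convergence[where w = "\<lambda>x. \<bar>g x\<bar> * exp (\<bar>t\<bar> * \<bar>x\<bar>)"])
    have "(\<lambda>n. ?s n x) \<longlonglongrightarrow> g x *\<^sub>R iexp (t * x)" for x
      using tendsto_scaleR[OF tendsto_const
          summable_LIMSEQ[OF summable_exp_generic[of "\<i> * complex_of_real (t * x)"]], of "g x"]
      by (simp only: exp_def scaleR_sum_right)
    then show "AE x in lborel. (\<lambda>n. ?s n x) \<longlonglongrightarrow> g x *\<^sub>R iexp (t * x)" by simp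
  qed (use int s_bound in auto)
  ultimately show ?thesis by (simp add: LIMSEQ_const_iff)
qed

text \<open>Levy's theorem compares probability measures, so g is split into its positive part p and
  negative part q. Normalised, they are densities whose characteristic functions differ by a
  multiple of the Fourier transform of g, which is 0. Equal measures have densities that agree
  almost everywhere. If the common mass m is 0, normalisation is impossible, but then p and q vanish
  almost everywhere.\<close>

lemma moments_eq_0_imp_AE_eq_0:
  fixes g :: "real \<Rightarrow> real"
  assumes g[measurable]: "g \<in> borel_measurable borel"
    and int: "\<And>t. integrable lborel (\<lambda>x. \<bar>g x\<bar> * exp (t * \<bar>x\<bar>))"
    and mom: "\<And>n. (LINT x|lborel. g x * x ^ n) = 0"
  shows "AE x in lborel. g x = 0"
proof -
  have gi: "integrable lborel g"
    using int[of 0] by (simp add: integrable_abs_iff)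
  define p q where "p x = max (g x) 0" and "q x = max (- g x) 0" for x
  have pq: "g x = p x - q x" "0 \<le> p x" "0 \<le> q x" for x
    by (auto simp: p_def q_def)
  have [measurable]: "p \<in> borel_measurable borel" "q \<in> borel_measurable borel"
    by (simp_all add: p_def[abs_def] q_def[abs_def])
  have i[simp]: "integrable lborel p" "integrable lborel q"
    by (rule Bochner_Integration.integrable_bound[OF gi]; auto simp: p_def q_def)+
  define m where "m = (LINT x|lborel. p x)"
  \<comment> \<open>The vanishing zeroth moment gives both parts the same mass, hence the same
    normalising constant.\<close>
  have m: "m = (LINT x|lborel. q x)"
    using mom[of 0] by (simp add: pq m_def)
  have "m \<ge> 0" by (simp add: m_def pq)
  show ?thesis
  proof (cases "m = 0")
    case True
    then have "AE x in lborel. p x = 0" "AE x in lborel. q x = 0"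
      using integral_nonneg_eq_0_iff_AE[of lborel p] integral_nonneg_eq_0_iff_AE[of lborel q] m m_def
      by (auto simp: pq)
    then show ?thesis by eventually_elim (simp add: pq)
  next
    case False
    with \<open>m \<ge> 0\<close> have "m > 0" by simp
    define D where "D u = density lborel (\<lambda>x. ennreal (u x / m))" for u :: "real \<Rightarrow> real"
    have iexp_int: "integrable lborel (\<lambda>x. u x *\<^sub>R iexp (t * x))" if "integrable lborel u"
      for u :: "real \<Rightarrow> real" and t
      using that borel_measurable_integrable[OF that]
      by (intro Bochner_Integration.integrable_bound[OF that]) auto
    have D: "real_distribution (D u) \<and> (\<forall>t. char (D u) t
        = (LINT x|lborel. u x *\<^sub>R iexp (t * x)) /\<^sub>R m)"
      if [measurable]: "u \<in> borel_measurable borel" and u: "\<And>x. 0 \<le> u x" "integrable lborel u"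
        "(LINT x|lborel. u x) = m" for u
    proof -
      have "prob_space (D u)"
      proof
        have "emeasure (D u) (space (D u)) = (\<integral>\<^sup>+x. ennreal (u x / m) \<partial>lborel)"
          unfolding D_def by (subst emeasure_density) auto
        also have "\<dots> = ennreal (LINT x|lborel. u x / m)"
          using u \<open>m > 0\<close> by (intro nn_integral_eq_integral) auto
        finally show "emeasure (D u) (space (D u)) = 1"
          using u(3) \<open>m > 0\<close> by simp
      qed
      then have "real_distribution (D u)"
        by (auto simp: real_distribution_def real_distribution_axioms_def D_def)
      moreover have "char (D u) t = (LINT x|lborel. u x *\<^sub>R iexp (t * x)) /\<^sub>R m" for t
      proof -
        have "char (D u) t = (LINT x|lborel. (u x / m) *\<^sub>R iexp (t * x))"
          unfolding char_def D_def using u \<open>m > 0\<close> by (subst integral_density) auto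
        also have "\<dots> = (LINT x|lborel. (u x *\<^sub>R iexp (t * x)) /\<^sub>R m)"
          by (simp only: divide_inverse mult.commute scaleR_scaleR)
        also have "\<dots> = (LINT x|lborel. u x *\<^sub>R iexp (t * x)) /\<^sub>R m"
          by (intro integral_scaleR_right iexp_int u(2))
        finally show ?thesis .
      qed
      ultimately show ?thesis by blast
    qed
    have "(LINT x|lborel. p x *\<^sub>R iexp (t * x)) = (LINT x|lborel. q x *\<^sub>R iexp (t * x))" for t
    proof -
      have "(LINT x|lborel. p x *\<^sub>R iexp (t * x)) - (LINT x|lborel. q x *\<^sub>R iexp (t * x))
          = (LINT x|lborel. g x *\<^sub>R iexp (t * x))"
        by (subst Bochner_Integration.integral_diff[symmetric])
          (simp_all only: iexp_int i pq(1) scaleR_left_diff_distrib)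
      then show ?thesis using integral_iexp_eq_0[OF g int mom, of t] by simp
    qed
    then have "char (D p) = char (D q)"
      using D[of p] D[of q] by (auto simp: pq m m_def[symmetric])
    then have eq: "D p = D q"
      using D[of p] D[of q] by (intro Levy_uniqueness) (auto simp: pq m m_def[symmetric])
    have "AE x in lborel. ennreal (p x / m) = ennreal (q x / m)"
      by (rule sigma_finite_measure.density_unique[OF sigma_finite_lborel _ _ eq[unfolded D_def]]) simp_all
    then show ?thesis
    proof eventually_elim
      case (elim x)
      then have "p x / m = q x / m"
        by (rule ennreal_inj[THEN iffD1, rotated 2]) (use pq(2,3)[of x] \<open>m > 0\<close> in simp_all)
      then show ?case using \<open>m > 0\<close> by (simp add: pq(1))
    qed
  qed
qed

text \<open>Half of the quadratic decay absorbs the linear term: (t - a |x|)^2 \<ge> 0 gives t |x|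
  \<le> t^2 / (2 a) + (a / 2) x^2. What remains is a rescaled normal density.\<close>

lemma exp_quadratic_integrable:
  fixes a :: real
  assumes "a > 0"
  shows "integrable lborel (\<lambda>x. exp (t * \<bar>x\<bar> - a * x\<^sup>2))"
proof (rule Bochner_Integration.integrable_bound)
  have "(\<lambda>x. sqrt (2 * pi) * (std_normal_density x * x ^ 0)) = (\<lambda>x. exp (- x\<^sup>2 / 2))"
    by (rule ext) (simp add: std_normal_density_def)
  with integrable_mult_right[OF integrable_std_normal_moment[of 0], of "sqrt (2 * pi)"]
  have "integrable lborel (\<lambda>x::real. exp (- x\<^sup>2 / 2))"
    by (simp only:)
  from lborel_integrable_real_affine[OF this, of "sqrt a" 0] assms
  have "integrable lborel (\<lambda>x. exp (- (0 + sqrt a * x)\<^sup>2 / 2))"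
    by simp
  moreover have "(\<lambda>x. exp (- (0 + sqrt a * x)\<^sup>2 / 2)) = (\<lambda>x. exp (- (a / 2 * x\<^sup>2)))"
    using assms by (simp add: power_mult_distrib)
  ultimately have "integrable lborel (\<lambda>x. exp (- (a / 2 * x\<^sup>2)))"
    by (simp only:)
  then show "integrable lborel (\<lambda>x. exp (t\<^sup>2 / (2 * a)) * exp (- (a / 2 * x\<^sup>2)))"
    by (rule integrable_mult_right)
  have "t * \<bar>x\<bar> - a * x\<^sup>2 \<le> t\<^sup>2 / (2 * a) + - (a / 2 * x\<^sup>2)" for x
  proof -
    have "0 \<le> (t - a * \<bar>x\<bar>)\<^sup>2" by simp
    also have "\<dots> = t\<^sup>2 - 2 * a * t * \<bar>x\<bar> + a\<^sup>2 * x\<^sup>2" by (simp add: power2_diff power_mult_distrib)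
    finally show ?thesis using assms by (simp add: field_simps power2_eq_square)
  qed
  then show "AE x in lborel. norm (exp (t * \<bar>x\<bar> - a * x\<^sup>2))
      \<le> norm (exp (t\<^sup>2 / (2 * a)) * exp (- (a / 2 * x\<^sup>2)))"
    by (simp add: exp_add[symmetric])
qed simp

text \<open>The exponent is half that of the Gaussian being differentiated in
  \<open>hermite\<close>, as in \<open>hermite_eq\<close>; products in Re w and Im w are thus
  monomials times \<open>hermite \<sigma> 0 0 w\<close>.\<close>

definition gauss_monomial :: "real \<Rightarrow> nat \<Rightarrow> real \<Rightarrow> complex"
  where "gauss_monomial \<sigma> n x = of_real (x ^ n * exp (- \<sigma> / 2 * x\<^sup>2))"

lemma L2_C_gauss_monomial:
  assumes "\<sigma> > 0"
  shows "gauss_monomial \<sigma> n \<in> L2_C"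
proof -
  have sq: "(norm (gauss_monomial \<sigma> n x))\<^sup>2 = (\<bar>x\<bar> ^ n)\<^sup>2 * exp (- \<sigma> * x\<^sup>2)" for x
    by (simp add: gauss_monomial_def norm_mult norm_power power_mult_distrib flip: exp_double)
  have "integrable lborel (\<lambda>x. (norm (gauss_monomial \<sigma> n x))\<^sup>2)"
  proof (rule Bochner_Integration.integrable_bound)
    show "integrable lborel (\<lambda>x. (fact n)\<^sup>2 * exp (2 * \<bar>x\<bar> - \<sigma> * x\<^sup>2))"
      by (intro integrable_mult_right exp_quadratic_integrable assms)
    have "(\<bar>x\<bar> ^ n)\<^sup>2 * exp (- \<sigma> * x\<^sup>2) \<le> (fact n)\<^sup>2 * exp (2 * \<bar>x\<bar> - \<sigma> * x\<^sup>2)" for x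
    proof -
      have "(\<bar>x\<bar> ^ n)\<^sup>2 * exp (- \<sigma> * x\<^sup>2) \<le> (fact n * exp \<bar>x\<bar>)\<^sup>2 * exp (- \<sigma> * x\<^sup>2)"
        by (intro mult_right_mono power_mono power_le_fact_exp) auto
      also have "\<dots> = (fact n)\<^sup>2 * (exp (2 * \<bar>x\<bar>) * exp (- \<sigma> * x\<^sup>2))"
        by (simp only: power_mult_distrib exp_double mult.assoc)
      finally show ?thesis by (simp flip: exp_add)
    qed
    then show "AE x in lborel. norm ((norm (gauss_monomial \<sigma> n x))\<^sup>2)
        \<le> norm ((fact n)\<^sup>2 * exp (2 * \<bar>x\<bar> - \<sigma> * x\<^sup>2))"
      unfolding sq by simp
  qed (simp add: gauss_monomial_def[abs_def])
  then show ?thesis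
    by (simp add: L2_C_def gauss_monomial_def[abs_def])
qed

text \<open>A function in L^2 need not have moments, but its product with the Gaussian has all
  exponential moments, because the Gaussian times \<open>exp (t * \<bar>x\<bar>)\<close> is again in
  L^2. Orthogonality to the monomials says that the moments of this product vanish. Real and
  imaginary parts are separated because the moment lemma concerns real functions.\<close>

lemma total_gauss_monomial:
  assumes "\<sigma> > 0"
  shows "total_C (gauss_monomial \<sigma>)"
  unfolding total_C_def
proof (intro ballI impI)
  fix f :: "real \<Rightarrow> complex"
  assume f: "f \<in> L2_C" and z: "\<forall>k. ip_C f (gauss_monomial \<sigma> k) = 0"
  have [measurable]: "f \<in> borel_measurable borel" by (rule L2_C_measurable[OF f])
  let ?G = "\<lambda>x. exp (- \<sigma> / 2 * x\<^sup>2)"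
  have G: "?G x * exp (t * \<bar>x\<bar>) = exp (t * \<bar>x\<bar> - \<sigma> / 2 * x\<^sup>2)" for t x
    by (simp flip: exp_add)
  have eL: "(\<lambda>x. of_real (exp (t * \<bar>x\<bar> - \<sigma> / 2 * x\<^sup>2))) \<in> L2_C" for t
  proof -
    have "(norm (complex_of_real (exp (t * \<bar>x\<bar> - \<sigma> / 2 * x\<^sup>2))))\<^sup>2
        = exp (2 * t * \<bar>x\<bar> - \<sigma> * x\<^sup>2)" for x
      by (simp add: algebra_simps flip: exp_double)
    then show ?thesis
      using exp_quadratic_integrable[OF assms, of "2 * t"] by (simp add: L2_C_def)
  qed
  have *: "integrable lborel (\<lambda>x. norm (f x) * ?G x * exp (t * \<bar>x\<bar>))" for t
    using L2_C_norm_mult_integrable[OF f eL, of t]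
        by (simp only: mult.assoc G norm_of_real abs_exp_cancel)
  have fG: "integrable lborel (\<lambda>x. f x * cnj (gauss_monomial \<sigma> n x))" for n
    by (intro ip_C_integrable f L2_C_gauss_monomial assms)
  have "AE x in lborel. Re (f x) * ?G x = 0"
  proof (rule moments_eq_0_imp_AE_eq_0)
    show "integrable lborel (\<lambda>x. \<bar>Re (f x) * ?G x\<bar> * exp (t * \<bar>x\<bar>))" for t
      by (rule Bochner_Integration.integrable_bound[OF *[of t]])
        (simp_all add: abs_mult mult_right_mono abs_Re_le_cmod)
    show "(LINT x|lborel. Re (f x) * ?G x * x ^ n) = 0" for n
    proof -
      have "Re (ip_C f (gauss_monomial \<sigma> n)) = (LINT x|lborel. Re (f x) * ?G x * x ^ n)"
        unfolding ip_C_def using fG[of n]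
        by (subst integral_Re[symmetric]) (simp_all add: gauss_monomial_def mult_ac)
      then show ?thesis using z by simp
    qed
  qed simp
  moreover have "AE x in lborel. Im (f x) * ?G x = 0"
  proof (rule moments_eq_0_imp_AE_eq_0)
    show "integrable lborel (\<lambda>x. \<bar>Im (f x) * ?G x\<bar> * exp (t * \<bar>x\<bar>))" for t
      by (rule Bochner_Integration.integrable_bound[OF *[of t]])
        (simp_all add: abs_mult mult_right_mono abs_Im_le_cmod)
    show "(LINT x|lborel. Im (f x) * ?G x * x ^ n) = 0" for n
    proof -
      have "Im (ip_C f (gauss_monomial \<sigma> n)) = (LINT x|lborel. Im (f x) * ?G x * x ^ n)"
        unfolding ip_C_def using fG[of n]
        by (subst integral_Im[symmetric]) (simp_all add: gauss_monomial_def mult_ac)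
      then show ?thesis using z by simp
    qed
  qed simp
  ultimately show "AE x in lborel. f x = 0"
    by eventually_elim (simp add: complex_eq_iff)
qed

section \<open>Tensor products and transport of orthogonal bases\<close>

definition tensor :: "('a \<Rightarrow> complex) \<Rightarrow> ('b \<Rightarrow> complex) \<Rightarrow> 'a \<times> 'b \<Rightarrow> complex"
  where "tensor u v = (\<lambda>(x, y). u x * v y)"

lemma tensor_measurable [measurable]:
  fixes u :: "'a::euclidean_space \<Rightarrow> complex" and v :: "'b::euclidean_space \<Rightarrow> complex"
  assumes [measurable]: "u \<in> borel_measurable borel" "v \<in> borel_measurable borel"
  shows "tensor u v \<in> borel_measurable borel"
  unfolding tensor_def borel_prod[symmetric] by measurable

lemma integrable_lborel_tensor:
  fixes u :: "'a::euclidean_space \<Rightarrow> 'c::{real_normed_field, banach, second_countable_topology}"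
    and v :: "'b::euclidean_space \<Rightarrow> 'c"
  assumes u: "integrable lborel u" and v: "integrable lborel v"
  shows "integrable lborel (\<lambda>(x, y). u x * v y)"
proof -
  have [measurable]: "u \<in> borel_measurable borel" "v \<in> borel_measurable borel"
    using borel_measurable_integrable[OF u] borel_measurable_integrable[OF v] by simp_all
  have "integrable (lborel \<Otimes>\<^sub>M lborel) (\<lambda>(x, y). u x * v y)"
    by (rule lborel_pair.Fubini_integrable) (use u v in \<open>auto simp: norm_mult\<close>)
  then show ?thesis by (simp add: lborel_prod)
qed

lemma L2_C_tensor:
  assumes u: "u \<in> L2_C" and v: "v \<in> L2_C"
  shows "tensor u v \<in> L2_C"
proof -
  have [measurable]: "u \<in> borel_measurable borel" "v \<in> borel_measurable borel"
    using assms by (simp_all add: L2_C_measurable)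
  have "integrable lborel (\<lambda>(x, y). (norm (u x))\<^sup>2 * (norm (v y))\<^sup>2)"
    using u v by (intro integrable_lborel_tensor) (simp_all add: L2_C_def)
  moreover have "tensor u v \<in> borel_measurable borel" by measurable
  ultimately show ?thesis
    by (simp add: L2_C_def tensor_def case_prod_unfold norm_mult power_mult_distrib)
qed

lemma ip_C_tensor:
  assumes "u \<in> L2_C" "v \<in> L2_C" "u' \<in> L2_C" "v' \<in> L2_C"
  shows "ip_C (tensor u v) (tensor u' v') = ip_C u u' * ip_C v v'"
proof -
  have "integrable lborel (\<lambda>(x, y). (u x * cnj (u' x)) * (v y * cnj (v' y)))"
    by (intro integrable_lborel_tensor ip_C_integrable assms)
  then have "integrable (lborel \<Otimes>\<^sub>M lborel) (\<lambda>(x, y). (u x * cnj (u' x)) * (v y * cnj (v' y)))"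
    by (simp add: lborel_prod)
  from lborel_pair.integral_fst[OF this]
  have "ip_C u u' * ip_C v v' = (LINT z|lborel. (case z of (x, y)
      \<Rightarrow> (u x * cnj (u' x)) * (v y * cnj (v' y))))"
    by (simp add: ip_C_def lborel_prod)
  also have "\<dots> = ip_C (tensor u v) (tensor u' v')"
    by (simp add: ip_C_def tensor_def case_prod_unfold mult_ac)
  finally show ?thesis ..
qed

lemma sq_C_tensor:
  assumes "u \<in> L2_C" "v \<in> L2_C"
  shows "sq_C (tensor u v) = sq_C u * sq_C v"
  using ip_C_tensor[OF assms assms] sq_C_eq_ip_C[of u] sq_C_eq_ip_C[of v] sq_C_eq_ip_C[of
      "tensor u v"]
  by (metis of_real_eq_iff of_real_mult)

text \<open>The slices of f are tested against v first. The resulting functions F l of x are in L^2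
  by Cauchy-Schwarz and orthogonal to every u k by Fubini. Countably many l yield one null set
  outside which all F l vanish, and there totality of v applies to the slice.\<close>

lemma total_C_tensor:
  fixes u :: "'k \<Rightarrow> 'a::euclidean_space \<Rightarrow> complex"
    and v :: "'l::countable \<Rightarrow> 'b::euclidean_space \<Rightarrow> complex"
  assumes u: "total_C u" "\<And>k. u k \<in> L2_C" and v: "total_C v" "\<And>l. v l \<in> L2_C"
  shows "total_C (\<lambda>(k, l). tensor (u k) (v l))"
  unfolding total_C_def
proof (intro ballI impI)
  fix f :: "'a \<times> 'b \<Rightarrow> complex"
  assume f: "f \<in> L2_C" and z: "\<forall>k. ip_C f (case k of (k, l) \<Rightarrow> tensor (u k) (v l)) = 0"
  have fm: "f \<in> borel_measurable borel" by (rule L2_C_measurable[OF f])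
  then have [measurable]: "f \<in> borel_measurable (borel \<Otimes>\<^sub>M borel)" by (simp add: borel_prod)
  have [measurable]: "v l \<in> borel_measurable borel" for l by (rule L2_C_measurable[OF v(2)])
  have f2: "integrable (lborel \<Otimes>\<^sub>M lborel) (\<lambda>(x, y). (norm (f (x, y)))\<^sup>2)"
    using f by (simp add: L2_C_def lborel_prod case_prod_unfold)
  have slice: "AE x in lborel. (\<lambda>y. f (x, y)) \<in> L2_C"
    using lborel_pair.AE_integrable_fst[OF f2] by eventually_elim (simp add: L2_C_def)
  define F where "F l x = ip_C (\<lambda>y. f (x, y)) (v l)" for l x
  have Fm[measurable]: "F l \<in> borel_measurable borel" for l
    unfolding F_def ip_C_def by measurable
  have F: "F l \<in> L2_C" for l
  proof -
    have i: "integrable lborel (\<lambda>x. sq_C (\<lambda>y. f (x, y)) * sq_C (v l))"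
      using lborel_pair.integrable_fst[OF f2] by (simp add: sq_C_def)
    have le: "AE x in lborel. norm ((norm (F l x))\<^sup>2) \<le> norm (sq_C (\<lambda>y. f (x, y)) * sq_C (v l))"
      using slice
    proof eventually_elim
      case (elim x)
      have "(norm (F l x))\<^sup>2 \<le> (sqrt (sq_C (\<lambda>y. f (x, y))) * sqrt (sq_C (v l)))\<^sup>2"
        unfolding F_def by (intro power_mono norm_ip_C_le elim v) auto
      then show ?case by (simp add: power_mult_distrib sq_C_nonneg)
    qed
    have "integrable lborel (\<lambda>x. (norm (F l x))\<^sup>2)"
      by (rule Bochner_Integration.integrable_bound[OF i _ le]) simp
    then show ?thesis by (simp add: L2_C_def)
  qed
  have "ip_C (F l) (u k) = 0" for k l
  proof -
    have "integrable (lborel \<Otimes>\<^sub>M lborel) (\<lambda>(x, y). f (x, y) * cnj (u k x * v l y))"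
      using ip_C_integrable[OF f L2_C_tensor[OF u(2)[of k] v(2)[of l]]]
      by (simp add: lborel_prod tensor_def case_prod_unfold)
    from lborel_pair.integral_fst[OF this]
    have "(LINT x|lborel. (LINT y|lborel. f (x, y) * cnj (u k x * v l y)))
        = ip_C f (tensor (u k) (v l))"
      by (simp add: lborel_prod tensor_def ip_C_def case_prod_unfold)
    moreover have "(LINT y|lborel. f (x, y) * cnj (u k x * v l y)) = F l x * cnj (u k x)" for x
    proof -
      have "(LINT y|lborel. f (x, y) * cnj (u k x * v l y))
          = (LINT y|lborel. (f (x, y) * cnj (v l y)) * cnj (u k x))"
        by (simp add: mult_ac)
      then show ?thesis by (simp add: F_def ip_C_def)
    qed
    ultimately show ?thesis using z by (auto simp: ip_C_def)
  qed
  then have "AE x in lborel. \<forall>l. F l x = 0"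
    using u(1) F unfolding total_C_def by (simp add: AE_all_countable)
  with slice have "AE x in lborel. AE y in lborel. f (x, y) = 0"
  proof eventually_elim
    case (elim x)
    then show ?case using v(1) unfolding total_C_def F_def by blast
  qed
  then have "AE z in lborel \<Otimes>\<^sub>M lborel. f z = 0"
  proof (rule lborel_pair.AE_pair_measure[rotated])
    have "{z \<in> space (borel \<Otimes>\<^sub>M borel). f z = 0} \<in> sets (borel \<Otimes>\<^sub>M borel)" by measurable
    then show "{z \<in> space (lborel \<Otimes>\<^sub>M lborel). f z = 0} \<in> sets (lborel \<Otimes>\<^sub>M lborel)"
      by (simp add: space_pair_measure cong: sets_pair_measure_cong)
  qed
  then show "AE z in lborel. f z = 0" unfolding lborel_prod .
qed

lemma orthogonal_basis_C_tensor:
  fixes u :: "'k \<Rightarrow> 'a::euclidean_space \<Rightarrow> complex"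
    and v :: "'l::countable \<Rightarrow> 'b::euclidean_space \<Rightarrow> complex"
  assumes u: "orthogonal_basis_C u" and v: "orthogonal_basis_C v"
  shows "orthogonal_basis_C (\<lambda>(k, l). tensor (u k) (v l))"
proof -
  have "total_C u" "total_C v" using u v by (simp_all add: orthogonal_basis_C_def)
  then show ?thesis
    unfolding orthogonal_basis_C_def
    using basis_L2_C[OF u] basis_L2_C[OF v] basis_sq_C_pos[OF u] basis_sq_C_pos[OF v]
    by (auto simp: L2_C_tensor sq_C_tensor ip_C_tensor basis_ip_C[OF u] basis_ip_C[OF v]
        less_imp_neq[symmetric] intro!: total_C_tensor)
qed

section \<open>Transport along maps that push Lebesgue measure to a constant multiple of Lebesgue
  measure\<close>

context
  fixes T :: "'a::euclidean_space \<Rightarrow> 'b::euclidean_space" and c :: real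
  assumes T [measurable]: "T \<in> borel \<rightarrow>\<^sub>M borel" and c: "c > 0"
    and distr_T: "distr lborel borel T = density lborel (\<lambda>_. ennreal c)"
begin

lemma integrable_transport:
  fixes g :: "'b \<Rightarrow> 'c::{banach, second_countable_topology}"
  assumes [measurable]: "g \<in> borel_measurable borel"
  shows "integrable lborel (\<lambda>x. g (T x)) \<longleftrightarrow> integrable lborel g"
proof -
  have "integrable lborel (\<lambda>x. g (T x)) \<longleftrightarrow> integrable (distr lborel borel T) g"
    by (rule integrable_distr_eq[symmetric]) auto
  also have "\<dots> \<longleftrightarrow> integrable lborel (\<lambda>x. c *\<^sub>R g x)"
    unfolding distr_T using c by (intro integrable_density) auto
  also have "\<dots> \<longleftrightarrow> integrable lborel g"
    using c integrable_scaleR_right[of "inverse c" lborel "\<lambda>x. c *\<^sub>R g x"] by auto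
  finally show ?thesis .
qed

lemma integral_transport:
  fixes g :: "'b \<Rightarrow> 'c::{banach, second_countable_topology}"
  assumes [measurable]: "g \<in> borel_measurable borel"
  shows "(LINT x|lborel. g (T x)) = c *\<^sub>R (LINT x|lborel. g x)"
proof -
  have "(LINT x|lborel. g (T x)) = (LINT y|distr lborel borel T. g y)"
    by (rule integral_distr[symmetric]) auto
  also have "\<dots> = (LINT x|lborel. c *\<^sub>R g x)"
    unfolding distr_T using c by (intro integral_density) auto
  finally show ?thesis by simp
qed

lemma AE_transport:
  assumes [measurable]: "Measurable.pred borel P" and "AE x in lborel. P (T x)"
  shows "AE y in lborel. P y"
proof -
  have "AE y in distr lborel borel T. P y"
    using assms(2) by (subst AE_distr_iff) auto
  then show ?thesis using c unfolding distr_T by (simp add: AE_density)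
qed

lemma L2_C_transport:
  "f \<in> borel_measurable borel \<Longrightarrow> (\<lambda>x. f (T x)) \<in> L2_C \<longleftrightarrow> f \<in> L2_C"
  using integrable_transport[of "\<lambda>x. (norm (f x))\<^sup>2"] by (auto simp: L2_C_def)

lemma ip_C_transport:
  assumes [measurable]: "f \<in> borel_measurable borel" "g \<in> borel_measurable borel"
  shows "ip_C (\<lambda>x. f (T x)) (\<lambda>x. g (T x)) = of_real c * ip_C f g"
proof -
  have "(\<lambda>x. f x * cnj (g x)) \<in> borel_measurable borel"
    by (intro borel_measurable_times borel_measurable_continuous_on[of cnj] continuous_intros assms)
  from integral_transport[OF this] show ?thesis
    by (simp add: ip_C_def scaleR_conv_of_real)
qed

text \<open>A function orthogonal to all b k is pulled back along T, where totality of the composed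
  family makes it vanish. As the density c is positive, the exceptional set is null on the target
  side too.\<close>

lemma total_C_transport:
  assumes b: "\<And>k. b k \<in> borel_measurable borel" and tot: "total_C (\<lambda>k x. b k (T x))"
  shows "total_C b"
  unfolding total_C_def
proof (intro ballI impI)
  fix f assume f: "f \<in> L2_C" and z: "\<forall>k. ip_C f (b k) = 0"
  have fm[measurable]: "f \<in> borel_measurable borel" by (rule L2_C_measurable[OF f])
  have "AE x in lborel. f (T x) = 0"
    using tot z f unfolding total_C_def
    by (simp add: ip_C_transport[OF fm b] L2_C_transport[OF fm])
  then show "AE x in lborel. f x = 0"
    by (intro AE_transport) auto
qed

lemma orthogonal_basis_C_transport:
  assumes m: "\<And>k. b k \<in> borel_measurable borel"
    and b: "orthogonal_basis_C (\<lambda>k x. b k (T x))"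
  shows "orthogonal_basis_C b"
proof -
  have "of_real (sq_C (b k)) = ip_C (\<lambda>x. b k (T x)) (\<lambda>x. b k (T x)) / complex_of_real c" for k
    using c by (simp add: sq_C_eq_ip_C ip_C_transport m)
  then have "sq_C (b k) \<noteq> 0" for k
    using basis_ip_C[OF b, of k k] basis_sq_C_pos[OF b, of k] c
        by (metis divide_eq_0_iff of_real_eq_0_iff less_irrefl)
  moreover have "ip_C (b k) (b l) = 0" if "k \<noteq> l" for k l
    using basis_ip_C[OF b, of k l] that c by (simp add: ip_C_transport m)
  ultimately show ?thesis
    using total_C_transport[of b, OF m] b L2_C_transport[OF m]
    by (simp add: orthogonal_basis_C_def)
qed

end

section \<open>Jacobians of the linear changes of variables\<close>

lemma measurable_Complex: "(\<lambda>(x, y). Complex x y) \<in> borel \<rightarrow>\<^sub>M borel"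
  by (intro borel_measurable_continuous_onI)
      (auto simp: case_prod_unfold Complex_eq intro!: continuous_intros)

lemma distr_lborel_Complex: "distr lborel borel (\<lambda>(x, y). Complex x y) = lborel"
proof (rule lborel_eqI[symmetric])
  fix l u :: complex
  assume le: "\<And>b. b \<in> Basis \<Longrightarrow> l \<bullet> b \<le> u \<bullet> b"
  note [measurable] = measurable_Complex
  have "(\<lambda>(x, y). Complex x y) -` box l u = box (Re l, Im l) (Re u, Im u)"
    by (auto simp: box_def Basis_complex_def Basis_prod_def inner_complex_def)
  then show "emeasure (distr lborel borel (\<lambda>(x, y). Complex x y)) (box l u)
      = (\<Prod>b\<in>Basis. (u - l) \<bullet> b)"
    using le[of 1] le[of \<i>]
    by (simp add: emeasure_distr emeasure_lborel_box_eq Basis_prod_def Basis_complex_def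
        inner_complex_def prod.union_disjoint)
qed simp

lemma distr_lborel_cnj: "distr lborel borel cnj = lborel"
proof (rule lborel_eqI[symmetric])
  fix l u :: complex
  assume le: "\<And>b. b \<in> Basis \<Longrightarrow> l \<bullet> b \<le> u \<bullet> b"
  have "cnj -` box l u = box (Complex (Re l) (- Im u)) (Complex (Re u) (- Im l))"
    by (auto simp: box_def Basis_complex_def inner_complex_def)
  then show "emeasure (distr lborel borel cnj) (box l u) = (\<Prod>b\<in>Basis. (u - l) \<bullet> b)"
    using le[of 1] le[of \<i>]
    by (simp add: emeasure_distr emeasure_lborel_box_eq Basis_complex_def inner_complex_def)
qed simp

text \<open>As i (x + i y) = - y + i x, a quarter turn swaps the coordinates and reverses one of
  them, so preimages of boxes are boxes of the same volume, and boxes determine Lebesgue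
  measure.\<close>

lemma distr_lborel_mult_ii: "distr lborel borel ((*) \<i>) = lborel"
proof (rule lborel_eqI[symmetric])
  fix l u :: complex
  assume le: "\<And>b. b \<in> Basis \<Longrightarrow> l \<bullet> b \<le> u \<bullet> b"
  have "(*) \<i> -` box l u = box (Complex (Im l) (- Re u)) (Complex (Im u) (- Re l))"
    by (auto simp: box_def Basis_complex_def inner_complex_def)
  then show "emeasure (distr lborel borel ((*) \<i>)) (box l u) = (\<Prod>b\<in>Basis. (u - l) \<bullet> b)"
    using le[of 1] le[of \<i>]
    by (simp add: emeasure_distr emeasure_lborel_box_eq Basis_complex_def inner_complex_def mult_ac)
qed simp

lemma distr_lborel_uminus: "distr lborel borel uminus = (lborel :: complex measure)"
  by (subst lborel_affine[of "-1" 0]) (auto simp: density_1)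

lemma nn_integral_distr_lborel:
  fixes f :: "'a::euclidean_space \<Rightarrow> ennreal"
  assumes "distr lborel borel T = lborel" and [measurable]: "T \<in> borel \<rightarrow>\<^sub>M borel" "f
      \<in> borel_measurable borel"
  shows "(\<integral>\<^sup>+x. f (T x) \<partial>lborel) = (\<integral>\<^sup>+x. f x \<partial>lborel)"
proof -
  have "(\<integral>\<^sup>+x. f (T x) \<partial>lborel) = (\<integral>\<^sup>+x. f x \<partial>distr lborel borel T)"
    by (rule nn_integral_distr[symmetric]) auto
  then show ?thesis by (simp add: assms(1))
qed

lemma distr_lborel_mult_ii':
  assumes "\<epsilon> = \<i> \<or> \<epsilon> = - \<i>"
  shows "distr lborel borel ((*) \<epsilon>) = lborel"
proof -
  have "distr (distr lborel borel ((*) \<i>)) borel uminus = distr lborel borel (uminus \<circ> (*) \<i>)"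
    by (rule distr_distr) auto
  moreover have "uminus \<circ> (*) \<i> = (*) (- \<i>)" by auto
  ultimately show ?thesis
    using assms distr_lborel_mult_ii distr_lborel_uminus by auto
qed

text \<open>The inverse of (X, Y) \<mapsto> (P, R). Composing with it turns the transform, a
  function of (X, Y), into a tensor product in (P, R).\<close>

definition mix :: "complex \<Rightarrow> complex \<times> complex \<Rightarrow> complex \<times> complex"
  where "mix \<epsilon> = (\<lambda>(P, R). (P + cnj R, \<epsilon> * (cnj R - P)))"

lemma continuous_mix: "continuous_on S (mix \<epsilon>)"
  unfolding mix_def case_prod_unfold by (intro continuous_intros)

text \<open>The Jacobian is read off from elementary substitutions: conjugation of R, translation of
  R by P, scaling of P by 2 and multiplication of R by \<epsilon>. Only the scaling changes volume,
  by 2^2 in the real plane, and the pushforward gets the reciprocal density 1/4.\<close>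

lemma distr_lborel_mix:
  assumes \<epsilon>: "\<epsilon> = \<i> \<or> \<epsilon> = - \<i>"
  shows "distr lborel borel (mix \<epsilon>) = density lborel (\<lambda>_. ennreal (1 / 4))"
proof (rule measure_eqI)
  fix A :: "(complex \<times> complex) set"
  assume "A \<in> sets (distr lborel borel (mix \<epsilon>))"
  then have A[measurable]: "A \<in> sets (borel \<Otimes>\<^sub>M borel)" "A \<in> sets borel"
    unfolding borel_prod by simp_all
  define g where "g = (\<lambda>z. indicator A z :: ennreal)"
  have g[measurable]: "g \<in> borel_measurable (borel \<Otimes>\<^sub>M borel)" "g \<in> borel_measurable borel"
    by (auto simp: g_def)
  have mix[measurable]: "mix \<epsilon> \<in> borel \<rightarrow>\<^sub>M borel"
    by (intro borel_measurable_continuous_onI continuous_mix)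
  have gm: "(\<lambda>z. g (mix \<epsilon> z)) \<in> borel_measurable (lborel \<Otimes>\<^sub>M lborel)"
    unfolding lborel_prod by measurable
  have "emeasure (distr lborel borel (mix \<epsilon>)) A = (\<integral>\<^sup>+z. g (mix \<epsilon> z) \<partial>lborel)"
    by (subst nn_integral_distr[symmetric, where M' = borel]) (auto simp: g_def)
  also have "\<dots> = (\<integral>\<^sup>+P. \<integral>\<^sup>+R. g (mix \<epsilon> (P, R)) \<partial>lborel \<partial>lborel)"
    using lborel.nn_integral_fst[OF gm] by (simp add: lborel_prod)
  also have "\<dots> = (\<integral>\<^sup>+P. \<integral>\<^sup>+R. g (P + R, \<epsilon> * (R - P)) \<partial>lborel \<partial>lborel)"
    unfolding mix_def prod.case
    by (intro nn_integral_cong nn_integral_distr_lborel[OF distr_lborel_cnj]) measurable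
  \<comment> \<open>Replacing R by P + R removes P from the second coordinate, so that after
    exchanging the integrals P can be rescaled in the first coordinate alone.\<close>
  also have "\<dots> = (\<integral>\<^sup>+P. \<integral>\<^sup>+R. g (2 * P + R, \<epsilon> * R) \<partial>lborel \<partial>lborel)"
  proof (rule nn_integral_cong)
    fix P :: complex
    have e: "P + (P + R) = 2 * P + R" for R by simp
    have "(\<integral>\<^sup>+R. g (P + (P + R), \<epsilon> * ((P + R) - P)) \<partial>lborel) = (\<integral>\<^sup>+R. g (P
        + R, \<epsilon> * (R - P)) \<partial>lborel)"
      by (rule nn_integral_distr_lborel[OF lborel_distr_plus[of P]]) measurable
    then show "(\<integral>\<^sup>+R. g (P + R, \<epsilon> * (R - P)) \<partial>lborel) = (\<integral>\<^sup>+R. g (2 * P + R, \<epsilon> * R) \<partial>lborel)"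
      by (simp only: e add_diff_cancel_left')
  qed
  also have "\<dots> = (\<integral>\<^sup>+R. \<integral>\<^sup>+P. g (2 * P + R, \<epsilon> * R) \<partial>lborel \<partial>lborel)"
    by (rule lborel_pair.Fubini'[symmetric]) measurable
  also have "\<dots> = (\<integral>\<^sup>+R. ennreal (1 / 4) * (\<integral>\<^sup>+P. g (P, \<epsilon> * R) \<partial>lborel) \<partial>lborel)"
  proof (rule nn_integral_cong)
    fix R :: complex
    have "(\<integral>\<^sup>+P. g (P, \<epsilon> * R) \<partial>lborel)
        = (\<integral>\<^sup>+P. g (P, \<epsilon> * R) \<partial>density (distr lborel borel (\<lambda>x. R
            + 2 *\<^sub>R x)) (\<lambda>_. ennreal (\<bar>2\<bar> ^ DIM(complex))))"
      by (rule arg_cong[OF lborel_affine]) simp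
    also have "\<dots> = 4 * (\<integral>\<^sup>+P. g (2 * P + R, \<epsilon> * R) \<partial>lborel)"
      by (simp add: nn_integral_density nn_integral_distr nn_integral_cmult add.commute scaleR_conv_of_real)
    finally have *: "(\<integral>\<^sup>+P. g (P, \<epsilon> * R) \<partial>lborel) = 4 * (\<integral>\<^sup>+P. g (2 * P + R, \<epsilon> * R) \<partial>lborel)" .
    have "ennreal (1 / 4) * 4 = ennreal (1 / 4) * ennreal 4" by simp
    also have "\<dots> = 1" by (subst ennreal_mult[symmetric]) auto
    finally show "(\<integral>\<^sup>+P. g (2 * P + R, \<epsilon> * R) \<partial>lborel)
        = ennreal (1 / 4) * (\<integral>\<^sup>+P. g (P, \<epsilon> * R) \<partial>lborel)"
      unfolding * mult.assoc[symmetric] by simp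
  qed
  also have "\<dots> = ennreal (1 / 4) * (\<integral>\<^sup>+R. \<integral>\<^sup>+P. g (P, \<epsilon> * R) \<partial>lborel \<partial>lborel)"
    by (rule nn_integral_cmult) measurable
  also have "(\<integral>\<^sup>+R. \<integral>\<^sup>+P. g (P, \<epsilon> * R) \<partial>lborel \<partial>lborel) = (\<integral>\<^sup>+R. \<integral>\<^sup>+P. g (P, R) \<partial>lborel \<partial>lborel)"
    by (rule nn_integral_distr_lborel[OF distr_lborel_mult_ii'[OF \<epsilon>]]) measurable
  also have "\<dots> = (\<integral>\<^sup>+z. g z \<partial>lborel)"
    using lborel_pair.nn_integral_snd[of g] by (simp add: lborel_prod)
  also have "ennreal (1 / 4) * \<dots> = emeasure (density lborel (\<lambda>_. ennreal (1 / 4))) A"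
    by (simp add: g_def emeasure_density nn_integral_cmult_indicator)
  finally show "emeasure (distr lborel borel (mix \<epsilon>)) A
      = emeasure (density lborel (\<lambda>_. ennreal (1 / 4))) A" .
qed simp

text \<open>Inverse to Z \<mapsto> (X, Y) with X = \<open>re_vec Z\<close> and Y =
  \<open>im_vec Z\<close>; it only permutes the four real coordinates.\<close>

definition pair_to_bicomplex :: "complex \<times> complex \<Rightarrow> bicomplex"
  where "pair_to_bicomplex = (\<lambda>(x, y). Bicomplex (Complex (Re x) (Re y)) (Complex (Im x) (Im y)))"

lemma re_im_vec_pair [simp]:
  "re_vec (pair_to_bicomplex (x, y)) = x" "im_vec (pair_to_bicomplex (x, y)) = y"
  by (simp_all add: re_vec_def im_vec_def pair_to_bicomplex_def)

lemma pair_to_bicomplex_measurable: "pair_to_bicomplex \<in> borel \<rightarrow>\<^sub>M borel"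
proof -
  have "linear pair_to_bicomplex"
    by (auto simp: linear_iff pair_to_bicomplex_def bicomplex_eq_iff complex_eq_iff)
  then have "continuous_on UNIV pair_to_bicomplex"
      by (rule linear_continuous_on_compose[OF continuous_on_id, simplified])
  then show ?thesis by (rule borel_measurable_continuous_onI)
qed

lemma distr_lborel_pair_to_bicomplex: "distr lborel borel pair_to_bicomplex = lborel"
proof (rule lborel_eqI[symmetric])
  fix l u :: bicomplex
  note [measurable] = pair_to_bicomplex_measurable
  assume le: "\<And>b. b \<in> Basis \<Longrightarrow> l \<bullet> b \<le> u \<bullet> b"
  have "pair_to_bicomplex -` box l u = box (re_vec l, im_vec l) (re_vec u, im_vec u)"
    by (auto simp: box_def Basis_complex_def Basis_prod_def inner_complex_def Basis_bicomplex_def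
        inner_bicomplex_def pair_to_bicomplex_def re_vec_def im_vec_def)
  then have "emeasure (distr lborel borel pair_to_bicomplex) (box l u)
      = emeasure lborel (box (re_vec l, im_vec l) (re_vec u, im_vec u))"
    by (simp add: emeasure_distr)
  also have "\<dots> = (\<Prod>b\<in>Basis. ((re_vec u, im_vec u) - (re_vec l, im_vec l)) \<bullet> b)"
    using le[of "Bicomplex 1 0"] le[of "Bicomplex \<i> 0"] le[of "Bicomplex 0 1"] le[of
        "Bicomplex 0 \<i>"]
    by (intro emeasure_lborel_box)
      (auto simp: Basis_prod_def Basis_complex_def Basis_bicomplex_def inner_complex_def
        inner_bicomplex_def re_vec_def im_vec_def)
  also have "(\<Prod>b\<in>Basis. ((re_vec u, im_vec u) - (re_vec l, im_vec l)) \<bullet> b)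
      = (\<Prod>b\<in>Basis. (u - l) \<bullet> b)"
    by (simp add: Basis_prod_def Basis_complex_def Basis_bicomplex_def inner_complex_def
        inner_bicomplex_def prod.union_disjoint re_vec_def im_vec_def)
  finally show "emeasure (distr lborel borel pair_to_bicomplex) (box l u)
      = (\<Prod>b\<in>Basis. (u - l) \<bullet> b)" .
qed simp

section \<open>Wirtinger calculus and Hermite polynomials\<close>

text \<open>The complex Hermite (Ito) polynomials, scaled by \<sigma>: what is left of a Hermite
  function when its Gaussian is removed. At n = 0 the truncated n - 1 is harmless because its
  coefficient is 0.\<close>

fun hpoly :: "real \<Rightarrow> nat \<Rightarrow> nat \<Rightarrow> complex \<Rightarrow> complex"
  where
    "hpoly \<sigma> 0 n z = (of_real \<sigma> * cnj z) ^ n"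
  | "hpoly \<sigma> (Suc m) n z
      = of_real \<sigma> * z * hpoly \<sigma> m n z - of_real \<sigma> * of_nat n * hpoly \<sigma> m (n - 1) z"

text \<open>The defining recurrence read downwards. The factor m on both sides makes it true at m =
  0 as well, where m - 1 truncates, so that it can be handed to \<open>algebra\<close> without a
  case distinction.\<close>

lemma hpoly_Suc_left:
  "of_nat m * hpoly \<sigma> m n z = of_nat m * (of_real \<sigma> * z * hpoly \<sigma> (m - 1) n z
    - of_real \<sigma> * of_nat n * hpoly \<sigma> (m - 1) (n - 1) z)"
  by (cases m) auto

text \<open>Raising both indices gives the same result in either order. Facts 1 and 3 are the
  induction hypothesis at n and n - 1, fact 2 is the defining recurrence, and the factors of 2 and 3
  make the truncated predecessors exact.\<close>

lemma hpoly_Suc_right: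
  "hpoly \<sigma> m (Suc n) z
    = of_real \<sigma> * cnj z * hpoly \<sigma> m n z - of_real \<sigma> * of_nat m * hpoly \<sigma> (m - 1) n z"
proof (induction m arbitrary: n)
  case (Suc m)
  define s where "s = complex_of_real \<sigma>"
  define h where "h = hpoly \<sigma>"
  have 1: "h m (Suc n) z = s * cnj z * h m n z - s * of_nat m * h (m - 1) n z"
    using Suc.IH by (simp add: h_def s_def)
  have 2: "of_nat m * h m n z
      = of_nat m * (s * z * h (m - 1) n z - s * of_nat n * h (m - 1) (n - 1) z)"
    unfolding h_def s_def by (rule hpoly_Suc_left)
  have 3: "of_nat n * h m n z
      = of_nat n * (s * cnj z * h m (n - 1) z - s * of_nat m * h (m - 1) (n - 1) z)"
    using Suc.IH[of "n - 1"] by (cases n) (simp_all add: h_def s_def)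
  have "s * z * h m (Suc n) z - s * of_nat (Suc n) * h m n z
      = s * cnj z * (s * z * h m n z - s * of_nat n * h m (n - 1) z) - s * of_nat (Suc m) * h m n z"
    using 2 3 unfolding 1 of_nat_Suc by algebra
  then show ?case by (simp add: h_def s_def)
qed simp

lemma cnj_hpoly: "cnj (hpoly \<sigma> m n z) = hpoly \<sigma> n m z"
proof (induction m arbitrary: n)
  case 0
  show ?case by (induction n) simp_all
next
  case (Suc m)
  then show ?case by (simp add: hpoly_Suc_right)
qed

text \<open>At z = 0 the recurrence lowers both indices together, up to a nonzero factor, so only
  the diagonal survives. Orthogonality of the Hermite functions rests on this.\<close>

lemma hpoly_0_eq_0_iff:
  assumes "\<sigma> \<noteq> 0"
  shows "hpoly \<sigma> m n 0 = 0 \<longleftrightarrow> m \<noteq> n"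
proof (induction m arbitrary: n)
  case (Suc m)
  then show ?case using assms by (cases n) (simp_all del: of_nat_Suc)
qed (simp add: power_0_left)

text \<open>Here a and b are the derivatives in w and cnj w. The full real derivative is recorded
  because it obeys the product and chain rules, whereas \<open>wirtinger\<close> and
  \<open>wirtinger_bar\<close> are built from \<open>vector_derivative\<close>, which has an
  unspecified value where no derivative exists.\<close>

definition has_wirtinger :: "(complex \<Rightarrow> complex) \<Rightarrow> complex \<Rightarrow> complex \<Rightarrow> complex \<Rightarrow> bool"
  where "has_wirtinger f a b z \<longleftrightarrow> (f has_derivative (\<lambda>d. a * d + b * cnj d)) (at z)"

lemma has_wirtinger_partial:
  assumes "has_wirtinger f a b z"
  shows "partial_x f z = a + b" "partial_y f z = \<i> * (a - b)"
proof -
  have *: "((\<lambda>t. f (z + v * of_real t)) has_vector_derivative (a * v + b * cnj v)) (at 0)" for v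
  proof -
    have "((\<lambda>t. z + v * of_real t) has_derivative (\<lambda>t. v * of_real t)) (at (0::real))"
      by (auto intro!: derivative_eq_intros)
    moreover have "(f has_derivative (\<lambda>d. a * d + b * cnj d)) (at (z + v * of_real 0))"
      using assms by (simp add: has_wirtinger_def)
    ultimately have "(f \<circ> (\<lambda>t. z + v * of_real t) has_derivative
        (\<lambda>d. a * d + b * cnj d) \<circ> (\<lambda>t. v * of_real t)) (at (0::real))"
      by (rule diff_chain_at)
    then show ?thesis
      by (simp add: has_vector_derivative_def comp_def scaleR_conv_of_real algebra_simps)
  qed
  show "partial_x f z = a + b"
    using vector_derivative_at[OF *[of 1]] by (simp add: partial_x_def)
  show "partial_y f z = \<i> * (a - b)"
    using vector_derivative_at[OF *[of \<i>]] by (simp add: partial_y_def algebra_simps)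
qed

lemma has_wirtinger_imp:
  assumes "has_wirtinger f a b z"
  shows "wirtinger f z = a" "wirtinger_bar f z = b"
  unfolding wirtinger_def wirtinger_bar_def has_wirtinger_partial[OF assms]
  by (simp_all add: complex_eq_iff)

lemma has_wirtinger_eq_rhs: "has_wirtinger f a b z \<Longrightarrow> a = a' \<Longrightarrow> b = b' \<Longrightarrow> has_wirtinger f a' b' z"
  by simp

lemma has_wirtinger_mult:
  assumes "has_wirtinger f a b z" "has_wirtinger g a' b' z"
  shows "has_wirtinger (\<lambda>w. f w * g w) (a * g z + f z * a') (b * g z + f z * b') z"
  using has_derivative_mult[OF assms[unfolded has_wirtinger_def]]
  by (simp add: has_wirtinger_def algebra_simps)

lemma has_wirtinger_diff:
  assumes "has_wirtinger f a b z" "has_wirtinger g a' b' z"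
  shows "has_wirtinger (\<lambda>w. f w - g w) (a - a') (b - b') z"
  using has_derivative_diff[OF assms[unfolded has_wirtinger_def]]
  by (simp add: has_wirtinger_def algebra_simps)

lemma has_wirtinger_cmult:
  assumes "has_wirtinger f a b z"
  shows "has_wirtinger (\<lambda>w. c * f w) (c * a) (c * b) z"
  using has_derivative_mult_right[OF assms[unfolded has_wirtinger_def], of c]
  by (simp add: has_wirtinger_def algebra_simps)

lemma has_wirtinger_id: "has_wirtinger (\<lambda>w. w) 1 0 z"
  by (simp add: has_wirtinger_def)

lemma has_wirtinger_cnj: "has_wirtinger cnj 0 1 z"
  by (simp add: has_wirtinger_def bounded_linear_cnj bounded_linear_imp_has_derivative)

lemma has_wirtinger_cnj_power:
  "has_wirtinger (\<lambda>w. (c * cnj w) ^ n) 0 (of_nat n * c * (c * cnj z) ^ (n - 1)) z"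
proof (induction n)
  case (Suc n)
  have "has_wirtinger (\<lambda>w. (c * cnj w) * (c * cnj w) ^ n)
      ((c * 0) * (c * cnj z) ^ n + (c * cnj z) * 0)
      ((c * 1) * (c * cnj z) ^ n + (c * cnj z) * (of_nat n * c * (c * cnj z) ^ (n - 1))) z"
    by (intro has_wirtinger_mult[OF has_wirtinger_cmult[OF has_wirtinger_cnj] Suc])
  moreover have "(c * 1) * (c * cnj z) ^ n + (c * cnj z) * (of_nat n * c * (c * cnj z) ^ (n - 1))
      = of_nat (Suc n) * c * (c * cnj z) ^ (Suc n - 1)"
    by (cases n) (simp_all add: algebra_simps)
  ultimately show ?case by simp
qed (simp add: has_wirtinger_def)

lemma has_wirtinger_exp:
  assumes "has_wirtinger f a b z"
  shows "has_wirtinger (\<lambda>w. exp (f w)) (a * exp (f z)) (b * exp (f z)) z"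
proof -
  have "(exp has_derivative (*) (exp (f z))) (at (f z))"
    using DERIV_exp by (simp add: has_field_derivative_def)
  from diff_chain_at[OF assms[unfolded has_wirtinger_def] this]
  show ?thesis by (simp add: has_wirtinger_def comp_def algebra_simps)
qed

lemma has_wirtinger_shift: "has_wirtinger f a b (z + c) \<Longrightarrow> has_wirtinger (\<lambda>w. f (w + c)) a b z"
  unfolding has_wirtinger_def
  using diff_chain_at[of "\<lambda>w. w + c" "\<lambda>d. d" z f "\<lambda>d. a * d + b * cnj d",
      OF has_derivative_add_const[OF has_derivative_ident]]
  by (simp add: comp_def)

text \<open>The two derivatives lower m and n respectively. In the induction step, the explicit
  factor z contributes one copy of \<open>hpoly \<sigma> m n\<close>, and
  \<open>hpoly_Suc_left\<close> folds the other terms into m further copies.\<close>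

lemma has_wirtinger_hpoly:
  "has_wirtinger (hpoly \<sigma> m n) (of_real \<sigma> * of_nat m * hpoly \<sigma> (m - 1) n z)
    (of_real \<sigma> * of_nat n * hpoly \<sigma> m (n - 1) z) z"
proof (induction m arbitrary: n)
  case 0
  have "hpoly \<sigma> 0 n = (\<lambda>w. (of_real \<sigma> * cnj w) ^ n)" by auto
  then show ?case
    using has_wirtinger_cnj_power[of "of_real \<sigma>" n z] by (simp add: mult_ac)
next
  case (Suc m)
  let ?s = "complex_of_real \<sigma>"
  let ?h = "hpoly \<sigma>"
  have "has_wirtinger (\<lambda>w. ?s * (w * ?h m n w) - ?s * of_nat n * ?h m (n - 1) w)
      (?s * (1 * ?h m n z + z * (?s * of_nat m * ?h (m - 1) n z)) -
        ?s * of_nat n * (?s * of_nat m * ?h (m - 1) (n - 1) z))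
      (?s * (0 * ?h m n z + z * (?s * of_nat n * ?h m (n - 1) z)) -
        ?s * of_nat n * (?s * of_nat (n - 1) * ?h m (n - 1 - 1) z)) z"
    by (intro has_wirtinger_diff has_wirtinger_cmult has_wirtinger_mult has_wirtinger_id Suc.IH)
  moreover have "?h (Suc m) n = (\<lambda>w. ?s * (w * ?h m n w) - ?s * of_nat n * ?h m (n - 1) w)"
    by (auto simp: mult_ac)
  moreover have "?s * (1 * ?h m n z + z * (?s * of_nat m * ?h (m - 1) n z)) -
        ?s * of_nat n * (?s * of_nat m * ?h (m - 1) (n - 1) z) = ?s * of_nat (Suc m) * ?h m n z"
    using hpoly_Suc_left[of m \<sigma> n z] unfolding of_nat_Suc by algebra
  moreover have "?s * (0 * ?h m n z + z * (?s * of_nat n * ?h m (n - 1) z)) -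
        ?s * of_nat n * (?s * of_nat (n - 1) * ?h m (n - 1 - 1) z)
      = ?s * of_nat n * ?h (Suc m) (n - 1) z"
    by (simp add: algebra_simps)
  ultimately show ?case by simp
qed

text \<open>With \<open>w * cnj w\<close> in place of the squared norm, this is the exponential of a quadratic
  polynomial in \<open>w\<close> and \<open>cnj w\<close>.\<close>

definition gauss :: "real \<Rightarrow> complex \<Rightarrow> complex \<Rightarrow> complex"
  where "gauss \<sigma> p w = exp (of_real \<sigma> * (p * w - cnj p * cnj w - w * cnj w))"

text \<open>The terms with p are p w minus its conjugate, hence imaginary: p contributes only a
  phase.\<close>

lemma norm_gauss: "norm (gauss \<sigma> p w) = exp (- \<sigma> * (norm w)\<^sup>2)"
  by (simp add: gauss_def cmod_power2) (simp add: power2_eq_square algebra_simps)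

lemma gauss_0: "gauss \<sigma> 0 w = of_real (exp (- \<sigma> * (norm w)\<^sup>2))"
  by (simp add: gauss_def complex_norm_square[symmetric] flip: exp_of_real del: of_real_power)

lemma has_wirtinger_gauss:
  "has_wirtinger (gauss \<sigma> p) (of_real \<sigma> * (p - cnj w) * gauss \<sigma> p w)
    (of_real \<sigma> * (- cnj p - w) * gauss \<sigma> p w) w"
proof -
  have "has_wirtinger (\<lambda>w. exp (of_real \<sigma> * (p * w - cnj p * cnj w - w * cnj w)))
      (of_real \<sigma> * (p * 1 - cnj p * 0 - (1 * cnj w + w * 0)) * gauss \<sigma> p w)
      (of_real \<sigma> * (p * 0 - cnj p * 1 - (0 * cnj w + w * 1)) * gauss \<sigma> p w) w"
    unfolding gauss_def
    by (intro has_wirtinger_exp has_wirtinger_cmult has_wirtinger_diff has_wirtinger_mult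
        has_wirtinger_id has_wirtinger_cnj)
  moreover have "gauss \<sigma> p = (\<lambda>w. exp (of_real \<sigma> * (p * w - cnj p * cnj w - w * cnj w)))"
    by (auto simp: gauss_def)
  ultimately show ?thesis by simp
qed

lemma wirtinger_funpow_gauss:
  "(wirtinger ^^ n) (gauss \<sigma> 0) = (\<lambda>w. (- 1) ^ n * (hpoly \<sigma> 0 n w * gauss \<sigma> 0 w))"
proof (induction n)
  case (Suc n)
  have "wirtinger (\<lambda>w. (- 1) ^ n * (hpoly \<sigma> 0 n w * gauss \<sigma> 0 w)) w
      = (- 1) ^ Suc n * (hpoly \<sigma> 0 (Suc n) w * gauss \<sigma> 0 w)" for w
    using has_wirtinger_imp(1)[OF has_wirtinger_cmult[OF has_wirtinger_mult[OF has_wirtinger_hpoly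
          has_wirtinger_gauss[of \<sigma> 0]]], of "(- 1) ^ n" \<sigma> 0 n w]
    by simp
  then show ?case using Suc by auto
qed simp

text \<open>By the product rule a derivative lowers n in \<open>hpoly\<close> or brings down -
  \<sigma> w from the Gaussian. Together these are minus the right-hand side of the recurrence, so
  each derivative raises m and changes the sign.\<close>

lemma wirtinger_bar_funpow_gauss:
  "(wirtinger_bar ^^ m) ((wirtinger ^^ n) (gauss \<sigma> 0))
    = (\<lambda>w. (- 1) ^ (m + n) * (hpoly \<sigma> m n w * gauss \<sigma> 0 w))"
proof (induction m)
  case 0
  then show ?case by (simp add: wirtinger_funpow_gauss)
next
  case (Suc m)
  have "wirtinger_bar (\<lambda>w. (- 1) ^ (m + n) * (hpoly \<sigma> m n w * gauss \<sigma> 0 w)) w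
      = (- 1) ^ (Suc m + n) * (hpoly \<sigma> (Suc m) n w * gauss \<sigma> 0 w)" for w
    using has_wirtinger_imp(2)[OF has_wirtinger_cmult[OF has_wirtinger_mult[OF has_wirtinger_hpoly
          has_wirtinger_gauss[of \<sigma> 0]]], of "(- 1) ^ (m + n)" \<sigma> m n w]
    by (simp add: algebra_simps)
  then show ?case using Suc by auto
qed

lemma hermite_eq: "hermite \<sigma> m n z = hpoly \<sigma> m n z * of_real (exp (- \<sigma> / 2 * (norm z)\<^sup>2))"
proof -
  have "exp (\<sigma> / 2 * (norm z)\<^sup>2) * exp (- \<sigma> * (norm z)\<^sup>2) = exp (- \<sigma> / 2 * (norm z)\<^sup>2)"
    by (simp flip: exp_add)
  moreover have "hermite \<sigma> m n z = (- 1) ^ (m + n) * (- 1) ^ (m + n) * hpoly \<sigma> m n z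
      * of_real (exp (\<sigma> / 2 * (norm z)\<^sup>2) * exp (- \<sigma> * (norm z)\<^sup>2))"
    unfolding hermite_def gauss_0[symmetric] wirtinger_bar_funpow_gauss of_real_mult
    by (simp only: mult_ac)
  moreover have "(- 1 :: complex) ^ (m + n) * (- 1) ^ (m + n) = 1"
    by (simp flip: power_mult_distrib)
  ultimately show ?thesis by simp
qed

section \<open>Gaussian decay and integration by parts\<close>

text \<open>The rate c is existential because multiplication by w is paid for by a smaller rate.
  Such decay gives integrability, membership in \<open>L2_C\<close> and the domination needed for
  integration by parts.\<close>

definition rapid :: "(complex \<Rightarrow> complex) \<Rightarrow> bool"
  where "rapid f \<longleftrightarrow> f \<in> borel_measurable borel \<and>
    (\<exists>C c. c > 0 \<and> (\<forall>w. norm (f w) \<le> C * exp (- c * (norm w)\<^sup>2)))"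

lemma rapidI:
  "f \<in> borel_measurable borel \<Longrightarrow> c > 0 \<Longrightarrow> (\<And>w. norm (f w) \<le> C * exp (- c * (norm w)\<^sup>2)) \<Longrightarrow> rapid f"
  by (auto simp: rapid_def)

lemma rapidE:
  assumes "rapid f"
  obtains C c where "f \<in> borel_measurable borel" "c > 0" "C \<ge> 0"
    "\<And>w. norm (f w) \<le> C * exp (- c * (norm w)\<^sup>2)"
proof -
  obtain C c where *: "f \<in> borel_measurable borel" "c > 0"
    "\<And>w. norm (f w) \<le> C * exp (- c * (norm w)\<^sup>2)"
    using assms by (auto simp: rapid_def)
  have "C \<ge> 0" using norm_ge_zero order_trans[OF _ *(3)[of 0]] by simp
  with * that show ?thesis by blast
qed

lemma rapid_measurable: "rapid f \<Longrightarrow> f \<in> borel_measurable borel"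
  by (simp add: rapid_def)

lemma rapid_add:
  assumes "rapid f" "rapid g"
  shows "rapid (\<lambda>w. f w + g w)"
proof -
  from assms(1) obtain C c where f: "f \<in> borel_measurable borel" "c > 0" "C \<ge> 0"
    "\<And>w. norm (f w) \<le> C * exp (- c * (norm w)\<^sup>2)" by (rule rapidE) blast
  from assms(2) obtain D d where g: "g \<in> borel_measurable borel" "d > 0" "D \<ge> 0"
    "\<And>w. norm (g w) \<le> D * exp (- d * (norm w)\<^sup>2)" by (rule rapidE) blast
  define m where "m = min c d"
  show ?thesis
  proof (rule rapidI)
    show "m > 0" using f(2) g(2) by (simp add: m_def)
    fix w :: complex
    have "exp (- c * (norm w)\<^sup>2) \<le> exp (- m * (norm w)\<^sup>2)" "exp (- d * (norm w)\<^sup>2)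
        \<le> exp (- m * (norm w)\<^sup>2)"
      by (auto simp: m_def intro!: mult_right_mono)
    then have "C * exp (- c * (norm w)\<^sup>2) + D * exp (- d * (norm w)\<^sup>2)
        \<le> C * exp (- m * (norm w)\<^sup>2) + D * exp (- m * (norm w)\<^sup>2)"
      using f(3) g(3) by (intro add_mono mult_left_mono) auto
    then show "norm (f w + g w) \<le> (C + D) * exp (- m * (norm w)\<^sup>2)"
      using norm_triangle_le[OF add_mono[OF f(4)[of w] g(4)[of w]]] by (simp add: distrib_right)
  qed (use f(1) g(1) in simp)
qed

lemma rapid_cmult:
  assumes "rapid f"
  shows "rapid (\<lambda>w. c * f w)"
proof -
  from assms obtain C d where f: "f \<in> borel_measurable borel" "d > 0" "C \<ge> 0"
    "\<And>w. norm (f w) \<le> C * exp (- d * (norm w)\<^sup>2)" by (rule rapidE) blast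
  have "norm (c * f w) \<le> (norm c * C) * exp (- d * (norm w)\<^sup>2)" for w
    using mult_left_mono[OF f(4)[of w], of "norm c"] by (simp add: norm_mult mult_ac)
  then show ?thesis using f(1,2) by (intro rapidI) auto
qed

lemma rapid_diff: "rapid f \<Longrightarrow> rapid g \<Longrightarrow> rapid (\<lambda>w. f w - g w)"
  using rapid_add[OF _ rapid_cmult[of g "-1"]] by simp

lemma rapid_id_mult:
  assumes "rapid f"
  shows "rapid (\<lambda>w. w * f w)"
proof -
  from assms obtain C d where f: "f \<in> borel_measurable borel" "d > 0" "C \<ge> 0"
    "\<And>w. norm (f w) \<le> C * exp (- d * (norm w)\<^sup>2)" by (rule rapidE) blast
  show ?thesis
  proof (rule rapidI)
    show "d / 2 > 0" using f(2) by simp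
    fix w :: complex
    \<comment> \<open>This comes from (1 - d |w|)^2 \<ge> 0; half of the decay pays for the factor
      w.\<close>
    have "norm w \<le> exp (1 / (2 * d)) * exp (d / 2 * (norm w)\<^sup>2)"
    proof -
      have "0 \<le> (1 - d * norm w)\<^sup>2 / (2 * d)" using f(2) by simp
      also have "\<dots> = 1 / (2 * d) - norm w + d / 2 * (norm w)\<^sup>2"
        using f(2) by (simp add: field_simps power2_eq_square)
      finally have "norm w \<le> 1 / (2 * d) + d / 2 * (norm w)\<^sup>2" by simp
      also have "\<dots> \<le> exp (1 / (2 * d) + d / 2 * (norm w)\<^sup>2)"
        using exp_ge_add_one_self[of "1 / (2 * d) + d / 2 * (norm w)\<^sup>2"] by linarith
      finally show ?thesis by (simp only: exp_add)
    qed
    then have "norm w * norm (f w)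
        \<le> (exp (1 / (2 * d)) * exp (d / 2 * (norm w)\<^sup>2)) * (C * exp (- d * (norm w)\<^sup>2))"
      by (intro mult_mono f) auto
    also have "\<dots> = C * exp (1 / (2 * d)) * (exp (d / 2 * (norm w)\<^sup>2) * exp (- d * (norm w)\<^sup>2))"
      by (simp only: mult_ac)
    also have "exp (d / 2 * (norm w)\<^sup>2) * exp (- d * (norm w)\<^sup>2) = exp (- (d / 2) * (norm w)\<^sup>2)"
      by (simp flip: exp_add)
    finally show "norm (w * f w) \<le> C * exp (1 / (2 * d)) * exp (- (d / 2) * (norm w)\<^sup>2)"
      by (simp only: norm_mult)
  qed (use f(1) in simp)
qed

lemma rapid_cnj_mult:
  assumes "rapid f"
  shows "rapid (\<lambda>w. cnj w * f w)"
proof -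
  from rapid_id_mult[OF assms] obtain C d where "d > 0"
    "\<And>w. norm (w * f w) \<le> C * exp (- d * (norm w)\<^sup>2)" by (rule rapidE) blast
  then show ?thesis using rapid_measurable[OF assms]
    by (intro rapidI[where c = d and C = C]) (auto simp: norm_mult)
qed

lemma rapid_hpoly_mult:
  assumes "rapid f"
  shows "rapid (\<lambda>w. hpoly \<sigma> m n (w + a) * f w)"
proof (induction m arbitrary: n)
  case 0
  show ?case
  proof (induction n)
    case (Suc n)
    have "rapid (\<lambda>w. of_real \<sigma> * (cnj w * (hpoly \<sigma> 0 n (w + a) * f w))
        + (of_real \<sigma> * cnj a) * (hpoly \<sigma> 0 n (w + a) * f w))"
      by (intro rapid_add rapid_cmult rapid_cnj_mult Suc)
    then show ?case by (simp add: algebra_simps)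
  qed (use assms in simp)
next
  case (Suc m)
  have "rapid (\<lambda>w. of_real \<sigma> * (w * (hpoly \<sigma> m n (w + a) * f w))
      + (of_real \<sigma> * a) * (hpoly \<sigma> m n (w + a) * f w)
      - (of_real \<sigma> * of_nat n) * (hpoly \<sigma> m (n - 1) (w + a) * f w))"
    by (intro rapid_add rapid_diff rapid_cmult rapid_id_mult Suc)
  then show ?case by (simp add: algebra_simps)
qed

lemma gauss_norm_integrable:
  assumes "c > 0"
  shows "integrable lborel (\<lambda>w::complex. exp (- c * (norm w)\<^sup>2))"
proof -
  have "integrable lborel (\<lambda>(x, y). exp (- c * x\<^sup>2) * exp (- c * y\<^sup>2))"
    using exp_quadratic_integrable[OF assms, of 0] by (intro integrable_lborel_tensor) simp_all
  moreover have "exp (- c * (norm (Complex x y))\<^sup>2) = exp (- c * x\<^sup>2) * exp (- c * y\<^sup>2)" for x y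
    by (simp add: cmod_power2 distrib_left flip: exp_add)
  ultimately have "integrable lborel (\<lambda>z. exp (- c * (norm ((\<lambda>(x, y). Complex x y) z))\<^sup>2))"
    by (simp add: case_prod_unfold)
  then show ?thesis
    using integrable_transport[of "\<lambda>(x, y). Complex x y" 1 "\<lambda>w. exp (- c * (norm w)\<^sup>2)"]
      distr_lborel_Complex measurable_Complex
    by (simp add: density_1)
qed

lemma rapid_integrable:
  assumes "rapid f"
  shows "integrable lborel f"
proof -
  from assms obtain C d where f: "f \<in> borel_measurable borel" "d > 0" "C \<ge> 0"
    "\<And>w. norm (f w) \<le> C * exp (- d * (norm w)\<^sup>2)" by (rule rapidE) blast
  show ?thesis
    by (rule Bochner_Integration.integrable_bound[OF integrable_mult_right[OF gauss_norm_integrable[OF f(2)], of C]])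
      (use f in \<open>auto simp: abs_mult\<close>)
qed

lemma rapid_L2_C:
  assumes "rapid f"
  shows "f \<in> L2_C"
proof -
  from assms obtain C d where f: "f \<in> borel_measurable borel" "d > 0" "C \<ge> 0"
    "\<And>w. norm (f w) \<le> C * exp (- d * (norm w)\<^sup>2)" by (rule rapidE) blast
  have "(norm (f w))\<^sup>2 \<le> C\<^sup>2 * exp (- (2 * d) * (norm w)\<^sup>2)" for w
  proof -
    have "(norm (f w))\<^sup>2 \<le> (C * exp (- d * (norm w)\<^sup>2))\<^sup>2"
      using f(4) by (intro power_mono) auto
    then show ?thesis by (simp add: power_mult_distrib mult.assoc flip: exp_double)
  qed
  then have "integrable lborel (\<lambda>w. (norm (f w))\<^sup>2)"
    using f(1,2)
    by (intro Bochner_Integration.integrable_bound[OF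
          integrable_mult_right[OF gauss_norm_integrable[of "2 * d"], of "C\<^sup>2"]])
       (auto simp: abs_mult)
  then show ?thesis using f(1) by (simp add: L2_C_def)
qed

text \<open>The integral of a directional derivative vanishes, since it is a limit of integrals of
  difference quotients, which vanish by translation invariance.\<close>

lemma integral_directional_derivative:
  assumes f: "rapid f" and A: "rapid A" and B: "rapid B"
    and W: "\<And>w. has_wirtinger f (A w) (B w) w" and v: "norm v = 1"
  shows "(LINT w|lborel. A w * v + B w * cnj v) = 0"
proof -
  define D where "D w = A w * v + B w * cnj v" for w
  from A obtain Ca a where A: "A \<in> borel_measurable borel" "a > 0" "Ca \<ge> 0"
    "\<And>w. norm (A w) \<le> Ca * exp (- a * (norm w)\<^sup>2)" by (rule rapidE) blast
  from B obtain Cb b where B: "B \<in> borel_measurable borel" "b > 0" "Cb \<ge> 0"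
    "\<And>w. norm (B w) \<le> Cb * exp (- b * (norm w)\<^sup>2)" by (rule rapidE) blast
  have [measurable]: "f \<in> borel_measurable borel" "A \<in> borel_measurable borel" "B
      \<in> borel_measurable borel"
    using f A B by (simp_all add: rapid_measurable)
  have Dm[measurable]: "D \<in> borel_measurable borel"
    unfolding D_def by measurable
  define t :: "nat \<Rightarrow> real" where "t n = 1 / (real n + 1)" for n
  have t: "0 < t n" "t n \<le> 1" for n by (simp_all add: t_def field_simps)
  have t0: "t \<longlonglongrightarrow> 0"
    unfolding t_def using LIMSEQ_inverse_real_of_nat by (simp add: inverse_eq_divide add.commute)
  define s where "s n w = (f (w + t n *\<^sub>R v) - f w) /\<^sub>R t n" for n w
  \<comment> \<open>K dominates all difference quotients. As t n \<le> 1 and |v| = 1, the mean value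
    inequality involves only points u of the unit ball around w, where |u|^2 \<ge> |w|^2 / 2 - 1.
    This costs the factors exp a and exp b and half of each rate.\<close>
  define K where "K w = Ca * exp a * exp (- (a / 2) * (norm w)\<^sup>2)
      + Cb * exp b * exp (- (b / 2) * (norm w)\<^sup>2)" for w :: complex
  have s_bound: "norm (s n w) \<le> K w" for n w
  proof -
    have "norm (f (w + t n *\<^sub>R v) - f w) \<le> K w * norm (w + t n *\<^sub>R v - w)"
    proof (rule differentiable_bound[of "cball w 1" f "\<lambda>u d. A u * d + B u * cnj d"])
      fix u assume u: "u \<in> cball w 1"
      show "(f has_derivative (\<lambda>d. A u * d + B u * cnj d)) (at u within cball w 1)"
        using W[of u] by (auto simp: has_wirtinger_def intro: has_derivative_at_withinI)
      have "norm w \<le> norm u + 1"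
        using u norm_triangle_ineq[of u "w - u"] by (simp add: dist_norm)
      then have "(norm w)\<^sup>2 \<le> (norm u + 1)\<^sup>2" by (intro power_mono) auto
      also have "\<dots> \<le> 2 * (norm u)\<^sup>2 + 2"
        using sum_squares_bound[of "norm u" 1] by (simp add: power2_sum)
      finally have wu: "(norm w)\<^sup>2 / 2 - 1 \<le> (norm u)\<^sup>2" by simp
      have "c * exp (- d * (norm u)\<^sup>2) \<le> c * exp d * exp (- (d / 2) * (norm w)\<^sup>2)" if "c \<ge> 0"
          "d > 0" for c d
      proof -
        have "- d * (norm u)\<^sup>2 \<le> d + - (d / 2) * (norm w)\<^sup>2"
          using mult_left_mono[OF wu, of d] that by (simp add: algebra_simps)
        then show ?thesis using that by (simp add: mult.assoc mult_left_mono flip: exp_add)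
      qed
      then have K: "norm (A u) + norm (B u) \<le> K w"
        unfolding K_def using A B by (intro add_mono order_trans[OF A(4)] order_trans[OF B(4)]) auto
      show "onorm (\<lambda>d. A u * d + B u * cnj d) \<le> K w"
      proof (rule onorm_le)
        fix d
        have "norm (A u * d + B u * cnj d) \<le> norm (A u) * norm d + norm (B u) * norm d"
          using norm_triangle_ineq[of "A u * d" "B u * cnj d"] by (simp add: norm_mult)
        also have "\<dots> \<le> K w * norm d"
          using K by (simp add: mult_right_mono flip: distrib_right)
        finally show "norm (A u * d + B u * cnj d) \<le> K w * norm d" .
      qed
    qed (use t[of n] v in \<open>auto simp: dist_norm\<close>)
    then show ?thesis using t[of n] v by (simp add: s_def divide_simps mult.commute)
  qed
  have K: "integrable lborel K"
    unfolding K_def using A(2) B(2)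
    by (intro Bochner_Integration.integrable_add integrable_mult_right gauss_norm_integrable) auto
  have "(\<lambda>n. LINT w|lborel. s n w) \<longlonglongrightarrow> (LINT w|lborel. D w)"
  proof (rule integral_dominated_convergence[OF _ _ K])
    have "(\<lambda>n. s n w) \<longlonglongrightarrow> D w" for w
    proof -
      have "((\<lambda>h. w + h *\<^sub>R v) has_derivative (\<lambda>h. h *\<^sub>R v)) (at (0::real))"
        by (auto intro!: derivative_eq_intros)
      moreover have "(f has_derivative (\<lambda>d. A w * d + B w * cnj d)) (at (w + 0 *\<^sub>R v))"
        using W[of w] by (simp add: has_wirtinger_def)
      ultimately have "(f \<circ> (\<lambda>h. w + h *\<^sub>R v) has_derivative
          (\<lambda>d. A w * d + B w * cnj d) \<circ> (\<lambda>h. h *\<^sub>R v)) (at (0::real))"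
        by (rule diff_chain_at)
      then have "((\<lambda>h. f (w + h *\<^sub>R v)) has_derivative (\<lambda>h. h *\<^sub>R D w)) (at 0)"
        by (simp add: comp_def D_def scaleR_conv_of_real algebra_simps)
      then have "((\<lambda>h. norm (f (w + h *\<^sub>R v) - f w - h *\<^sub>R D w) / norm h) \<longlongrightarrow> 0) (at 0)"
        by (simp add: has_derivative_at)
      moreover have "\<forall>\<^sub>F h in at 0. norm (f (w + h *\<^sub>R v) - f w - h *\<^sub>R D w) / norm h
          = norm ((f (w + h *\<^sub>R v) - f w) /\<^sub>R h - D w)"
        unfolding eventually_at_filter
      proof (intro always_eventually allI impI)
        fix h :: real assume "h \<noteq> 0"
        then have "(f (w + h *\<^sub>R v) - f w) /\<^sub>R h - D w = (f (w + h *\<^sub>R v) - f w - h *\<^sub>R D w) /\<^sub>R h"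
          by (simp add: scaleR_diff_right)
        then show "norm (f (w + h *\<^sub>R v) - f w - h *\<^sub>R D w) / norm h
            = norm ((f (w + h *\<^sub>R v) - f w) /\<^sub>R h - D w)"
          by (simp only: norm_scaleR) (simp add: divide_inverse mult.commute)
      qed
      ultimately have "((\<lambda>h. norm ((f (w + h *\<^sub>R v) - f w) /\<^sub>R h - D w)) \<longlongrightarrow> 0) (at 0)"
        by (rule Lim_transform_eventually)
      then have "((\<lambda>h. (f (w + h *\<^sub>R v) - f w) /\<^sub>R h) \<longlongrightarrow> D w) (at 0)"
        by (simp add: tendsto_norm_zero_iff LIM_zero_iff)
      moreover have "filterlim t (at 0) sequentially"
        using t0 t(1) by (simp add: filterlim_at less_imp_neq[symmetric])
      ultimately show ?thesis
        unfolding s_def by (rule filterlim_compose)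
    qed
    then show "AE w in lborel. (\<lambda>n. s n w) \<longlonglongrightarrow> D w" by simp
  qed (use s_bound in \<open>auto simp: s_def\<close>)
  moreover have "(LINT w|lborel. s n w) = 0" for n
  proof -
    have tr: "distr lborel borel (\<lambda>w. w + t n *\<^sub>R v) = density lborel (\<lambda>_. ennreal 1)"
      using lborel_distr_plus[of "t n *\<^sub>R v"] by (simp add: density_1 add.commute[of _ "t n *\<^sub>R v"])
    have "integrable lborel (\<lambda>w. f (w + t n *\<^sub>R v))"
      by (subst integrable_transport[OF _ _ tr]) (use rapid_integrable[OF f] in auto)
    moreover have "(LINT w|lborel. f (w + t n *\<^sub>R v)) = (LINT w|lborel. f w)"
      by (subst integral_transport[OF _ _ tr]) auto
    ultimately show ?thesis
      using rapid_integrable[OF f] by (simp add: s_def)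
  qed
  ultimately have "(\<lambda>n. 0) \<longlonglongrightarrow> (LINT w|lborel. D w)" by simp
  then show ?thesis by (simp add: LIMSEQ_const_iff D_def)
qed

text \<open>The directions 1 and \<i> show that the integrals of A + B and of A - B vanish.\<close>

lemma integral_wirtinger_eq_0:
  assumes f: "rapid f" and A: "rapid A" and B: "rapid B"
    and W: "\<And>w. has_wirtinger f (A w) (B w) w"
  shows "(LINT w|lborel. A w) = 0" "(LINT w|lborel. B w) = 0"
proof -
  have [simp]: "integrable lborel A" "integrable lborel B"
    using A B by (simp_all add: rapid_integrable)
  have 1: "(LINT w|lborel. A w) + (LINT w|lborel. B w) = 0"
    using integral_directional_derivative[OF f A B W, of 1] by simp
  have "(LINT w|lborel. A w) * \<i> - (LINT w|lborel. B w) * \<i> = 0"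
    using integral_directional_derivative[OF f A B W, of \<i>] by simp
  then have 2: "(LINT w|lborel. A w) = (LINT w|lborel. B w)" by simp
  show "(LINT w|lborel. A w) = 0" "(LINT w|lborel. B w) = 0" using 1 2 by simp_all
qed

lemma rapid_gauss: "\<sigma> > 0 \<Longrightarrow> rapid (gauss \<sigma> p)"
proof (rule rapidI[where c = \<sigma> and C = 1])
  have "continuous_on UNIV (gauss \<sigma> p)"
    unfolding gauss_def by (intro continuous_intros)
  then show "gauss \<sigma> p \<in> borel_measurable borel" by (rule borel_measurable_continuous_onI)
qed (simp_all add: norm_gauss)

text \<open>The integrand of the transform after centring: a is X/2 and p encodes Y. The polynomial
  at w - a is the conjugate of that of the second Hermite function, and conjugation swaps indices,
  so k and l will be n' and m'.\<close>

definition hgauss :: "real \<Rightarrow> complex \<Rightarrow> complex \<Rightarrow> nat \<Rightarrow> nat \<Rightarrow> nat \<Rightarrow> nat \<Rightarrow> complex \<Rightarrow> complex"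
  where "hgauss \<sigma> a p m n k l w = hpoly \<sigma> m n (w + a) * (hpoly \<sigma> k l (w - a) * gauss \<sigma> p w)"

definition hgauss_int :: "real \<Rightarrow> complex \<Rightarrow> complex \<Rightarrow> nat \<Rightarrow> nat \<Rightarrow> nat \<Rightarrow> nat \<Rightarrow> complex"
  where "hgauss_int \<sigma> a p m n k l = (LINT w|lborel. hgauss \<sigma> a p m n k l w)"

context
  fixes \<sigma> :: real and a p :: complex
  assumes \<sigma>: "\<sigma> > 0"
begin

lemma rapid_hgauss: "rapid (hgauss \<sigma> a p m n k l)"
proof -
  have "rapid (\<lambda>w. hpoly \<sigma> m n (w + a) * (hpoly \<sigma> k l (w + (- a)) * gauss \<sigma> p w))"
    by (intro rapid_hpoly_mult rapid_gauss \<sigma>)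
  then show ?thesis by (simp add: hgauss_def[abs_def])
qed

lemma has_wirtinger_hgauss:
  "has_wirtinger (hgauss \<sigma> a p m n k l)
    (of_real \<sigma> * of_nat m * hgauss \<sigma> a p (m - 1) n k l w
        + of_real \<sigma> * of_nat k * hgauss \<sigma> a p m n (k - 1) l w
      + of_real \<sigma> * p * hgauss \<sigma> a p m n k l w - of_real \<sigma> * (cnj w * hgauss \<sigma> a p m n k l w))
    (of_real \<sigma> * of_nat n * hgauss \<sigma> a p m (n - 1) k l w
        + of_real \<sigma> * of_nat l * hgauss \<sigma> a p m n k (l - 1) w
      + (- of_real \<sigma> * cnj p) * hgauss \<sigma> a p m n k l w - of_real \<sigma> * (w
          * hgauss \<sigma> a p m n k l w)) w"
proof -
  have "has_wirtinger (\<lambda>w. hpoly \<sigma> m n (w + a)) (of_real \<sigma> * of_nat m * hpoly \<sigma> (m - 1) n (w + a))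
      (of_real \<sigma> * of_nat n * hpoly \<sigma> m (n - 1) (w + a)) w"
    by (rule has_wirtinger_shift[OF has_wirtinger_hpoly])
  moreover have "has_wirtinger (\<lambda>w. hpoly \<sigma> k l (w
      + (- a))) (of_real \<sigma> * of_nat k * hpoly \<sigma> (k - 1) l (w + (- a)))
      (of_real \<sigma> * of_nat l * hpoly \<sigma> k (l - 1) (w + (- a))) w"
    by (rule has_wirtinger_shift[OF has_wirtinger_hpoly])
  ultimately have W: "has_wirtinger (\<lambda>w. hpoly \<sigma> m n (w + a) * (hpoly \<sigma> k l (w
      + (- a)) * gauss \<sigma> p w))
     (of_real \<sigma> * of_nat m * hpoly \<sigma> (m - 1) n (w + a) * (hpoly \<sigma> k l (w + (- a)) * gauss \<sigma> p w)
      + hpoly \<sigma> m n (w + a) * (of_real \<sigma> * of_nat k * hpoly \<sigma> (k - 1) l (w + (- a)) * gauss \<sigma> p w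
        + hpoly \<sigma> k l (w + (- a)) * (of_real \<sigma> * (p - cnj w) * gauss \<sigma> p w)))
     (of_real \<sigma> * of_nat n * hpoly \<sigma> m (n - 1) (w + a) * (hpoly \<sigma> k l (w + (- a)) * gauss \<sigma> p w)
      + hpoly \<sigma> m n (w + a) * (of_real \<sigma> * of_nat l * hpoly \<sigma> k (l - 1) (w + (- a)) * gauss \<sigma> p w
        + hpoly \<sigma> k l (w + (- a)) * (of_real \<sigma> * (- cnj p - w) * gauss \<sigma> p w))) w"
    by (intro has_wirtinger_mult has_wirtinger_gauss)
  have eq: "hgauss \<sigma> a p m n k l = (\<lambda>w. hpoly \<sigma> m n (w + a) * (hpoly \<sigma> k l (w
      + (- a)) * gauss \<sigma> p w))"
    by (auto simp: hgauss_def)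
  show ?thesis
    unfolding eq by (rule has_wirtinger_eq_rhs[OF W]) (simp_all add: hgauss_def algebra_simps)
qed

text \<open>Integration by parts: differentiating the Gaussian in cnj w produces the factor w, and
  in w the factor cnj w, while the polynomials only have indices lowered. Since the derivatives
  integrate to 0, these moments reduce to lower integrals.\<close>

lemma integral_mult_hgauss:
  "of_real \<sigma> * (LINT w|lborel. w * hgauss \<sigma> a p m n k l w)
    = of_real \<sigma> * of_nat n * hgauss_int \<sigma> a p m (n - 1) k l
        + of_real \<sigma> * of_nat l * hgauss_int \<sigma> a p m n k (l - 1) - of_real \<sigma> * cnj p
        * hgauss_int \<sigma> a p m n k l"
  "of_real \<sigma> * (LINT w|lborel. cnj w * hgauss \<sigma> a p m n k l w)
    = of_real \<sigma> * of_nat m * hgauss_int \<sigma> a p (m - 1) n k l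
        + of_real \<sigma> * of_nat k * hgauss_int \<sigma> a p m n (k - 1) l
        + of_real \<sigma> * p * hgauss_int \<sigma> a p m n k l"
proof -
  have i: "integrable lborel (hgauss \<sigma> a p m n k l)"
      "integrable lborel (\<lambda>w. w * hgauss \<sigma> a p m n k l w)"
    "integrable lborel (\<lambda>w. cnj w * hgauss \<sigma> a p m n k l w)" for m n k l
    by (intro rapid_integrable rapid_hgauss rapid_id_mult rapid_cnj_mult)+
  let ?A = "\<lambda>w. of_real \<sigma> * of_nat m * hgauss \<sigma> a p (m - 1) n k l w
      + of_real \<sigma> * of_nat k * hgauss \<sigma> a p m n (k - 1) l w
      + of_real \<sigma> * p * hgauss \<sigma> a p m n k l w - of_real \<sigma> * (cnj w * hgauss \<sigma> a p m n k l w)"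
  let ?B = "\<lambda>w. of_real \<sigma> * of_nat n * hgauss \<sigma> a p m (n - 1) k l w
      + of_real \<sigma> * of_nat l * hgauss \<sigma> a p m n k (l - 1) w
      + (- of_real \<sigma> * cnj p) * hgauss \<sigma> a p m n k l w - of_real \<sigma> * (w * hgauss \<sigma> a p m n k l w)"
  have "rapid ?A" "rapid ?B"
    by (intro rapid_add rapid_diff rapid_cmult rapid_hgauss rapid_cnj_mult rapid_id_mult)+
  note z = integral_wirtinger_eq_0[OF rapid_hgauss this has_wirtinger_hgauss]
  have "(LINT w|lborel. ?B w) = of_real \<sigma> * of_nat n * hgauss_int \<sigma> a p m (n - 1) k l
      + of_real \<sigma> * of_nat l * hgauss_int \<sigma> a p m n k (l - 1)
      + (- of_real \<sigma> * cnj p) * hgauss_int \<sigma> a p m n k l - of_real \<sigma> * (LINT w|lborel. w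
          * hgauss \<sigma> a p m n k l w)"
    unfolding hgauss_int_def by
        (simp only: Bochner_Integration.integral_diff Bochner_Integration.integral_add
      Bochner_Integration.integrable_add integral_mult_right_zero integrable_mult_right i)
  then show "of_real \<sigma> * (LINT w|lborel. w * hgauss \<sigma> a p m n k l w)
    = of_real \<sigma> * of_nat n * hgauss_int \<sigma> a p m (n - 1) k l
        + of_real \<sigma> * of_nat l * hgauss_int \<sigma> a p m n k (l - 1) - of_real \<sigma> * cnj p
        * hgauss_int \<sigma> a p m n k l"
    unfolding z(2) by (simp add: algebra_simps)
  have "(LINT w|lborel. ?A w) = of_real \<sigma> * of_nat m * hgauss_int \<sigma> a p (m - 1) n k l
      + of_real \<sigma> * of_nat k * hgauss_int \<sigma> a p m n (k - 1) l
      + of_real \<sigma> * p * hgauss_int \<sigma> a p m n k l - of_real \<sigma> * (LINT w|lborel. cnj w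
          * hgauss \<sigma> a p m n k l w)"
    unfolding hgauss_int_def by
        (simp only: Bochner_Integration.integral_diff Bochner_Integration.integral_add
      Bochner_Integration.integrable_add integral_mult_right_zero integrable_mult_right i)
  then show "of_real \<sigma> * (LINT w|lborel. cnj w * hgauss \<sigma> a p m n k l w)
    = of_real \<sigma> * of_nat m * hgauss_int \<sigma> a p (m - 1) n k l
        + of_real \<sigma> * of_nat k * hgauss_int \<sigma> a p m n (k - 1) l
        + of_real \<sigma> * p * hgauss_int \<sigma> a p m n k l"
    unfolding z(1) by (simp add: algebra_simps)
qed

lemma hgauss_Suc:
  "hgauss \<sigma> a p (Suc m) n k l w = of_real \<sigma> * (w * hgauss \<sigma> a p m n k l w)
      + of_real \<sigma> * a * hgauss \<sigma> a p m n k l w - of_real \<sigma> * of_nat n * hgauss \<sigma> a p m (n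
      - 1) k l w"
  "hgauss \<sigma> a p m (Suc n) k l w = of_real \<sigma> * (cnj w * hgauss \<sigma> a p m n k l w)
      + of_real \<sigma> * cnj a * hgauss \<sigma> a p m n k l w - of_real \<sigma> * of_nat m * hgauss \<sigma> a p (m
      - 1) n k l w"
  "hgauss \<sigma> a p m n (Suc k) l w
      = of_real \<sigma> * (w * hgauss \<sigma> a p m n k l w) - of_real \<sigma> * a * hgauss \<sigma> a p m n k l w
      - of_real \<sigma> * of_nat l * hgauss \<sigma> a p m n k (l - 1) w"
  "hgauss \<sigma> a p m n k (Suc l) w
      = of_real \<sigma> * (cnj w * hgauss \<sigma> a p m n k l w) - of_real \<sigma> * cnj a * hgauss \<sigma> a p m n k l w
      - of_real \<sigma> * of_nat k * hgauss \<sigma> a p m n (k - 1) l w"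
  by (simp_all add: hgauss_def hpoly_Suc_right algebra_simps)

text \<open>Raising m produces a factor w + a and a term that lowers n; integration by parts
  produces the latter with opposite sign. After this cancellation m is linked only to l, and
  likewise n only to k, which is why the integral factors into one polynomial for each of these
  pairs.\<close>

lemma integral_hgauss_Suc:
  "hgauss_int \<sigma> a p (Suc m) n k l = of_real \<sigma> * (a - cnj p) * hgauss_int \<sigma> a p m n k l
      + of_real \<sigma> * of_nat l * hgauss_int \<sigma> a p m n k (l - 1)"
  "hgauss_int \<sigma> a p m (Suc n) k l = of_real \<sigma> * (cnj a + p) * hgauss_int \<sigma> a p m n k l
      + of_real \<sigma> * of_nat k * hgauss_int \<sigma> a p m n (k - 1) l"
  "hgauss_int \<sigma> a p m n (Suc k) l = - of_real \<sigma> * (a + cnj p) * hgauss_int \<sigma> a p m n k l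
      + of_real \<sigma> * of_nat n * hgauss_int \<sigma> a p m (n - 1) k l"
  "hgauss_int \<sigma> a p m n k (Suc l) = - of_real \<sigma> * (cnj a - p) * hgauss_int \<sigma> a p m n k l
      + of_real \<sigma> * of_nat m * hgauss_int \<sigma> a p (m - 1) n k l"
proof -
  have i: "integrable lborel (hgauss \<sigma> a p m n k l)"
      "integrable lborel (\<lambda>w. w * hgauss \<sigma> a p m n k l w)"
    "integrable lborel (\<lambda>w. cnj w * hgauss \<sigma> a p m n k l w)" for m n k l
    by (intro rapid_integrable rapid_hgauss rapid_id_mult rapid_cnj_mult)+
  note m = integral_mult_hgauss[of m n k l]
  have "(LINT w|lborel. hgauss \<sigma> a p (Suc m) n k l w)
      = of_real \<sigma> * (LINT w|lborel. w * hgauss \<sigma> a p m n k l w)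
      + of_real \<sigma> * a * hgauss_int \<sigma> a p m n k l
      - of_real \<sigma> * of_nat n * hgauss_int \<sigma> a p m (n - 1) k l"
    unfolding hgauss_Suc hgauss_int_def by (simp only: Bochner_Integration.integral_diff
      Bochner_Integration.integral_add Bochner_Integration.integrable_add
      Bochner_Integration.integrable_diff integral_mult_right_zero integrable_mult_right i)
  then show "hgauss_int \<sigma> a p (Suc m) n k l = of_real \<sigma> * (a - cnj p) * hgauss_int \<sigma> a p m n k l
      + of_real \<sigma> * of_nat l * hgauss_int \<sigma> a p m n k (l - 1)"
    unfolding hgauss_int_def[of _ _ _ "Suc m"] m(1) by (simp add: algebra_simps)
  have "(LINT w|lborel. hgauss \<sigma> a p m (Suc n) k l w)
      = of_real \<sigma> * (LINT w|lborel. cnj w * hgauss \<sigma> a p m n k l w)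
      + of_real \<sigma> * cnj a * hgauss_int \<sigma> a p m n k l
      - of_real \<sigma> * of_nat m * hgauss_int \<sigma> a p (m - 1) n k l"
    unfolding hgauss_Suc hgauss_int_def by (simp only: Bochner_Integration.integral_diff
      Bochner_Integration.integral_add Bochner_Integration.integrable_add
      Bochner_Integration.integrable_diff integral_mult_right_zero integrable_mult_right i)
  then show "hgauss_int \<sigma> a p m (Suc n) k l = of_real \<sigma> * (cnj a + p) * hgauss_int \<sigma> a p m n k l
      + of_real \<sigma> * of_nat k * hgauss_int \<sigma> a p m n (k - 1) l"
    unfolding hgauss_int_def[of _ _ _ m "Suc n"] m(2) by (simp add: algebra_simps)
  have "(LINT w|lborel. hgauss \<sigma> a p m n (Suc k) l w)
      = of_real \<sigma> * (LINT w|lborel. w * hgauss \<sigma> a p m n k l w) - of_real \<sigma> * a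
      * hgauss_int \<sigma> a p m n k l
      - of_real \<sigma> * of_nat l * hgauss_int \<sigma> a p m n k (l - 1)"
    unfolding hgauss_Suc hgauss_int_def by (simp only: Bochner_Integration.integral_diff
      Bochner_Integration.integral_add Bochner_Integration.integrable_add
      Bochner_Integration.integrable_diff integral_mult_right_zero integrable_mult_right i)
  then show "hgauss_int \<sigma> a p m n (Suc k) l = - of_real \<sigma> * (a + cnj p) * hgauss_int \<sigma> a p m n k l
      + of_real \<sigma> * of_nat n * hgauss_int \<sigma> a p m (n - 1) k l"
    unfolding hgauss_int_def[of _ _ _ m n "Suc k"] m(1) by (simp add: algebra_simps)
  have "(LINT w|lborel. hgauss \<sigma> a p m n k (Suc l) w)
      = of_real \<sigma> * (LINT w|lborel. cnj w * hgauss \<sigma> a p m n k l w) - of_real \<sigma> * cnj a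
      * hgauss_int \<sigma> a p m n k l
      - of_real \<sigma> * of_nat k * hgauss_int \<sigma> a p m n (k - 1) l"
    unfolding hgauss_Suc hgauss_int_def by (simp only: Bochner_Integration.integral_diff
      Bochner_Integration.integral_add Bochner_Integration.integrable_add
      Bochner_Integration.integrable_diff integral_mult_right_zero integrable_mult_right i)
  then show "hgauss_int \<sigma> a p m n k (Suc l) = - of_real \<sigma> * (cnj a - p) * hgauss_int \<sigma> a p m n k l
      + of_real \<sigma> * of_nat m * hgauss_int \<sigma> a p (m - 1) n k l"
    unfolding hgauss_int_def[of _ _ _ m n k "Suc l"] m(2) by (simp add: algebra_simps)
qed

text \<open>With m = n = 0, raising k or l leaves no lowering terms, hence pure powers; the next two
  lemmas raise n and then m. The lowering terms of \<open>integral_hgauss_Suc\<close> carry a plus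
  where the recurrence of \<open>hpoly\<close> has a minus; the sign (- 1) ^ (k + l) compensates for
  this.\<close>

lemma integral_hgauss_0:
  "hgauss_int \<sigma> a p 0 0 k l = hgauss_int \<sigma> a p 0 0 0 0 * (- 1) ^ (k
      + l) * (hpoly \<sigma> 0 l (a - cnj p) * hpoly \<sigma> 0 k (cnj a + p))"
proof (induction k)
  case 0
  show ?case
    by (induction l) (simp_all add: integral_hgauss_Suc(4) algebra_simps)
next
  case (Suc k)
  then show ?case by (simp add: integral_hgauss_Suc(3) algebra_simps)
qed

lemma integral_hgauss_1:
  "hgauss_int \<sigma> a p 0 n k l = hgauss_int \<sigma> a p 0 0 0 0 * (- 1) ^ (k
      + l) * (hpoly \<sigma> 0 l (a - cnj p) * hpoly \<sigma> n k (cnj a + p))"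
proof (induction n arbitrary: k)
  case 0
  show ?case by (rule integral_hgauss_0)
next
  case (Suc n)
  show ?case unfolding integral_hgauss_Suc(2) Suc
    by (cases k) (simp_all add: algebra_simps)
qed

lemma integral_hgauss_2:
  "hgauss_int \<sigma> a p m n k l = hgauss_int \<sigma> a p 0 0 0 0 * (- 1) ^ (k
      + l) * (hpoly \<sigma> m l (a - cnj p) * hpoly \<sigma> n k (cnj a + p))"
proof (induction m arbitrary: l)
  case 0
  show ?case by (rule integral_hgauss_1)
next
  case (Suc m)
  show ?case unfolding integral_hgauss_Suc(1) Suc
    by (cases l) (simp_all add: algebra_simps)
qed

end

text \<open>This is the characteristic function of the standard normal distribution. Substituting c
  x with c = sqrt (2 \<sigma>) makes the exponent of the density - \<sigma> x^2, and the frequency c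
  b makes the phase 2 \<sigma> b x.\<close>

lemma integral_gauss_1D:
  fixes \<sigma> b :: real
  assumes \<sigma>: "\<sigma> > 0"
  shows "(LINT x|lborel. exp (of_real \<sigma> * (2 * \<i> * of_real b * of_real x - (of_real x)\<^sup>2)))
    = complex_of_real (sqrt (pi / \<sigma>) * exp (- \<sigma> * b\<^sup>2))"
proof -
  define c where "c = sqrt (2 * \<sigma>)"
  have c: "c > 0" "c\<^sup>2 = 2 * \<sigma>" using \<sigma> by (simp_all add: c_def)
  let ?t = "c * b"
  have "complex_of_real (exp (- ?t\<^sup>2 / 2)) = char std_normal_distribution ?t"
    by (simp add: char_std_normal_distribution)
  also have "\<dots> = (LINT x|lborel. std_normal_density x *\<^sub>R iexp (?t * x))"
    unfolding char_def by (subst integral_density) auto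
  also have "\<dots> = \<bar>c\<bar> *\<^sub>R (LINT x|lborel. std_normal_density (0 + c * x) *\<^sub>R iexp (?t * (0
      + c * x)))"
    using c by (intro lborel_integral_real_affine) simp
  also have "(\<lambda>x. std_normal_density (0 + c * x) *\<^sub>R iexp (?t * (0 + c * x)))
      = (\<lambda>x. (1 / sqrt (2 * pi)) *\<^sub>R exp (of_real \<sigma> * (2 * \<i> * of_real b * of_real x -
          (of_real x)\<^sup>2)))"
  proof
    fix x
    have "std_normal_density (0 + c * x) = (1 / sqrt (2 * pi)) * exp (- \<sigma> * x\<^sup>2)"
      by (simp add: std_normal_density_def power_mult_distrib c)
    moreover have "iexp (?t * (0 + c * x)) = exp (of_real \<sigma> * (2 * \<i> * of_real b * of_real x))"
    proof -
      have t: "?t * (0 + c * x) = \<sigma> * (2 * b * x)"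
        using c(2) by (simp add: power2_eq_square)
      show ?thesis unfolding t by (simp add: mult_ac)
    qed
    moreover have "complex_of_real (exp (- \<sigma> * x\<^sup>2)) * exp (of_real \<sigma> * (2 * \<i> * of_real b
        * of_real x))
        = exp (of_real \<sigma> * (2 * \<i> * of_real b * of_real x - (of_real x)\<^sup>2))"
      by (simp add: exp_of_real[symmetric] algebra_simps flip: exp_add)
    ultimately show "std_normal_density (0 + c * x) *\<^sub>R iexp (?t * (0 + c * x))
        = (1 / sqrt (2 * pi)) *\<^sub>R exp (of_real \<sigma> * (2 * \<i> * of_real b * of_real x - (of_real x)\<^sup>2))"
      by (simp add: scaleR_conv_of_real mult.assoc)
  qed
  finally have *: "complex_of_real (exp (- ?t\<^sup>2 / 2)) = (c / sqrt (2 * pi)) *\<^sub>R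
      (LINT x|lborel. exp (of_real \<sigma> * (2 * \<i> * of_real b * of_real x - (of_real x)\<^sup>2)))"
    using c by simp
  have "sqrt (pi / \<sigma>) * (c / sqrt (2 * pi)) = 1"
    using \<sigma> by (simp add: c_def real_sqrt_divide real_sqrt_mult)
  then have "(LINT x|lborel. exp (of_real \<sigma> * (2 * \<i> * of_real b * of_real x - (of_real x)\<^sup>2)))
      = sqrt (pi / \<sigma>) *\<^sub>R (c / sqrt (2 * pi)) *\<^sub>R
      (LINT x|lborel. exp (of_real \<sigma> * (2 * \<i> * of_real b * of_real x - (of_real x)\<^sup>2)))"
    by (simp only: scaleR_scaleR scaleR_one)
  also have "\<dots> = sqrt (pi / \<sigma>) *\<^sub>R complex_of_real (exp (- ?t\<^sup>2 / 2))"
    by (simp only: *)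
  finally show ?thesis
    using c by (simp add: power_mult_distrib scaleR_conv_of_real)
qed

lemma integral_gauss:
  assumes \<sigma>: "\<sigma> > 0"
  shows "(LINT w|lborel. gauss \<sigma> p w) = of_real (pi / \<sigma> * exp (- \<sigma> * (norm p)\<^sup>2))"
proof -
  let ?e = "\<lambda>b x. exp (of_real \<sigma> * (2 * \<i> * of_real b * of_real x - (of_real x)\<^sup>2)) :: complex"
  have e_int: "integrable lborel (?e b)" for b
  proof (rule Bochner_Integration.integrable_bound[OF exp_quadratic_integrable[OF \<sigma>, of 0]])
    have "norm (?e b x) = exp (- \<sigma> * x\<^sup>2)" for x
      by (simp add: power2_eq_square)
    then show "AE x in lborel. norm (?e b x) \<le> norm (exp (0 * \<bar>x\<bar> - \<sigma> * x\<^sup>2))"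
      by simp
  qed simp
  \<comment> \<open>Here p w - cnj (p w) = 2 i (Im p x + Re p y), so the real variables separate,
    with frequencies Im p and Re p.\<close>
  have g: "gauss \<sigma> p (Complex x y) = ?e (Im p) x * ?e (Re p) y" for x y
    unfolding gauss_def exp_add[symmetric]
    by (rule arg_cong[where f = exp]) (simp add: complex_eq_iff power2_eq_square algebra_simps)
  have "(LINT z|lborel. gauss \<sigma> p ((\<lambda>(x, y). Complex x y) z)) = 1 *\<^sub>R (LINT w|lborel. gauss \<sigma> p w)"
    using rapid_measurable[OF rapid_gauss[OF \<sigma>]] measurable_Complex distr_lborel_Complex
    by (intro integral_transport) (simp_all add: density_1)
  moreover have "(LINT z|lborel. gauss \<sigma> p ((\<lambda>(x, y). Complex x y) z))
      = (LINT x|lborel. ?e (Im p) x) * (LINT y|lborel. ?e (Re p) y)"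
  proof -
    have "integrable (lborel \<Otimes>\<^sub>M lborel) (\<lambda>(x, y). ?e (Im p) x * ?e (Re p) y)"
      using integrable_lborel_tensor[OF e_int e_int] by (simp add: lborel_prod)
    from lborel_pair.integral_fst[OF this] show ?thesis
      by (simp add: lborel_prod case_prod_unfold g)
  qed
  ultimately have "(LINT w|lborel. gauss \<sigma> p w)
      = (LINT x|lborel. ?e (Im p) x) * (LINT y|lborel. ?e (Re p) y)"
    by simp
  also have "\<dots> = of_real ((sqrt (pi / \<sigma>) * exp (- \<sigma> * (Im p)\<^sup>2)) * (sqrt (pi / \<sigma>) * exp (- \<sigma> *
      (Re p)\<^sup>2)))"
    unfolding integral_gauss_1D[OF \<sigma>] by simp
  also have "(sqrt (pi / \<sigma>) * exp (- \<sigma> * (Im p)\<^sup>2)) * (sqrt (pi / \<sigma>) * exp (- \<sigma> * (Re p)\<^sup>2))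
      = (sqrt (pi / \<sigma>) * sqrt (pi / \<sigma>)) * (exp (- \<sigma> * (Im p)\<^sup>2) * exp (- \<sigma> * (Re p)\<^sup>2))"
    by (simp only: mult_ac)
  also have "sqrt (pi / \<sigma>) * sqrt (pi / \<sigma>) = pi / \<sigma>" using \<sigma> by simp
  also have "exp (- \<sigma> * (Im p)\<^sup>2) * exp (- \<sigma> * (Re p)\<^sup>2) = exp (- \<sigma> * (norm p)\<^sup>2)"
    by (simp add: cmod_power2 algebra_simps flip: exp_add)
  finally show ?thesis .
qed

lemma integral_hgauss:
  assumes \<sigma>: "\<sigma> > 0"
  shows "hgauss_int \<sigma> a p m n k l
    = of_real (pi / \<sigma> * exp (- \<sigma> * (norm p)\<^sup>2)) * (- 1) ^ (k + l)
      * (hpoly \<sigma> m l (a - cnj p) * hpoly \<sigma> n k (cnj a + p))"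
  using integral_hgauss_2[OF \<sigma>, of a p m n k l] integral_gauss[OF \<sigma>, of p]
  by (simp add: hgauss_int_def hgauss_def)

section \<open>Orthogonality and totality of the Hermite functions\<close>

lemma hermite_eq_gauss: "hermite \<sigma> m n = (\<lambda>w. hpoly \<sigma> m n (w + 0) * gauss (\<sigma> / 2) 0 w)"
  by (rule ext) (simp add: hermite_eq gauss_0)

lemma rapid_hermite: "\<sigma> > 0 \<Longrightarrow> rapid (hermite \<sigma> m n)"
  unfolding hermite_eq_gauss by (intro rapid_hpoly_mult rapid_gauss) simp

lemma ip_C_hermite:
  assumes \<sigma>: "\<sigma> > 0"
  shows "ip_C (hermite \<sigma> m n) (hermite \<sigma> k l)
    = of_real (pi / \<sigma>) * (- 1) ^ (l + k) * (hpoly \<sigma> m k 0 * hpoly \<sigma> n l 0)"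
proof -
  have "hermite \<sigma> m n w * cnj (hermite \<sigma> k l w) = hgauss \<sigma> 0 0 m n l k w" for w
  proof -
    have "exp (- \<sigma> / 2 * (norm w)\<^sup>2) * exp (- \<sigma> / 2 * (norm w)\<^sup>2) = exp (- \<sigma> * (norm w)\<^sup>2)"
      by (simp flip: exp_add)
    then have "complex_of_real (exp (- \<sigma> / 2 * (norm w)\<^sup>2)) * of_real (exp (- \<sigma> / 2 * (norm w)\<^sup>2))
        = gauss \<sigma> 0 w"
      by (simp only: gauss_0 flip: of_real_mult)
    then show ?thesis
      by (simp add: hermite_eq hgauss_def cnj_hpoly mult_ac)
  qed
  then show ?thesis
    using integral_hgauss[OF \<sigma>, of 0 0 m n l k] by (simp add: ip_C_def hgauss_int_def)
qed

text \<open>Multiplication by a real coordinate stays within the span of the Hermite functions. This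
  is how \<open>total_hermite\<close> reaches the monomials.\<close>

lemma Re_Im_mult_hermite:
  assumes "\<sigma> \<noteq> 0"
  shows "of_real (Re w) * hermite \<sigma> m n w = inverse (2 * of_real \<sigma>) * (hermite \<sigma> (Suc m) n w
      + hermite \<sigma> m (Suc n) w
      + of_real \<sigma> * of_nat n * hermite \<sigma> m (n - 1) w
          + of_real \<sigma> * of_nat m * hermite \<sigma> (m - 1) n w)"
    "of_real (Im w) * hermite \<sigma> m n w
        = inverse (2 * \<i> * of_real \<sigma>) * (hermite \<sigma> (Suc m) n w - hermite \<sigma> m (Suc n) w
      + of_real \<sigma> * of_nat n * hermite \<sigma> m (n - 1) w - of_real \<sigma> * of_nat m * hermite \<sigma> (m
          - 1) n w)"
proof -
  have 1: "of_real \<sigma> * (w * hermite \<sigma> m n w) = hermite \<sigma> (Suc m) n w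
      + of_real \<sigma> * of_nat n * hermite \<sigma> m (n - 1) w"
    by (simp add: hermite_eq algebra_simps)
  have 2: "of_real \<sigma> * (cnj w * hermite \<sigma> m n w) = hermite \<sigma> m (Suc n) w
      + of_real \<sigma> * of_nat m * hermite \<sigma> (m - 1) n w"
    by (simp add: hermite_eq hpoly_Suc_right algebra_simps)
  have re: "of_real (Re w) = (w + cnj w) / 2" and im: "of_real (Im w) = (w - cnj w) / (2 * \<i>)"
    by (simp_all add: complex_eq_iff)
  have "of_real (Re w) * hermite \<sigma> m n w
      = inverse (2 * of_real \<sigma>) * (of_real \<sigma> * (w * hermite \<sigma> m n w)
          + of_real \<sigma> * (cnj w * hermite \<sigma> m n w))"
    unfolding re using assms by (simp add: field_simps)
  then show "of_real (Re w) * hermite \<sigma> m n w = inverse (2 * of_real \<sigma>) * (hermite \<sigma> (Suc m) n w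
      + hermite \<sigma> m (Suc n) w
      + of_real \<sigma> * of_nat n * hermite \<sigma> m (n - 1) w
          + of_real \<sigma> * of_nat m * hermite \<sigma> (m - 1) n w)"
    unfolding 1 2 by (simp only: add_ac diff_conv_add_uminus minus_add_distrib)
  have "of_real (Im w) * hermite \<sigma> m n w
      = inverse (2 * \<i> * of_real \<sigma>) * (of_real \<sigma> * (w * hermite \<sigma> m n w) - of_real \<sigma> * (cnj w
          * hermite \<sigma> m n w))"
    unfolding im using assms by (simp add: field_simps)
  then show "of_real (Im w) * hermite \<sigma> m n w
      = inverse (2 * \<i> * of_real \<sigma>) * (hermite \<sigma> (Suc m) n w - hermite \<sigma> m (Suc n) w
      + of_real \<sigma> * of_nat n * hermite \<sigma> m (n - 1) w - of_real \<sigma> * of_nat m * hermite \<sigma> (m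
          - 1) n w)"
    unfolding 1 2 by (simp only: add_ac diff_conv_add_uminus minus_add_distrib)
qed

lemma gauss_monomial_Complex:
  "gauss_monomial \<sigma> i (Re w) * gauss_monomial \<sigma> j (Im w)
    = of_real (Re w) ^ i * (of_real (Im w) ^ j * hermite \<sigma> 0 0 w)"
proof -
  have "exp (- \<sigma> / 2 * (Re w)\<^sup>2) * exp (- \<sigma> / 2 * (Im w)\<^sup>2) = exp (- \<sigma> / 2 * (norm w)\<^sup>2)"
    by (simp add: cmod_power2 algebra_simps add_divide_distrib flip: exp_add)
  then have "complex_of_real (exp (- \<sigma> / 2 * (Re w)\<^sup>2)) * of_real (exp (- \<sigma> / 2 * (Im w)\<^sup>2))
      = hermite \<sigma> 0 0 w"
    by (simp only: hermite_eq hpoly.simps power_0 mult_1 flip: of_real_mult)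
  moreover have "gauss_monomial \<sigma> i (Re w) * gauss_monomial \<sigma> j (Im w)
      = of_real (Re w) ^ i * (of_real (Im w) ^ j *
        (complex_of_real (exp (- \<sigma> / 2 * (Re w)\<^sup>2)) * of_real (exp (- \<sigma> / 2 * (Im w)\<^sup>2))))"
    by (simp only: gauss_monomial_def of_real_mult of_real_power mult_ac)
  ultimately show ?thesis by (simp only:)
qed

lemma total_gauss_monomial_Complex:
  assumes \<sigma>: "\<sigma> > 0"
  shows "total_C (\<lambda>(i, j) w. of_real (Re w) ^ i * (of_real (Im w) ^ j * hermite \<sigma> 0 0 w))"
proof (rule total_C_transport[where T = "\<lambda>(x, y). Complex x y" and c = 1])
  note [measurable] = rapid_measurable[OF rapid_hermite[OF \<sigma>]]
  show "(case k of (i, j) \<Rightarrow> \<lambda>w. of_real (Re w) ^ i * (of_real (Im w) ^ j * hermite \<sigma> 0 0 w))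
      \<in> borel_measurable borel" for k
    by (cases k) simp
  have tot: "total_C (\<lambda>(i, j). tensor (gauss_monomial \<sigma> i) (gauss_monomial \<sigma> j))"
    by (intro total_C_tensor total_gauss_monomial L2_C_gauss_monomial \<sigma>)
  have eq: "(\<lambda>(i, j). tensor (gauss_monomial \<sigma> i) (gauss_monomial \<sigma> j))
      = (\<lambda>k z. (case k of (i, j) \<Rightarrow> \<lambda>w. of_real (Re w) ^ i * (of_real (Im w) ^ j * hermite \<sigma> 0 0 w))
          (case z of (x, y) \<Rightarrow> Complex x y))" (is "?l = ?r")
  proof (intro ext)
    fix k z
    show "?l k z = ?r k z"
      using gauss_monomial_Complex[of \<sigma> "fst k" "Complex (fst z) (snd z)" "snd k"]
      by (simp add: tensor_def case_prod_unfold)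
  qed
  show "total_C (\<lambda>k z. (case k of (i, j)
      \<Rightarrow> \<lambda>w. of_real (Re w) ^ i * (of_real (Im w) ^ j * hermite \<sigma> 0 0 w))
          (case z of (x, y) \<Rightarrow> Complex x y))"
    using tot unfolding eq .
qed (simp_all add: measurable_Complex distr_lborel_Complex density_1)

text \<open>Instead of spans, Q collects the multipliers g for which all g *
  \<open>hermite \<sigma> m n\<close> are orthogonal to f. It holds for 1 and, by
  \<open>Re_Im_mult_hermite\<close>, is stable under multiplication by Re w and Im w. Hence f is
  orthogonal to every monomial times the Gaussian, and these are total. Demanding
  \<open>rapid\<close> in Q keeps the inner products additive.\<close>

lemma total_hermite:
  assumes \<sigma>: "\<sigma> > 0"
  shows "total_C (\<lambda>(m, n). hermite \<sigma> m n)"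
  unfolding total_C_def
proof (intro ballI impI)
  fix f assume f: "f \<in> L2_C" and z: "\<forall>k. ip_C f (case k of (m, n) \<Rightarrow> hermite \<sigma> m n) = 0"
  define Q where "Q g \<longleftrightarrow> (\<forall>m n. rapid (\<lambda>w. g w * hermite \<sigma> m n w) \<and> ip_C (\<lambda>w. g w
      * hermite \<sigma> m n w) f = 0)"
    for g :: "complex \<Rightarrow> complex"
  have lin: "rapid (\<lambda>w. a * (g w * hermite \<sigma> m n w) + b * (g w * hermite \<sigma> m' n' w)
        + c * (g w * hermite \<sigma> k l w) + d * (g w * hermite \<sigma> k' l' w)) \<and>
      ip_C (\<lambda>w. a * (g w * hermite \<sigma> m n w) + b * (g w * hermite \<sigma> m' n' w)
        + c * (g w * hermite \<sigma> k l w) + d * (g w * hermite \<sigma> k' l' w)) f = 0"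
    if "Q g" for g a b c d m n m' n' k l k' l'
  proof -
    have r: "rapid (\<lambda>w. g w * hermite \<sigma> m n w)" "ip_C (\<lambda>w. g w * hermite \<sigma> m n w) f = 0" for m n
      using that by (simp_all add: Q_def)
    show ?thesis
      by (intro conjI rapid_add rapid_cmult r)
        (simp add: ip_C_add_left ip_C_cmult_left f r L2_C_add L2_C_cmult rapid_L2_C)
  qed
  have s0: "\<sigma> \<noteq> 0" using \<sigma> by simp
  have Q_Re: "Q (\<lambda>w. of_real (Re w) * g w)" if g: "Q g" for g
  proof -
    define k :: complex where "k = inverse (2 * of_real \<sigma>)"
    have "(\<lambda>w. of_real (Re w) * g w * hermite \<sigma> m n w)
       = (\<lambda>w. k * (g w * hermite \<sigma> (Suc m) n w) + k * (g w * hermite \<sigma> m (Suc n) w)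
         + k * of_real \<sigma> * of_nat n * (g w * hermite \<sigma> m (n - 1) w)
         + k * of_real \<sigma> * of_nat m * (g w * hermite \<sigma> (m - 1) n w))" for m n
    proof
      fix w
      have "of_real (Re w) * g w * hermite \<sigma> m n w = g w * (of_real (Re w) * hermite \<sigma> m n w)"
        by (simp only: mult_ac)
      then show "of_real (Re w) * g w * hermite \<sigma> m n w
        = k * (g w * hermite \<sigma> (Suc m) n w) + k * (g w * hermite \<sigma> m (Suc n) w)
         + k * of_real \<sigma> * of_nat n * (g w * hermite \<sigma> m (n - 1) w)
         + k * of_real \<sigma> * of_nat m * (g w * hermite \<sigma> (m - 1) n w)"
        unfolding Re_Im_mult_hermite(1)[OF s0, folded k_def] by (simp add: algebra_simps)
    qed
    then show ?thesis unfolding Q_def by (simp only: lin[OF g] simp_thms)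
  qed
  have Q_Im: "Q (\<lambda>w. of_real (Im w) * g w)" if g: "Q g" for g
  proof -
    define k :: complex where "k = inverse (2 * \<i> * of_real \<sigma>)"
    have "(\<lambda>w. of_real (Im w) * g w * hermite \<sigma> m n w)
       = (\<lambda>w. k * (g w * hermite \<sigma> (Suc m) n w) + - k * (g w * hermite \<sigma> m (Suc n) w)
         + k * of_real \<sigma> * of_nat n * (g w * hermite \<sigma> m (n - 1) w)
         + - k * of_real \<sigma> * of_nat m * (g w * hermite \<sigma> (m - 1) n w))" for m n
    proof
      fix w
      have "of_real (Im w) * g w * hermite \<sigma> m n w = g w * (of_real (Im w) * hermite \<sigma> m n w)"
        by (simp only: mult_ac)
      then show "of_real (Im w) * g w * hermite \<sigma> m n w
        = k * (g w * hermite \<sigma> (Suc m) n w) + - k * (g w * hermite \<sigma> m (Suc n) w)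
         + k * of_real \<sigma> * of_nat n * (g w * hermite \<sigma> m (n - 1) w)
         + - k * of_real \<sigma> * of_nat m * (g w * hermite \<sigma> (m - 1) n w)"
        unfolding Re_Im_mult_hermite(2)[OF s0, folded k_def] by (simp add: algebra_simps)
    qed
    then show ?thesis unfolding Q_def by (simp only: lin[OF g] simp_thms)
  qed
  have "ip_C f (hermite \<sigma> m n) = 0" for m n using z by auto
  then have "ip_C (hermite \<sigma> m n) f = 0" for m n by (subst ip_C_cnj[symmetric]) simp
  then have "Q (\<lambda>w. 1)" by (simp add: Q_def rapid_hermite \<sigma>)
  then have "Q (\<lambda>w. of_real (Im w) ^ j)" for j
    by (induction j) (auto dest: Q_Im)
  then have "Q (\<lambda>w. of_real (Re w) ^ i * of_real (Im w) ^ j)" for i j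
    by (induction i) (auto dest: Q_Re simp: mult.assoc)
  then have "ip_C (\<lambda>w. of_real (Re w) ^ i * (of_real (Im w) ^ j * hermite \<sigma> 0 0 w)) f = 0" for i j
    unfolding Q_def by (simp add: mult.assoc)
  then have "ip_C f (\<lambda>w. of_real (Re w) ^ i * (of_real (Im w) ^ j * hermite \<sigma> 0 0 w)) = 0" for i j
    by (subst ip_C_cnj[symmetric]) simp
  then show "AE w in lborel. f w = 0"
    using total_gauss_monomial_Complex[OF \<sigma>] f unfolding total_C_def by (auto simp: split_def)
qed

lemma orthogonal_basis_hermite:
  assumes \<sigma>: "\<sigma> > 0"
  shows "orthogonal_basis_C (\<lambda>(m, n). hermite \<sigma> m n)"
proof -
  have "sq_C (hermite \<sigma> m n) \<noteq> 0" for m n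
  proof
    assume "sq_C (hermite \<sigma> m n) = 0"
    then have "ip_C (hermite \<sigma> m n) (hermite \<sigma> m n) = 0"
      by (simp flip: sq_C_eq_ip_C)
    then show False using \<sigma> hpoly_0_eq_0_iff[of \<sigma>] by (simp add: ip_C_hermite)
  qed
  moreover have "ip_C (hermite \<sigma> m n) (hermite \<sigma> k l) = 0" if "(m, n) \<noteq> (k, l)" for m n k l
    using that \<sigma> hpoly_0_eq_0_iff[of \<sigma>] by (auto simp: ip_C_hermite)
  ultimately show ?thesis
    using total_hermite[OF \<sigma>] rapid_L2_C[OF rapid_hermite[OF \<sigma>]]
    by (auto simp: orthogonal_basis_C_def)
qed

section \<open>The Fourier--Wigner transform of Hermite functions\<close>

text \<open>Absorbs the constants (- 1) ^ (m' + n') / 2 and the regrouping (m, n, m', n') \<mapsto>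
  ((m, m'), (n, n')).\<close>

lemma orthogonal_basis_C_reindex:
  assumes b: "orthogonal_basis_C b" and \<pi>: "bij \<pi>" and c: "\<And>k. c k \<noteq> 0"
  shows "orthogonal_basis_C (\<lambda>k x. c k * b (\<pi> k) x)"
proof -
  have ip: "ip_C f (\<lambda>x. c k * g x) = cnj (c k) * ip_C f g" for f g k
    by (simp add: ip_C_def mult_ac flip: integral_mult_right_zero)
  have "of_real (sq_C (\<lambda>x. c k * b (\<pi> k) x)) = c k * cnj (c k) * complex_of_real (sq_C (b (\<pi> k)))"
      for k
    by (simp add: sq_C_eq_ip_C ip ip_C_cmult_left)
  moreover have "c k * cnj (c k) * complex_of_real (sq_C (b (\<pi> k))) \<noteq> 0" for k
    using c[of k] basis_sq_C_pos[OF b, of "\<pi> k"] by simp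
  ultimately have "sq_C (\<lambda>x. c k * b (\<pi> k) x) \<noteq> 0" for k
    by (metis of_real_0)
  moreover have "total_C (\<lambda>k x. c k * b (\<pi> k) x)"
    unfolding total_C_def
  proof (intro ballI impI)
    fix f :: "'b \<Rightarrow> complex"
    assume f: "f \<in> L2_C" and z: "\<forall>k. ip_C f (\<lambda>x. c k * b (\<pi> k) x) = 0"
    have "ip_C f (b (\<pi> k)) = 0" for k
      using spec[OF z, of k] c[of k] by (simp add: ip)
    then have "ip_C f (b k) = 0" for k using bij_is_surj[OF \<pi>] by (metis surjD)
    then show "AE x in lborel. f x = 0"
      using b f unfolding orthogonal_basis_C_def total_C_def by blast
  qed
  moreover have "\<pi> k \<noteq> \<pi> l" if "k \<noteq> l" for k l
    using that bij_is_inj[OF \<pi>] by (simp add: inj_eq)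
  ultimately show ?thesis
    using basis_L2_C[OF b] basis_ip_C[OF b]
    by (auto simp: orthogonal_basis_C_def ip ip_C_cmult_left intro: L2_C_cmult)
qed

text \<open>One idempotent component of the integrand of \<open>fourier_wigner\<close>, with
  \<epsilon> the corresponding component of \<nu> or \<mu>.\<close>

definition wigner_integrand ::
    "real \<Rightarrow> complex \<Rightarrow> (complex \<Rightarrow> complex) \<Rightarrow> (complex \<Rightarrow> complex) \<Rightarrow> complex \<Rightarrow> complex \<Rightarrow> complex
        \<Rightarrow> complex"
  where "wigner_integrand \<sigma> \<epsilon> \<phi> \<psi> x y U
      = exp ((\<sigma> * inner (U - x / 2) y) *\<^sub>R \<epsilon>) * \<phi> U * cnj (\<psi> (U - x))"

context
  fixes \<sigma> :: real and \<epsilon> :: complex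
  assumes \<sigma>: "\<sigma> > 0" and \<epsilon>: "\<epsilon> = \<i> \<or> \<epsilon> = - \<i>"
begin

text \<open>Centring makes the Hermite arguments w + a and w - a, whose Gaussians multiply to exp (-
  \<sigma> (|a|^2 + |w|^2)) by the parallelogram law. As cnj \<epsilon> = - \<epsilon>, the phase
  \<epsilon> <w, y> is p w - cnj p cnj w with p = \<epsilon> cnj y / 2, the form in
  \<open>gauss\<close>.\<close>

lemma wigner_integrand_hermite_shift:
  "wigner_integrand \<sigma> \<epsilon> (hermite \<sigma> m n) (hermite \<sigma> m' n') x y (x / 2 + w)
    = of_real (exp (- \<sigma> * (norm (x / 2))\<^sup>2)) * hgauss \<sigma> (x / 2) (\<epsilon> * cnj y / 2) m n n' m' w"
proof -
  have cnj_\<epsilon>: "cnj \<epsilon> = - \<epsilon>" using \<epsilon> by auto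
  define a where "a = x / 2"
  define p where "p = \<epsilon> * cnj y / 2"
  have inner: "complex_of_real (inner w y) = (w * cnj y + cnj w * y) / 2"
    by (simp add: inner_complex_def complex_eq_iff)
  have sq: "complex_of_real ((norm z)\<^sup>2) = z * cnj z" for z by (rule complex_norm_square)
  have "exp ((\<sigma> * inner w y) *\<^sub>R \<epsilon>) * (of_real (exp (- \<sigma> / 2 * (norm (w
      + a))\<^sup>2)) * of_real (exp (- \<sigma> / 2 * (norm (w - a))\<^sup>2)))
      = of_real (exp (- \<sigma> * (norm a)\<^sup>2)) * gauss \<sigma> p w"
    unfolding gauss_def scaleR_conv_of_real of_real_mult of_real_minus of_real_divide inner sq
      exp_of_real[symmetric] exp_add[symmetric]
    by (rule arg_cong[where f = exp]) (simp add: p_def cnj_\<epsilon> field_simps)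
  moreover have "wigner_integrand \<sigma> \<epsilon> (hermite \<sigma> m n) (hermite \<sigma> m' n') x y (x / 2 + w)
      = (hpoly \<sigma> m n (w + a) * hpoly \<sigma> n' m' (w - a)) * (exp ((\<sigma> * inner w y) *\<^sub>R \<epsilon>) *
        (of_real (exp (- \<sigma> / 2 * (norm (w + a))\<^sup>2)) * of_real (exp (- \<sigma> / 2 * (norm (w - a))\<^sup>2))))"
  proof -
    have "x / 2 + w - x / 2 = w" "x / 2 + w = w + a" "w + a - x = w - a"
        by (simp_all add: a_def field_simps)
    then show ?thesis
      unfolding wigner_integrand_def hermite_eq
      by (simp only: complex_cnj_mult cnj_hpoly complex_cnj_complex_of_real mult_ac)
  qed
  ultimately show ?thesis
    by (simp only: hgauss_def a_def p_def mult_ac)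
qed

lemma distr_shift: "distr lborel borel ((+) c) = density lborel (\<lambda>_. ennreal 1)" for c :: complex
  using lborel_distr_plus[of c] by (simp add: density_1)

lemma wigner_integrand_measurable:
  "wigner_integrand \<sigma> \<epsilon> (hermite \<sigma> m n) (hermite \<sigma> m' n') x y \<in> borel_measurable borel"
proof -
  note [measurable] = rapid_measurable[OF rapid_hermite[OF \<sigma>]]
  show ?thesis unfolding wigner_integrand_def by measurable
qed

lemma wigner_integrand_integrable:
  "integrable lborel (wigner_integrand \<sigma> \<epsilon> (hermite \<sigma> m n) (hermite \<sigma> m' n') x y)"
proof -
  have "integrable lborel (\<lambda>w. wigner_integrand \<sigma> \<epsilon> (hermite \<sigma> m n) (hermite \<sigma> m' n') x y (x / 2
      + w))"
    unfolding wigner_integrand_hermite_shift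
    by (intro rapid_integrable rapid_cmult rapid_hgauss \<sigma>)
  then show ?thesis
    by (subst (asm) integrable_transport[OF _ _ distr_shift])
        (simp_all add: wigner_integrand_measurable)
qed

lemma integral_wigner_integrand:
  "of_real (\<sigma> / (2 * pi)) * (LINT U|lborel. wigner_integrand \<sigma> \<epsilon> (hermite \<sigma> m n)
      (hermite \<sigma> m' n') x y U)
    = ((- 1) ^ (m' + n') / 2) * (hermite \<sigma> m m' ((x
        + \<epsilon> * y) / 2) * hermite \<sigma> n n' (cnj ((x - \<epsilon> * y) / 2)))"
proof -
  have cnj_\<epsilon>: "cnj \<epsilon> = - \<epsilon>" using \<epsilon> by auto
  define a where "a = x / 2"
  define p where "p = \<epsilon> * cnj y / 2"
  define P where "P = (x + \<epsilon> * y) / 2"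
  define R where "R = cnj ((x - \<epsilon> * y) / 2)"
  have P: "a - cnj p = P" and R: "cnj a + p = R"
    by (simp_all add: a_def p_def P_def R_def cnj_\<epsilon> field_simps)
  let ?W = "wigner_integrand \<sigma> \<epsilon> (hermite \<sigma> m n) (hermite \<sigma> m' n') x y"
  have "(LINT w|lborel. ?W (x / 2 + w)) = 1 *\<^sub>R (LINT U|lborel. ?W U)"
    by (rule integral_transport[OF _ _ distr_shift]) (simp_all add: wigner_integrand_measurable)
  then have "(LINT U|lborel. ?W U) = (LINT w|lborel. ?W (x / 2 + w))" by simp
  also have "\<dots> = of_real (exp (- \<sigma> * (norm a)\<^sup>2)) * hgauss_int \<sigma> a p m n n' m'"
    unfolding wigner_integrand_hermite_shift by (simp add: a_def p_def hgauss_int_def)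
  finally have 1: "(LINT U|lborel. ?W U) = of_real (exp (- \<sigma> * (norm a)\<^sup>2))
      * (of_real (pi / \<sigma> * exp (- \<sigma> * (norm p)\<^sup>2)) * (- 1) ^ (n'
          + m') * (hpoly \<sigma> m m' P * hpoly \<sigma> n n' R))"
    unfolding integral_hgauss[OF \<sigma>] P R .
  \<comment> \<open>The parallelogram law for P = a - cnj p and cnj R = a + cnj p splits the
    prefactor into the Gaussians of the two Hermite functions.\<close>
  have "exp (- \<sigma> * (norm a)\<^sup>2) * exp (- \<sigma> * (norm p)\<^sup>2)
      = exp (- \<sigma> / 2 * (norm P)\<^sup>2) * exp (- \<sigma> / 2 * (norm R)\<^sup>2)"
  proof -
    have "(norm P)\<^sup>2 + (norm R)\<^sup>2 = 2 * ((norm a)\<^sup>2 + (norm p)\<^sup>2)"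
      unfolding P[symmetric] R[symmetric] cmod_power2 by (simp add: power2_eq_square algebra_simps)
    then have "- \<sigma> * (norm a)\<^sup>2 + - \<sigma> * (norm p)\<^sup>2 = - \<sigma> / 2 * (norm P)\<^sup>2 + - \<sigma> / 2 * (norm R)\<^sup>2"
      by (simp add: field_simps) (metis distrib_left mult.left_commute)
    then show ?thesis by (simp only: exp_add[symmetric])
  qed
  then have 2: "complex_of_real (exp (- \<sigma> * (norm a)\<^sup>2)) * of_real (exp (- \<sigma> * (norm p)\<^sup>2))
      = of_real (exp (- \<sigma> / 2 * (norm P)\<^sup>2)) * of_real (exp (- \<sigma> / 2 * (norm R)\<^sup>2))"
    by (simp only: flip: of_real_mult)
  have 3: "complex_of_real (\<sigma> / (2 * pi)) * of_real (pi / \<sigma>) = 1 / 2"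
    using \<sigma> by simp
  have "of_real (\<sigma> / (2 * pi)) * (LINT U|lborel. ?W U)
      = (complex_of_real (\<sigma> / (2 * pi)) * of_real (pi / \<sigma>)) * (- 1) ^ (m' + n')
        * (complex_of_real (exp (- \<sigma> * (norm a)\<^sup>2)) * of_real (exp (- \<sigma> * (norm p)\<^sup>2)))
        * (hpoly \<sigma> m m' P * hpoly \<sigma> n n' R)"
    unfolding 1 of_real_mult[of "pi / \<sigma>"] by (simp only: mult_ac add_ac)
  then show ?thesis
    unfolding 2 3 hermite_eq P_def[symmetric] R_def[symmetric] by (simp add: mult_ac)
qed

lemma orthogonal_basis_wigner:
  "orthogonal_basis_C (\<lambda>(m, n, m', n') Z. of_real (\<sigma> / (2 * pi)) *
    (LINT U|lborel. wigner_integrand \<sigma> \<epsilon> (hermite \<sigma> m n) (hermite \<sigma> m' n') (re_vec Z)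
        (im_vec Z) U))"
    (is "orthogonal_basis_C ?b")
proof -
  define h where "h = (\<lambda>(m, n, m', n') (x, y). ((- 1) ^ (m' + n') / 2) *
    (hermite \<sigma> m m' ((x + \<epsilon> * y) / 2) * hermite \<sigma> n n' (cnj ((x - \<epsilon> * y) / 2))))"
  note [measurable] = rapid_measurable[OF rapid_hermite[OF \<sigma>]]
  have hm: "h k \<in> borel_measurable borel" for k
    unfolding h_def borel_prod[symmetric] by (cases k) simp
  have b_h: "?b k (pair_to_bicomplex z) = h k z" for k z
    by (cases k; cases z) (simp only: prod.case re_im_vec_pair integral_wigner_integrand h_def)
  have "continuous_on UNIV re_vec" "continuous_on UNIV im_vec"
    by (auto intro!: linear_continuous_on simp: linear_conv_bounded_linear[symmetric] linear_iff re_vec_def im_vec_def complex_eq_iff)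
  then have [measurable]: "re_vec \<in> borel \<rightarrow>\<^sub>M borel" "im_vec \<in> borel \<rightarrow>\<^sub>M borel"
    by (simp_all add: borel_measurable_continuous_onI)
  \<comment> \<open>The closed form of the integral makes its measurability in Z immediate.\<close>
  have bm: "?b k \<in> borel_measurable borel" for k
    by (cases k) (simp only: prod.case integral_wigner_integrand, measurable)
  have bij: "bij (\<lambda>(m, n, m', n'). ((m, m'), (n, n')))"
    by (rule o_bij[of "\<lambda>((m, m'), (n, n')). (m, n, m', n')"]) auto
  \<comment> \<open>After \<open>mix\<close> the two Hermite arguments are P and R themselves, and a
    reindexed, rescaled tensor product is left.\<close>
  have "orthogonal_basis_C (\<lambda>k z. h k (mix \<epsilon> z))"
  proof -
    have "\<epsilon> * \<epsilon> = - 1" using \<epsilon> by auto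
    then have \<epsilon>2: "\<epsilon> * (\<epsilon> * z) = - z" for z by (metis mult.assoc mult_minus1)
    have "(P + cnj R + \<epsilon> * (\<epsilon> * (cnj R - P))) / 2 = P" "cnj ((P
        + cnj R - \<epsilon> * (\<epsilon> * (cnj R - P))) / 2) = R" for P R
      unfolding \<epsilon>2 by simp_all
    then have eq: "h k (mix \<epsilon> z) = (case k of (m, n, m', n') \<Rightarrow> (- 1) ^ (m' + n') / 2) *
        (case (case k of (m, n, m', n') \<Rightarrow> ((m, m'), (n, n'))) of (k, l) \<Rightarrow>
          tensor (case k of (m, n) \<Rightarrow> hermite \<sigma> m n) (case l of (m, n) \<Rightarrow> hermite \<sigma> m n)) z" for k z
      by (cases k; cases z) (simp only: h_def mix_def tensor_def prod.case)
    show ?thesis unfolding eq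
      by (rule orthogonal_basis_C_reindex[OF orthogonal_basis_C_tensor[OF orthogonal_basis_hermite[OF \<sigma>]
        orthogonal_basis_hermite[OF \<sigma>]] bij]) auto
  qed
  from orthogonal_basis_C_transport[OF borel_measurable_continuous_onI[OF continuous_mix] _ distr_lborel_mix[OF \<epsilon>] hm this]
  have "orthogonal_basis_C h" by simp
  then have "orthogonal_basis_C (\<lambda>k z. ?b k (pair_to_bicomplex z))"
    unfolding b_h by simp
  then show ?thesis
    using distr_lborel_pair_to_bicomplex
    by (intro orthogonal_basis_C_transport[where c
        = 1, OF pair_to_bicomplex_measurable _ _ bm]) (simp_all add: density_1)
qed

end

theorem corollary4p5:
  fixes \<sigma> :: real and \<nu> \<mu> :: bicomplex
  assumes "\<sigma> > 0" and "\<nu>\<^sup>2 = - 1" and "\<mu>\<^sup>2 = - 1"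
  shows "L2_orthogonal_basis
    (\<lambda>(m, n, m', n'). fourier_wigner \<sigma> \<nu> \<mu> (hermite_T \<sigma> m n) (hermite_T \<sigma> m' n'))"
proof -
  let ?W = "\<lambda>\<epsilon> m n m' n' Z. wigner_integrand \<sigma> \<epsilon> (hermite \<sigma> m n) (hermite \<sigma> m' n') (re_vec Z)
      (im_vec Z)"
  have sq: "z = \<i> \<or> z = - \<i>" if "z\<^sup>2 = - 1" for z :: complex
    using that power2_eq_iff[of z \<i>] by simp
  \<comment> \<open>The components of \<open>\<nu> * e_plus + \<mu> * e_minus\<close> are
    \<open>plus_part \<nu>\<close> and \<open>minus_part \<mu>\<close>. Taking components is
    multiplicative, so each squares to - 1 in the field of complex numbers and must be \<i> or -
    \<i>; for j, too, both components have this form.\<close>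
  have "(plus_part \<nu>)\<^sup>2 = - 1" "(minus_part \<mu>)\<^sup>2 = - 1"
    using arg_cong[OF assms(2), of plus_part] arg_cong[OF assms(3), of minus_part]
    by (simp_all add: power2_eq_square)
  then have \<nu>: "plus_part \<nu> = \<i> \<or> plus_part \<nu> = - \<i>" and \<mu>: "minus_part \<mu> = \<i> \<or> minus_part \<mu> = - \<i>"
    by (simp_all add: sq)
  have parts: "plus_part (hermite_T \<sigma> m n U) = hermite \<sigma> m n U" "minus_part (hermite_T \<sigma> m n U)
      = hermite \<sigma> m n U" for m n U
    by (simp_all add: hermite_T_def)
  let ?F = "\<lambda>m n m' n' Z U. bc_exp ((\<sigma> * inner (U - re_vec Z / 2) (im_vec Z)) *\<^sub>R (\<nu> * e_plus
      + \<mu> * e_minus)) *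
      hermite_T \<sigma> m n U * bc_cnj (hermite_T \<sigma> m' n' (U - re_vec Z))"
  have F: "plus_part (?F m n m' n' Z U) = ?W (plus_part \<nu>) m n m' n' Z U"
    "minus_part (?F m n m' n' Z U) = ?W (minus_part \<mu>) m n m' n' Z U" for m n m' n' Z U
    by (simp_all add: parts wigner_integrand_def)
  have int: "integrable lborel (?F m n m' n' Z)" for m n m' n' Z
    unfolding integrable_bicomplex_iff F
    by (intro conjI wigner_integrand_integrable assms(1) \<nu> \<mu>)
  have p: "plus_part (fourier_wigner \<sigma> \<nu> \<mu> (hermite_T \<sigma> m n) (hermite_T \<sigma> m' n') Z)
      = of_real (\<sigma> / (2 * pi)) * (LINT U|lborel. ?W (plus_part \<nu>) m n m' n' Z U)"
    and m: "minus_part (fourier_wigner \<sigma> \<nu> \<mu> (hermite_T \<sigma> m n) (hermite_T \<sigma> m' n') Z)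
      = of_real (\<sigma> / (2 * pi)) * (LINT U|lborel. ?W (minus_part \<mu>) m n m' n' Z U)" for m n m' n' Z
    unfolding fourier_wigner_def parts_simps(13,14) integral_parts[OF int] F
    by (simp_all only: scaleR_conv_of_real)
  show ?thesis
  proof (rule L2_orthogonal_basisI)
    show "orthogonal_basis_C (\<lambda>k Z. plus_part ((case k of (m, n, m', n') \<Rightarrow>
        fourier_wigner \<sigma> \<nu> \<mu> (hermite_T \<sigma> m n) (hermite_T \<sigma> m' n')) Z))"
      using orthogonal_basis_wigner[OF assms(1) \<nu>] by (simp add: case_prod_unfold p)
    show "orthogonal_basis_C (\<lambda>k Z. minus_part ((case k of (m, n, m', n') \<Rightarrow>
        fourier_wigner \<sigma> \<nu> \<mu> (hermite_T \<sigma> m n) (hermite_T \<sigma> m' n')) Z))"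
      using orthogonal_basis_wigner[OF assms(1) \<mu>] by (simp add: case_prod_unfold m)
  qed
qed

end
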